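(* For every $n\in\{2,3,\dots,9\}$ the spectrum of the Neumann Laplacian on the Vicsek set $\mathcal{VS}_n$ exhibits spectral clustering: for every positive integer $N$ and every $\varepsilon>0$ there exists an interval $I$ of length $\varepsilon$ that contains $N$ distinct eigenvalues.
   Context: Vicsek set. For $n\ge2$, $\mathcal{VS}_n$ is the self-similar set in the unit square generated by the $4n-3$ orientation-preserving homotheties $F_i$ of ratio $1/(2n-1)$ that map the unit square onto the $4n-3$ subsquares lying along the two diagonals of the $(2n-1)\times(2n-1)$ grid of subsquares. $V_0$ is the set of the four corners, $\Gamma_0$ the complete graph on $V_0$; $V_m=\bigcup_iF_i(V_{m-1})$, and $\Gamma_m$ is the graph on $V_m$ in which two vertices are adjacent iff both are corners of a common $m$-cell. The graph Laplacian is $\Delta_mu(x)=\frac1{\deg x}\sum_{y\sim x}(u(y)-u(x))$ for all $x\in V_m$ (Neumann boundary conditions). Put $\rho_n=(4n-3)(2n-1)$. The Neumann Laplacian on $\mathcal{VS}_n$ is $\Delta u=\lim_m\rho_n^m\Delta_mu$; eigenvalues are those of $-\Delta$. Spectral decimation (known description of the spectrum). Let $U_k$ be the Chebyshev polynomials of the second kind, $g_n(\lambda)=U_{n-1}(3\lambda-1)-U_{n-2}(3\lambda-1)$, $h_n(\lambda)=U_{n-1}(3\lambda-1)-3U_{n-2}(3\lambda-1)$ and $R(\lambda)=\lambda g_n(\lambda)h_n(\lambda)$ (for $n=2$, $R(\lambda)=36\lambda^3-48\lambda^2+15\lambda$). Let $\phi_1<\cdots<\phi_{2n-1}$ be the inverse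 branches of $R$ on $[0,4/3]$. The eigenvalues are exactly the numbers of the forms: (a) ($0$-series) $\lim_{m\to\infty}\rho_n^m\phi_{w_m}\circ\cdots\circ\phi_{w_1}(0)$, where all but finitely many $w_j$ equal $1$, and the first $w_j\ne1$ (if any) is odd; (b) ($4/3$-series, born on level $k\ge0$) $\lim_{m\to\infty}\rho_n^{m+k}\phi_{w_m}\circ\cdots\circ\phi_{w_1}(4/3)$, where all but finitely many $w_j$ equal $1$, $w_1$ is odd and $w_1\ne2n-1$. *)

theory Defs
  imports "HOL-Analysis.Analysis"
begin

text \<open>
  The subsquare in column \<open>i\<close> and row \<open>j\<close> (counted from \<open>0\<close>) of the
  \<open>(2n-1) \<times> (2n-1)\<close> grid is indexed by \<open>(i, j)\<close>.
\<close>

definition vicsek_index :: "nat \<Rightarrow> (nat \<times> nat) set" where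
  "vicsek_index n = {(i, j). i < 2 * n - 1 \<and> j < 2 * n - 1 \<and> (i = j \<or> i + j = 2 * n - 2)}"

definition vicsek_map :: "nat \<Rightarrow> nat \<times> nat \<Rightarrow> real \<times> real \<Rightarrow> real \<times> real" where
  "vicsek_map n ij p = (1 / (2 * real n - 1)) *\<^sub>R (p + (real (fst ij), real (snd ij)))"

definition vicsek_set :: "nat \<Rightarrow> (real \<times> real) set" where
  "vicsek_set n =
     (THE K. compact K \<and> K \<noteq> {} \<and> K = (\<Union>i\<in>vicsek_index n. vicsek_map n i ` K))"

definition square_corners :: "(real \<times> real) set" where
  "square_corners = {0, 1} \<times> {0, 1}"

fun vicsek_vertices :: "nat \<Rightarrow> nat \<Rightarrow> (real \<times> real) set" where
  "vicsek_vertices n 0 = square_corners"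
| "vicsek_vertices n (Suc m) = (\<Union>i\<in>vicsek_index n. vicsek_map n i ` vicsek_vertices n m)"

text \<open>An \<open>m\<close>-cell is represented by the set of its four corners.\<close>

definition vicsek_cells :: "nat \<Rightarrow> nat \<Rightarrow> (real \<times> real) set set" where
  "vicsek_cells n m =
     {foldr (vicsek_map n) w ` square_corners | w. length w = m \<and> set w \<subseteq> vicsek_index n}"

definition vicsek_adj :: "nat \<Rightarrow> nat \<Rightarrow> real \<times> real \<Rightarrow> real \<times> real \<Rightarrow> bool" where
  "vicsek_adj n m x y \<longleftrightarrow> x \<noteq> y \<and> (\<exists>C\<in>vicsek_cells n m. x \<in> C \<and> y \<in> C)"

definition vicsek_nbrs :: "nat \<Rightarrow> nat \<Rightarrow> real \<times> real \<Rightarrow> (real \<times> real) set" where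
  "vicsek_nbrs n m x = {y \<in> vicsek_vertices n m. vicsek_adj n m x y}"

definition graph_laplacian ::
    "nat \<Rightarrow> nat \<Rightarrow> (real \<times> real \<Rightarrow> real) \<Rightarrow> real \<times> real \<Rightarrow> real" where
  "graph_laplacian n m u x =
     (1 / real (card (vicsek_nbrs n m x))) * (\<Sum>y\<in>vicsek_nbrs n m x. u y - u x)"

definition vicsek_rho :: "nat \<Rightarrow> real" where
  "vicsek_rho n = (4 * real n - 3) * (2 * real n - 1)"

text \<open>
  \<open>has_neumann_laplacian n u f\<close> says that \<open>u\<close> is in the domain of the Neumann Laplacian and that
  its Laplacian is \<open>f\<close>. As usual for Laplacians on self-similar sets, \<open>u\<close> and \<open>f\<close> are continuous
  on the whole set and the limit of the renormalised graph Laplacians is uniform over the vertices.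
  Here the four boundary corners are among those vertices, which encodes the Neumann condition.
\<close>

definition has_neumann_laplacian ::
    "nat \<Rightarrow> (real \<times> real \<Rightarrow> real) \<Rightarrow> (real \<times> real \<Rightarrow> real) \<Rightarrow> bool" where
  "has_neumann_laplacian n u f \<longleftrightarrow>
     continuous_on (vicsek_set n) u \<and> continuous_on (vicsek_set n) f \<and>
     (\<forall>e>0. \<forall>\<^sub>F m in sequentially. \<forall>x\<in>vicsek_vertices n m.
        \<bar>vicsek_rho n ^ m * graph_laplacian n m u x - f x\<bar> < e)"

definition neumann_eigenvalues :: "nat \<Rightarrow> real set" where
  "neumann_eigenvalues n =
     {ev. \<exists>u. (\<exists>x\<in>vicsek_set n. u x \<noteq> 0) \<and> has_neumann_laplacian n u (\<lambda>x. - (ev * u x))}"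

definition spectral_clustering :: "real set \<Rightarrow> bool" where
  "spectral_clustering E \<longleftrightarrow>
     (\<forall>N::nat. \<forall>\<epsilon>::real. N > 0 \<and> \<epsilon> > 0 \<longrightarrow>
        (\<exists>a. \<exists>S \<subseteq> E \<inter> {a..a + \<epsilon>}. finite S \<and> card S = N))"


subsection \<open>The description of the Vicsek set is definite\<close>

lemma dist_vicsek_map:
  assumes "n \<ge> 2"
  shows "dist (vicsek_map n i p) (vicsek_map n i q) = (1 / (2 * real n - 1)) * dist p q"
proof -
  have "vicsek_map n i p - vicsek_map n i q = (1 / (2 * real n - 1)) *\<^sub>R (p - q)"
    unfolding vicsek_map_def by (simp flip: scaleR_diff_right)
  then show ?thesis
    using assms by (simp add: dist_norm)
qed

lemma finite_vicsek_index: "finite (vicsek_index n)"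
  by (rule finite_subset[of _ "{..<2 * n - 1} \<times> {..<2 * n - 1}"]) (auto simp: vicsek_index_def)

lemma card_vicsek_index:
  assumes "n \<ge> 2"
  shows "card (vicsek_index n) = 4 * n - 3"
proof -
  define A where "A = (\<lambda>i. (i, i)) ` {..<2 * n - 1}"
  define B where "B = (\<lambda>i. (i, 2 * n - 2 - i)) ` {..<2 * n - 1}"
  have "vicsek_index n = A \<union> B"
    using assms by (auto simp: vicsek_index_def A_def B_def image_iff)
  moreover have "A \<inter> B = {(n - 1, n - 1)}"
    using assms by (auto simp: A_def B_def image_iff)
  moreover have "card A = 2 * n - 1" "card B = 2 * n - 1"
    by (auto simp: A_def B_def card_image inj_on_def)
  moreover have "finite A" "finite B"
    by (auto simp: A_def B_def)
  ultimately show ?thesis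
    using card_Un_Int[of A B] by simp
qed

lemma vicsek_vertices_subset_square:
  assumes "n \<ge> 2"
  shows "vicsek_vertices n m \<subseteq> {0..1} \<times> {0..1}"
proof (induction m)
  case 0
  show ?case by (auto simp: square_corners_def)
next
  case (Suc m)
  have "vicsek_map n i p \<in> {0..1} \<times> {0..1}"
    if i: "i \<in> vicsek_index n" and p: "p \<in> {0..1} \<times> {0..1}" for i p
  proof -
    obtain a b where ab: "i = (a, b)" by (cases i)
    obtain x y where xy: "p = (x, y)" by (cases p)
    have "a + 2 \<le> 2 * n" "b + 2 \<le> 2 * n"
      using i ab by (auto simp: vicsek_index_def)
    then have ab': "real a + 1 \<le> 2 * real n - 1" "real b + 1 \<le> 2 * real n - 1"
      by linarith+
    have pos: "0 < 2 * real n - 1"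
      using assms by linarith
    have "0 \<le> x" "x \<le> 1" "0 \<le> y" "y \<le> 1"
      using p xy by auto
    then have "0 \<le> (x + real a) / (2 * real n - 1)" "(x + real a) / (2 * real n - 1) \<le> 1"
      "0 \<le> (y + real b) / (2 * real n - 1)" "(y + real b) / (2 * real n - 1) \<le> 1"
      using pos ab' by (simp_all add: pos_divide_le_eq)
    then show ?thesis
      by (simp add: vicsek_map_def ab xy)
  qed
  then show ?case
    using Suc unfolding vicsek_vertices.simps by blast
qed

lemma vicsek_vertices_mono_Suc:
  assumes "n \<ge> 2"
  shows "vicsek_vertices n m \<subseteq> vicsek_vertices n (Suc m)"
proof (induction m)
  case 0
  have "p \<in> vicsek_vertices n (Suc 0)" if p: "p \<in> square_corners" for p
  proof -
    have r: "real (2 * n - 2) = 2 * real n - 2" and pos: "2 * real n - 1 \<noteq> 0"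
      using assms by (simp_all add: of_nat_diff)
    obtain x y where xy1: "p = (x, y)" by (cases p)
    have xy: "x = 0 \<or> x = 1" "y = 0 \<or> y = 1"
      using p unfolding square_corners_def xy1 mem_Times_iff by simp_all
    define c where "c t = (if t = 0 then 0 else 2 * n - 2)" for t :: real
    have "(c x, c y) \<in> vicsek_index n"
      using assms by (simp add: vicsek_index_def c_def; linarith)
    moreover have "(1 / (2 * real n - 1)) * (t + real (c t)) = t" if "t = 0 \<or> t = 1" for t
      using that r pos by (elim disjE) (simp_all add: c_def)
    then have "p = vicsek_map n (c x, c y) p"
      using xy by (simp add: vicsek_map_def xy1)
    then have "p \<in> vicsek_map n (c x, c y) ` square_corners"
      using p by (rule image_eqI)
    ultimately show ?thesis
      unfolding vicsek_vertices.simps by (rule UN_I)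
  qed
  then show ?case
    unfolding vicsek_vertices.simps(1) by blast
next
  case (Suc m)
  have "(\<Union>i\<in>vicsek_index n. vicsek_map n i ` vicsek_vertices n m)
      \<subseteq> (\<Union>i\<in>vicsek_index n. vicsek_map n i ` vicsek_vertices n (Suc m))"
    by (intro UN_mono image_mono Suc order_refl)
  then show ?case
    unfolding vicsek_vertices.simps(2)[symmetric] .
qed

lemma closure_Union_finite:
  assumes "finite I"
  shows "closure (\<Union>i\<in>I. f i) = (\<Union>i\<in>I. closure (f i))"
  using assms by (induction I) simp_all

lemma vicsek_fixpoint_closure:
  assumes "n \<ge> 2"
  defines "K \<equiv> closure (\<Union>m. vicsek_vertices n m)"
  shows "compact K" "K \<noteq> {}" "K = (\<Union>i\<in>vicsek_index n. vicsek_map n i ` K)"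
proof -
  define V where "V = (\<Union>m. vicsek_vertices n m)"
  have KV: "K = closure V"
    by (simp add: K_def V_def)
  have "V \<subseteq> {0..1} \<times> {0..1}"
    using vicsek_vertices_subset_square[OF assms(1)] by (auto simp: V_def)
  then have "bounded V"
    by (rule bounded_subset[rotated]) (intro bounded_Times bounded_closed_interval)
  then show comp: "compact K"
    by (simp add: KV)
  have "(0, 0) \<in> vicsek_vertices n 0"
    by (simp add: square_corners_def)
  then have "V \<noteq> {}"
    unfolding V_def by blast
  then show "K \<noteq> {}"
    by (simp add: KV)
  have inv: "V = (\<Union>i\<in>vicsek_index n. vicsek_map n i ` V)" (is "_ = ?R")
  proof
    show "V \<subseteq> ?R"
    proof
      fix x assume "x \<in> V"
      then obtain m where "x \<in> vicsek_vertices n m" by (auto simp: V_def)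
      then have "x \<in> vicsek_vertices n (Suc m)"
        using vicsek_vertices_mono_Suc[OF assms(1)] by blast
      then show "x \<in> ?R" by (auto simp: V_def)
    qed
    show "?R \<subseteq> V"
    proof
      fix x assume "x \<in> ?R"
      then obtain i m where "i \<in> vicsek_index n" "x \<in> vicsek_map n i ` vicsek_vertices n m"
        by (auto simp: V_def)
      then have "x \<in> vicsek_vertices n (Suc m)" by auto
      then show "x \<in> V" unfolding V_def by blast
    qed
  qed
  have cl: "closure (vicsek_map n i ` V) = vicsek_map n i ` closure V" for i
  proof
    have cont: "continuous_on S (vicsek_map n i)" for S
      unfolding vicsek_map_def by (intro continuous_intros)
    have "compact (closure V)"
      using comp unfolding KV .
    then have "closed (vicsek_map n i ` closure V)"
      by (intro compact_imp_closed compact_continuous_image cont)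
    then show "closure (vicsek_map n i ` V) \<subseteq> vicsek_map n i ` closure V"
      by (rule closure_minimal[OF image_mono[OF closure_subset]])
    show "vicsek_map n i ` closure V \<subseteq> closure (vicsek_map n i ` V)"
      by (rule image_closure_subset[OF cont closed_closure closure_subset])
  qed
  have "K = closure (\<Union>i\<in>vicsek_index n. vicsek_map n i ` V)"
    unfolding KV by (rule arg_cong[OF inv])
  also have "\<dots> = (\<Union>i\<in>vicsek_index n. closure (vicsek_map n i ` V))"
    by (rule closure_Union_finite[OF finite_vicsek_index])
  finally show "K = (\<Union>i\<in>vicsek_index n. vicsek_map n i ` K)"
    unfolding cl KV[symmetric] .
qed

lemma vicsek_fixpoint_subset:
  assumes "n \<ge> 2"
    and A: "compact A" "A \<noteq> {}" "A = (\<Union>i\<in>vicsek_index n. vicsek_map n i ` A)"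
    and B: "compact B" "B \<noteq> {}" "B = (\<Union>i\<in>vicsek_index n. vicsek_map n i ` B)"
  shows "A \<subseteq> B"
proof -
  have "continuous_on A (\<lambda>x. infdist x B)"
    by (intro continuous_intros)
  then obtain a where a: "a \<in> A" "\<And>x. x \<in> A \<Longrightarrow> infdist x B \<le> infdist a B"
    using continuous_attains_sup[OF A(1,2)] by blast
  obtain i a' where i: "i \<in> vicsek_index n" "a' \<in> A" "a = vicsek_map n i a'"
    using a(1) A(3) by blast
  obtain b where b: "b \<in> B" "infdist a' B = dist a' b"
    using infdist_attains_inf[OF compact_imp_closed[OF B(1)] B(2)] by blast
  have "vicsek_map n i b \<in> B"
    using B(3) i(1) b(1) by blast
  then have "infdist a B \<le> (1 / (2 * real n - 1)) * infdist a' B"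
    using infdist_le[of "vicsek_map n i b" B a] dist_vicsek_map[OF assms(1)] i b by simp
  also have "\<dots> \<le> (1 / (2 * real n - 1)) * infdist a B"
    using assms(1) a(2) i(2) by (intro mult_left_mono) auto
  also have "\<dots> \<le> (1 / 2) * infdist a B"
    using assms(1) by (intro mult_right_mono infdist_nonneg) (auto simp: divide_simps)
  finally have "infdist a B \<le> 0" by simp
  then have "infdist x B = 0" if "x \<in> A" for x
    using a(2)[OF that] infdist_nonneg[of x B] by linarith
  then show ?thesis
    using in_closed_iff_infdist_zero[OF compact_imp_closed[OF B(1)] B(2)] by blast
qed

lemma vicsek_set_eq_closure:
  assumes "n \<ge> 2"
  shows "vicsek_set n = closure (\<Union>m. vicsek_vertices n m)"
  unfolding vicsek_set_def
proof (rule the_equality)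
  let ?K = "closure (\<Union>m. vicsek_vertices n m)"
  note fp = vicsek_fixpoint_closure[OF assms]
  show "compact ?K \<and> ?K \<noteq> {} \<and> ?K = (\<Union>i\<in>vicsek_index n. vicsek_map n i ` ?K)"
    by (intro conjI fp)
  fix K assume *: "compact K \<and> K \<noteq> {} \<and> K = (\<Union>i\<in>vicsek_index n. vicsek_map n i ` K)"
  note K = conjunct1[OF *] conjunct1[OF conjunct2[OF *]] conjunct2[OF conjunct2[OF *]]
  show "K = ?K"
    by (intro equalityI vicsek_fixpoint_subset[OF assms K fp] vicsek_fixpoint_subset[OF assms fp K])
qed

end

theory Submission
  imports Defs
begin

text \<open>
  On an arm of the Vicsek set an eigenfunction satisfies a three-term recurrence in the distance from
  the centre. Solving it extends an eigenfunction of \<open>\<Gamma>\<^sub>m\<close> with eigenvalue \<open>R x\<close> to one of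
  \<open>\<Gamma>\<^sub>m\<^sub>+\<^sub>1\<close> with eigenvalue \<open>x\<close>, where \<open>R\<close> is the polynomial \<open>decimation n\<close>. Starting from the constant
  function, each sequence of preimages of \<open>0\<close> under \<open>R\<close> that finally follows the branch at the fixed
  point \<open>0\<close> yields an eigenvalue of the Neumann Laplacian: the extensions converge uniformly because a
  harmonic extension shrinks the oscillation by the factor \<open>2/3\<close>.

  The branch \<open>\<phi>\<close> of \<open>R\<^sup>-\<^sup>1\<close> at \<open>0\<close> has slope \<open>1/\<rho>\<close> there, while the last branch \<open>\<psi>\<close> contracts by a factor
  \<open>1/q\<close> with \<open>q > \<rho>\<close> near its fixed point. So, applying \<open>\<psi>\<close> \<open>k\<close> times to \<open>N\<close> different points on
  one level before \<open>\<phi>\<close> takes over gives \<open>N\<close> different eigenvalues in an interval of length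
  \<open>O((\<rho>/q)\<^sup>k)\<close>.
\<close>

subsection \<open>The decimation polynomial\<close>

text \<open>All points of the construction lie in two windows, \<open>[0, origin_bound n]\<close>
  for \<open>\<phi>\<close> and \<open>[5/6, 15/16]\<close> for \<open>\<psi>\<close>. These avoid
  the values at which an extension breaks down (\<open>2/3\<close>, \<open>4/3\<close> and the zeros
  of \<open>arm_seq 2\<close>), and \<open>15/16\<close> is a height that \<open>R\<close> reaches
  at the right end of each window.

  The crux is \<open>q > \<rho>\<close>. At \<open>x = 8/9\<close> the recurrence has characteristic
  roots \<open>3\<close> and \<open>1/3\<close> up to sign. To the right of this point the slope of
  \<open>R\<close> grows geometrically in \<open>n\<close>, while \<open>\<rho>\<close> is only
  quadratic. For \<open>n = 2\<close> the slope at \<open>8/9\<close> is exactly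
  \<open>\<rho> = 15\<close>, so this case starts slightly further right.

  The \<open>N\<close> points have to be different, on one level, and all of the form
  \<open>\<psi>\<close> iterated \<open>k\<close> times. They arise from one zero \<open>z\<close>
  of \<open>R\<close>: \<open>a\<close> steps of \<open>\<phi>\<close>, one step back to the upper
  window, then \<open>N - a + k\<close> steps of \<open>\<psi>\<close>. The total does not depend on
  \<open>a\<close>, but the orbit under \<open>R\<close> reveals \<open>a\<close>. The linearisation
  at \<open>0\<close> is bi-Lipschitz, so it carries both the distinctness and the closeness of
  these points over to the eigenvalues.\<close>

text \<open>
  The values at distance \<open>k\<close> from the centre are proportional to \<open>arm_seq 2 x k\<close> if the corner values
  have mean zero, and to \<open>sym_seq x k\<close> if they are equal. Up to sign, \<open>arm_seq 2 x (n - 1)\<close> and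
  \<open>arm_seq 4 x (n - 1)\<close> are the factors \<open>g\<^sub>n(x)\<close> and \<open>h\<^sub>n(x)\<close> of \<open>R(x)\<close>.
\<close>

fun arm_seq :: "real \<Rightarrow> real \<Rightarrow> nat \<Rightarrow> real" where
  "arm_seq s x 0 = 1"
| "arm_seq s x (Suc 0) = 1 + s - 6 * x"
| "arm_seq s x (Suc (Suc k)) = 2 * (1 - 3 * x) * arm_seq s x (Suc k) - arm_seq s x k"

definition sym_seq :: "real \<Rightarrow> nat \<Rightarrow> real" where
  "sym_seq x k = (8 - 9 * x) * arm_seq 2 x k - (4 - 6 * x) * arm_seq 4 x k"

definition decimation :: "nat \<Rightarrow> real \<Rightarrow> real" where
  "decimation n x = x * arm_seq 2 x (n - 1) * arm_seq 4 x (n - 1)"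

text \<open>The first two values solve the equation at a corner of the centre cell when its four
  corners share the value \<open>y\<^sub>0\<close>, namely \<open>4 y\<^sub>0 + (4 - 3 x) / (2 - 3
  x) * (y\<^sub>0 + y\<^sub>1) = 2 (4 - 3 x) y\<^sub>0\<close>, scaled to
  \<open>y\<^sub>0 = 4 - 3 x\<close>.\<close>

lemma sym_seq_rec:
  "sym_seq x 0 = 4 - 3 * x"
  "sym_seq x (Suc 0) = 4 - 21 * x + 18 * x\<^sup>2"
  "sym_seq x (Suc (Suc k)) = 2 * (1 - 3 * x) * sym_seq x (Suc k) - sym_seq x k"
  by (simp_all add: sym_seq_def algebra_simps power2_eq_square)

lemma arm_seq_at_0: "arm_seq s 0 k = 1 + s * real k"
  by (induction k rule: induct_nat_012) (simp_all add: algebra_simps)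

text \<open>Both sides obey the three-term recurrence, so two initial cases suffice. At the end of
  an arm the identity expresses the value one step before the corner through the value at the
  corner. This is how the factor \<open>arm_seq 4\<close> enters \<open>R\<close>.\<close>

lemma sym_seq_step:
  "sym_seq x k - (1 - 3 * x) * sym_seq x (Suc k) = 3 * x * (2 - 3 * x) * arm_seq 4 x (Suc k)"
proof (induction k rule: induct_nat_012)
  case (ge2 k)
  have "sym_seq x (Suc (Suc k)) - (1 - 3 * x) * sym_seq x (Suc (Suc (Suc k))) =
     2 * (1 - 3 * x) * (sym_seq x (Suc k) - (1 - 3 * x) * sym_seq x (Suc (Suc k)))
     - (sym_seq x k - (1 - 3 * x) * sym_seq x (Suc k))"
    by (simp add: sym_seq_rec algebra_simps)
  also have "\<dots> = 3 * x * (2 - 3 * x) * arm_seq 4 x (Suc (Suc (Suc k)))"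
    unfolding ge2 by (simp add: algebra_simps)
  finally show ?case .
qed (simp_all add: sym_seq_rec algebra_simps power2_eq_square)

text \<open>Two solutions of a recurrence whose last coefficient is \<open>-1\<close> have a
  constant Casoratian; its value is read off at \<open>k = 0\<close>.\<close>

lemma arm_sym_wronskian:
  "arm_seq 2 x k * sym_seq x (Suc k) - arm_seq 2 x (Suc k) * sym_seq x k = - 4 * (2 - 3 * x)"
proof (induction k)
  case 0
  show ?case by (simp add: sym_seq_rec algebra_simps power2_eq_square)
next
  case (Suc k)
  have "arm_seq 2 x (Suc k) * sym_seq x (Suc (Suc k)) - arm_seq 2 x (Suc (Suc k)) * sym_seq x (Suc k)
     = arm_seq 2 x k * sym_seq x (Suc k) - arm_seq 2 x (Suc k) * sym_seq x k"
    by (simp add: sym_seq_rec algebra_simps)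
  then show ?case using Suc by (simp only:)
qed

text \<open>The second difference in \<open>k\<close> is \<open>- 6 x\<close> times the middle term.
  Differentiating at \<open>x = 0\<close>, where the values are \<open>1 + s k\<close>, explains the
  constants: summing \<open>6 (1 + s j)\<close> once gives the bound for the increments, and summing
  twice gives \<open>k (k + 1) (s k + 3 - s)\<close>. The increments belong to the induction because
  they are what the recurrence controls.\<close>

lemma arm_seq_diff_bounds:
  assumes s: "s \<ge> 2"
  shows "0 \<le> x \<Longrightarrow> x \<le> y \<Longrightarrow> 2 * real k * (real k + 1) * y \<le> 1 \<Longrightarrow>
    0 \<le> arm_seq s x k - arm_seq s y k \<and>
    arm_seq s x k - arm_seq s y k \<le> real k * (real k + 1) * (s * real k + 3 - s) * (y - x) \<and>
    0 \<le> (arm_seq s x (Suc k) - arm_seq s y (Suc k)) - (arm_seq s x k - arm_seq s y k) \<and>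
    (arm_seq s x (Suc k) - arm_seq s y (Suc k)) - (arm_seq s x k - arm_seq s y k)
       \<le> 6 * (real k + 1) * (1 + s * real k / 2) * (y - x)"
proof (induction k arbitrary: x y)
  case 0
  then show ?case by simp
next
  case (Suc k)
  define d where "d x y = arm_seq s x (Suc k) - arm_seq s y (Suc k)" for x y
  define w where "w = real k + 1"
  have w: "w \<ge> 1" "real (Suc k) = w" "real k = w - 1"
    by (simp_all add: w_def)
  have y0: "0 \<le> y" using Suc.prems by simp
  have yw: "2 * w * (w + 1) * y \<le> 1"
    using Suc.prems(3) w by (simp add: algebra_simps)
  have "2 * real k * (real k + 1) * y \<le> 2 * w * (w + 1) * y"
    using y0 w by (intro mult_right_mono mult_mono) auto
  then have yk: "2 * real k * (real k + 1) * y \<le> 1"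
    using yw by linarith
  \<comment> \<open>The bound for the next index is the bound for \<open>k\<close> plus the bound
    for the increment. It is stated for every \<open>x\<close> below \<open>y\<close> because
    \<open>x = 0\<close> compares the value at \<open>y\<close> with the explicit value
    \<open>1 + s w\<close>.\<close>
  have D: "0 \<le> d x y \<and> d x y \<le> w * (w + 1) * (s * w + 3 - s) * (y - x)"
    if "0 \<le> x" "x \<le> y" for x
  proof -
    note IH = Suc.IH[OF that yk]
    have "(real k * (real k + 1) * (s * real k + 3 - s) + 6 * (real k + 1) * (1 + s * real k / 2)) * (y - x)
       = w * (w + 1) * (s * w + 3 - s) * (y - x)"
      unfolding w by (simp add: field_simps)
    then show ?thesis
      using IH unfolding d_def by (simp add: distrib_right)
  qed
  have sw: "0 \<le> s * w + 3 - s" "s * w + 3 - s \<le> 1 + s * w"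
    using s mult_left_mono[OF w(1), of s] by linarith+
  have v0: "arm_seq s 0 (Suc k) = 1 + s * w"
    unfolding arm_seq_at_0 w ..
  have up: "arm_seq s y (Suc k) \<le> 1 + s * w"
    using D[of 0] y0 v0 by (simp add: d_def)
  have lo: "arm_seq s y (Suc k) \<ge> 1 + s * w - w * (w + 1) * (s * w + 3 - s) * y"
    using D[of 0] y0 v0 by (simp add: d_def)
  have e: "(arm_seq s x (Suc (Suc k)) - arm_seq s y (Suc (Suc k))) - d x y
     = (d x y - (arm_seq s x k - arm_seq s y k)) + 6 * (y - x) * arm_seq s y (Suc k) - 6 * x * d x y"
    by (simp add: d_def algebra_simps)
  note IH = Suc.IH[OF Suc.prems(1,2) yk]
  note Dxy = D[OF Suc.prems(1,2)]
  have "x * d x y \<le> y * (w * (w + 1) * (s * w + 3 - s) * (y - x))"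
    using Dxy Suc.prems(1,2) y0 by (intro mult_mono) auto
  moreover have "(y - x) * arm_seq s y (Suc k) \<ge> (y - x) * (1 + s * w - w * (w + 1) * (s * w + 3 - s) * y)"
    using lo Suc.prems by (intro mult_left_mono) auto
  \<comment> \<open>The lower bound for \<open>arm_seq s y (Suc k)\<close> and the upper bound for
    \<open>x * d x y\<close> lose the same amount. This is the source of the factor \<open>2\<close>
    in the smallness condition on \<open>y\<close>.\<close>
  moreover have "(y - x) * (1 + s * w - (2 * w * (w + 1) * y) * (s * w + 3 - s)) \<ge> 0"
  proof -
    have "(2 * w * (w + 1) * y) * (s * w + 3 - s) \<le> 1 * (s * w + 3 - s)"
      using yw sw by (intro mult_right_mono) auto
    then have "(2 * w * (w + 1) * y) * (s * w + 3 - s) \<le> 1 + s * w"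
      using sw(2) by (simp only: mult_1_left)
    then show ?thesis
      using Suc.prems(2) by (intro mult_nonneg_nonneg) (simp_all only: diff_ge_0_iff_ge)
  qed
  ultimately have "(y - x) * arm_seq s y (Suc k) - x * d x y \<ge> 0"
    by (simp add: algebra_simps)
  moreover have "(y - x) * arm_seq s y (Suc k) \<le> (y - x) * (1 + s * w)"
    using up Suc.prems by (intro mult_left_mono) auto
  moreover have "x * d x y \<ge> 0"
    using Dxy Suc.prems by simp
  moreover have "6 * (real k + 1) * (1 + s * real k / 2) * (y - x) + 6 * ((y - x) * (1 + s * w))
     = 6 * (w + 1) * (1 + s * w / 2) * (y - x)"
    unfolding w by (simp add: field_simps)
  ultimately have "0 \<le> (arm_seq s x (Suc (Suc k)) - arm_seq s y (Suc (Suc k))) - d x y"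
    "(arm_seq s x (Suc (Suc k)) - arm_seq s y (Suc (Suc k))) - d x y \<le> 6 * (w + 1) * (1 + s * w / 2) * (y - x)"
    using IH e by (auto simp: d_def algebra_simps)
  then show ?case
    using Dxy unfolding d_def w(2) by simp
qed

lemma arm_seq_bounds:
  assumes "s \<ge> 2" "0 \<le> y" "2 * real k * (real k + 1) * y \<le> 1"
  shows "arm_seq s y k \<le> 1 + s * real k"
    and "arm_seq s y k \<ge> 1 + s * real k - real k * (real k + 1) * (s * real k + 3 - s) * y"
    and "arm_seq s y k > 0"
proof -
  have *: "0 \<le> arm_seq s 0 k - arm_seq s y k"
    "arm_seq s 0 k - arm_seq s y k \<le> real k * (real k + 1) * (s * real k + 3 - s) * (y - 0)"
    using arm_seq_diff_bounds[OF assms(1) _ assms(2,3)] by auto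
  then show "arm_seq s y k \<le> 1 + s * real k"
    and lo: "arm_seq s y k \<ge> 1 + s * real k - real k * (real k + 1) * (s * real k + 3 - s) * y"
    unfolding arm_seq_at_0 by auto
  \<comment> \<open>The drop below the value at \<open>0\<close> is at most half of that value,
    which leaves a positive remainder.\<close>
  have "2 * (real k * (real k + 1) * (s * real k + 3 - s) * y) \<le> 1 + s * real k"
  proof (cases k)
    case 0
    then show ?thesis by simp
  next
    case (Suc j)
    then have "0 \<le> s * real k + 3 - s" "s * real k + 3 - s \<le> 1 + s * real k"
      using assms(1) by (simp_all add: algebra_simps)
    then have "(2 * real k * (real k + 1) * y) * (s * real k + 3 - s) \<le> 1 * (1 + s * real k)"
      using assms by (intro mult_mono) auto
    then show ?thesis by (simp add: algebra_simps)
  qed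
  moreover have "1 + s * real k > 0"
    using assms(1) by (simp add: add_pos_nonneg)
  ultimately show "arm_seq s y k > 0"
    using lo by linarith
qed


text \<open>
  Up to this bound \<open>R(x)\<close> is increasing and at least \<open>\<rho>x - (\<rho>x)\<^sup>2/4\<close>, which reaches \<open>15/16\<close>.
\<close>

definition origin_bound :: "nat \<Rightarrow> real" where
  "origin_bound n = 3 / (2 * vicsek_rho n)"

lemma vicsek_rho_ge:
  assumes "n \<ge> 2"
  shows "vicsek_rho n \<ge> 15"
proof -
  have "(5::real) * 3 \<le> (4 * real n - 3) * (2 * real n - 1)"
    using assms by (intro mult_mono) auto
  then show ?thesis by (simp add: vicsek_rho_def)
qed

lemma origin_bound_pos: "n \<ge> 2 \<Longrightarrow> 0 < origin_bound n"
  and origin_bound_le: "n \<ge> 2 \<Longrightarrow> origin_bound n \<le> 1 / 10"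
  using vicsek_rho_ge[of n] by (auto simp: origin_bound_def field_simps)

lemma decimation_0 [simp]: "decimation n 0 = 0"
  by (simp add: decimation_def)

lemma continuous_arm_seq: "continuous_on S (\<lambda>x. arm_seq s x k)"
proof (induction k rule: induct_nat_012)
  case (ge2 k)
  then show ?case unfolding arm_seq.simps by (intro continuous_intros)
qed (simp_all add: continuous_intros)

lemma continuous_decimation: "continuous_on S (decimation n)"
  unfolding decimation_def by (intro continuous_intros continuous_arm_seq)

lemma origin_bound_index:
  assumes "n \<ge> 2" "y \<le> origin_bound n"
  shows "2 * real (n - 1) * (real (n - 1) + 1) * y \<le> 1"
proof -
  define K where "K = real n - 1"
  have K: "K \<ge> 1" "real (n - 1) = K"
    using assms(1) by (simp_all add: K_def of_nat_diff)
  have rho: "vicsek_rho n = (4 * K + 1) * (2 * K + 1)"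
    by (simp add: vicsek_rho_def K_def algebra_simps)
  have "2 * K * (K + 1) * y \<le> 2 * K * (K + 1) * origin_bound n"
    using K assms by (intro mult_left_mono) auto
  also have "\<dots> \<le> 1"
    using K vicsek_rho_ge[OF assms(1)] unfolding origin_bound_def
    by (simp add: pos_divide_le_eq) (simp add: rho algebra_simps)
  finally show ?thesis unfolding K .
qed

lemma arm_seq_2_pos_origin:
  assumes "n \<ge> 2" "0 \<le> y" "y \<le> origin_bound n"
  shows "arm_seq 2 y (n - 1) > 0"
  using arm_seq_bounds(3)[of 2 y "n - 1"] origin_bound_index[OF assms(1,3)] assms by simp

text \<open>Write \<open>R(x) = x A(x) H(x)\<close> with \<open>A\<close>, \<open>H\<close> positive
  and decreasing from \<open>1 + 2 K\<close> and \<open>1 + 4 K\<close>, where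
  \<open>K = n - 1\<close>; the product of these two numbers is \<open>\<rho>\<close>. Hence the
  slope is at most \<open>\<rho>\<close>, and the second bound quantifies how fast
  \<open>A H\<close> falls.\<close>

lemma decimation_origin:
  assumes n: "n \<ge> 2" and xy: "0 \<le> x" "x \<le> y" "y \<le> origin_bound n"
  shows "decimation n y - decimation n x \<le> vicsek_rho n * (y - x)"
    and "decimation n y - decimation n x \<ge>
           vicsek_rho n * (y - x) * (1 - vicsek_rho n / 4 * (x + y))"
proof -
  define K where "K = real n - 1"
  have K: "K \<ge> 1" "real (n - 1) = K"
    using n by (simp_all add: K_def of_nat_diff)
  define r where "r = vicsek_rho n"
  have rho: "r = (1 + 4 * K) * (1 + 2 * K)"
    by (simp add: r_def vicsek_rho_def K_def algebra_simps)
  define A where "A x = arm_seq 2 x (n - 1)" for x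
  define H where "H x = arm_seq 4 x (n - 1)" for x
  have R: "decimation n x = x * A x * H x" for x
    by (simp add: decimation_def A_def H_def)
  define p where "p = K * (K + 1)"
  have p: "p \<ge> 0" using K by (simp add: p_def)
  define a where "a = p * (2 * K + 3 - 2)"
  define b where "b = p * (4 * K + 3 - 4)"
  have ab: "a \<ge> 0" "b \<ge> 0" using K p by (auto simp: a_def b_def)
  have y0: "0 \<le> y" and xc: "x \<le> origin_bound n" using xy by auto
  note ix = origin_bound_index[OF n xc] and iy = origin_bound_index[OF n xy(3)]
  have four: "(2::real) \<le> 4" by simp
  note defs = A_def H_def a_def b_def p_def K(2)[symmetric]
  have Ax: "0 < A x" "A x \<le> 1 + 2 * K"
    and Ay: "0 < A y" "A y \<le> 1 + 2 * K" "A y \<ge> 1 + 2 * K - a * y"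
    unfolding defs by (fact arm_seq_bounds[OF order_refl xy(1) ix] arm_seq_bounds[OF order_refl y0 iy])+
  have Hx: "0 < H x" "H x \<le> 1 + 4 * K"
    and Hy: "0 < H y" "H y \<le> 1 + 4 * K" "H y \<ge> 1 + 4 * K - b * y"
    unfolding defs by (fact arm_seq_bounds[OF four xy(1) ix] arm_seq_bounds[OF four y0 iy])+
  have dA: "0 \<le> A x - A y" "A x - A y \<le> a * (y - x)"
    and dH: "0 \<le> H x - H y" "H x - H y \<le> b * (y - x)"
    using arm_seq_diff_bounds[OF order_refl xy(1,2) iy] arm_seq_diff_bounds[OF four xy(1,2) iy]
    unfolding defs by blast+
  have split: "decimation n y - decimation n x = (y - x) * (A y * H y) - x * ((A x - A y) * H x + A y * (H x - H y))"
    unfolding R by (simp add: algebra_simps)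
  have "A y * H y \<le> r"
    unfolding rho using Ay Hy K by (subst mult.commute) (intro mult_mono, auto)
  then have "(y - x) * (A y * H y) \<le> (y - x) * r"
    using xy by (intro mult_left_mono) auto
  moreover have "x * ((A x - A y) * H x + A y * (H x - H y)) \<ge> 0"
    using xy dA dH Ax Ay Hx by simp
  ultimately show "decimation n y - decimation n x \<le> vicsek_rho n * (y - x)"
    unfolding split r_def by (simp add: mult.commute)
  \<comment> \<open>The product \<open>A H\<close> has derivative \<open>- g\<close> at
    \<open>0\<close>. The quotient of \<open>g\<close> by \<open>\<rho>\<close> squared tends to
    \<open>1/4\<close> as \<open>n\<close> grows, whence the constant \<open>1/4\<close>: the
    inequality reduces to \<open>32 K^2 (K + 1) <= (1 + 4 K)^2 (1 + 2 K)\<close>, whose two leading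
    coefficients agree.\<close>
  define g where "g = a * (1 + 4 * K) + b * (1 + 2 * K)"
  have g: "g \<le> r * (r / 4)"
  proof -
    have "g = (1 + 2 * K) * (8 * K * p)"
      by (simp add: g_def a_def b_def algebra_simps)
    also have "8 * K * p \<le> (1 + 4 * K) * (r / 4)"
      using K by (simp add: p_def rho algebra_simps)
    then have "(1 + 2 * K) * (8 * K * p) \<le> (1 + 2 * K) * ((1 + 4 * K) * (r / 4))"
      using K by (intro mult_left_mono) auto
    also have "\<dots> = r * (r / 4)" by (simp add: rho)
    finally show ?thesis .
  qed
  have ay: "a * y \<le> 1 + 2 * K"
  proof -
    have "2 * (a * y) = (2 * K * (K + 1) * y) * (2 * K + 1)"
      by (simp add: a_def p_def algebra_simps)
    also have "\<dots> \<le> 1 * (2 * K + 1)"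
      using iy K by (intro mult_right_mono) auto
    finally show ?thesis using K(1) ab y0 by simp
  qed
  have "A y * H y \<ge> (1 + 2 * K - a * y) * H y"
    using Ay Hy by (intro mult_right_mono) auto
  moreover have "(1 + 2 * K - a * y) * H y \<ge> (1 + 2 * K - a * y) * (1 + 4 * K - b * y)"
    using Hy ay by (intro mult_left_mono) auto
  moreover have "(1 + 2 * K - a * y) * (1 + 4 * K - b * y) = r - g * y + (a * y) * (b * y)"
    by (simp add: rho g_def algebra_simps)
  moreover have "(a * y) * (b * y) \<ge> 0" using ab y0 by simp
  ultimately have "A y * H y \<ge> r - g * y" by linarith
  then have 1: "(y - x) * (A y * H y) \<ge> (y - x) * (r - g * y)"
    using xy by (intro mult_left_mono) auto
  have "(A x - A y) * H x \<le> (a * (y - x)) * (1 + 4 * K)"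
    using dA Hx ab xy by (intro mult_mono) auto
  moreover have "A y * (H x - H y) \<le> (1 + 2 * K) * (b * (y - x))"
    using dH Ay K by (intro mult_mono) auto
  ultimately have "(A x - A y) * H x + A y * (H x - H y) \<le> (y - x) * g"
    by (simp add: g_def algebra_simps)
  then have 2: "x * ((A x - A y) * H x + A y * (H x - H y)) \<le> x * ((y - x) * g)"
    using xy by (intro mult_left_mono) auto
  have "((y - x) * (x + y)) * g \<le> ((y - x) * (x + y)) * (r * (r / 4))"
    using g xy y0 by (intro mult_left_mono) auto
  moreover have "(y - x) * (r - g * y) - x * ((y - x) * g) = r * (y - x) - ((y - x) * (x + y)) * g"
    by (simp add: algebra_simps)
  moreover have "r * (y - x) * (1 - r / 4 * (x + y)) = r * (y - x) - ((y - x) * (x + y)) * (r * (r / 4))"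
    by (simp add: field_simps)
  ultimately have "(y - x) * (r - g * y) - x * ((y - x) * g) \<ge> r * (y - x) * (1 - r / 4 * (x + y))"
    by linarith
  then show "decimation n y - decimation n x \<ge>
      vicsek_rho n * (y - x) * (1 - vicsek_rho n / 4 * (x + y))"
    using 1 2 unfolding split r_def by linarith
qed

lemma decimation_origin_bound:
  assumes "n \<ge> 2"
  shows "decimation n (origin_bound n) \<ge> 15 / 16"
  using decimation_origin(2)[OF assms, of 0 "origin_bound n"] origin_bound_pos[OF assms]
    vicsek_rho_ge[OF assms]
  by (simp add: origin_bound_def)

text \<open>For \<open>x \<ge> 2/3\<close> the sequence alternates in sign.\<close>

definition arm_abs :: "real \<Rightarrow> real \<Rightarrow> nat \<Rightarrow> real" where
  "arm_abs s x k = (- 1) ^ k * arm_seq s x k"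

lemma arm_abs_rec:
  "arm_abs s x 0 = 1"
  "arm_abs s x (Suc 0) = 6 * x - 1 - s"
  "arm_abs s x (Suc (Suc k)) = 2 * (3 * x - 1) * arm_abs s x (Suc k) - arm_abs s x k"
  by (simp_all add: arm_abs_def algebra_simps)

lemma decimation_arm_abs:
  "decimation n x = x * arm_abs 2 x (n - 1) * arm_abs 4 x (n - 1)"
proof -
  have "(- 1) ^ (n - 1) * ((- 1) ^ (n - 1) * z) = z" for z :: real
    by (simp flip: mult.assoc power_mult_distrib)
  then show ?thesis
    by (simp add: decimation_def arm_abs_def mult_ac)
qed

text \<open>For \<open>x >= 2/3\<close> the coefficient \<open>2 (3 x - 1)\<close> is at least
  \<open>2\<close>, so a nonnegative sequence is convex and an initial increase persists.\<close>

lemma arm_abs_2_mono: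
  assumes "2 / 3 \<le> x"
  shows "1 \<le> arm_abs 2 x k \<and> arm_abs 2 x k \<le> arm_abs 2 x (Suc k)"
proof (induction k)
  case 0
  then show ?case using assms by (simp add: arm_abs_rec)
next
  case (Suc k)
  have "2 * arm_abs 2 x (Suc k) \<le> 2 * (3 * x - 1) * arm_abs 2 x (Suc k)"
    using Suc assms by (intro mult_right_mono) auto
  then show ?case using Suc unfolding arm_abs_rec by linarith
qed

lemma arm_abs_2_mono_arg:
  assumes "2 / 3 \<le> x" "x \<le> y"
  shows "arm_abs 2 x k \<le> arm_abs 2 y k"
proof -
  define d where "d j = arm_abs 2 y j - arm_abs 2 x j" for j
  have "0 \<le> d k \<and> d k \<le> d (Suc k)"
  proof (induction k)
    case 0
    then show ?case using assms by (simp add: d_def arm_abs_rec)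
  next
    case (Suc k)
    have "d (Suc (Suc k)) = 2 * (3 * x - 1) * d (Suc k) - d k + 6 * (y - x) * arm_abs 2 y (Suc k)"
      by (simp add: d_def arm_abs_rec algebra_simps)
    moreover have "0 \<le> 6 * (y - x) * arm_abs 2 y (Suc k)"
      using assms arm_abs_2_mono[of y k] by simp
    moreover have "2 * d (Suc k) \<le> 2 * (3 * x - 1) * d (Suc k)"
      using Suc assms by (intro mult_right_mono) auto
    ultimately show ?case using Suc by auto
  qed
  then show ?thesis by (simp add: d_def)
qed

text \<open>For \<open>x >= 8/9\<close> the coefficient is at least \<open>10/3\<close>, and the
  subtracted term is at most the current one, which leaves the factor
  \<open>10/3 - 1 = 7/3\<close>.\<close>

lemma arm_abs_2_growth:
  assumes "8 / 9 \<le> x"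
  shows "(7 / 3) ^ k \<le> arm_abs 2 x k"
proof (induction k)
  case 0
  then show ?case by (simp add: arm_abs_rec)
next
  case (Suc k)
  have "7 / 3 * arm_abs 2 x k \<le> arm_abs 2 x (Suc k)"
  proof (cases k)
    case 0
    then show ?thesis using assms by (simp add: arm_abs_rec)
  next
    case (Suc j)
    have 1: "1 \<le> arm_abs 2 x j" "arm_abs 2 x j \<le> arm_abs 2 x (Suc j)"
      using arm_abs_2_mono[of x j] assms by auto
    then have "10 / 3 * arm_abs 2 x (Suc j) \<le> 2 * (3 * x - 1) * arm_abs 2 x (Suc j)"
      using assms by (intro mult_right_mono) auto
    then show ?thesis using 1 unfolding Suc arm_abs_rec by linarith
  qed
  then show ?case using Suc by simp
qed

text \<open>At \<open>8/9\<close> the coefficient is \<open>10/3 = 3 + 1/3\<close>, so the solutions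
  are combinations of \<open>3 ^ k\<close> and \<open>(1/3) ^ k\<close>. The starting values with
  \<open>s = 4\<close> select the purely decaying one, so the factors of \<open>R(8/9)\<close>
  nearly cancel.\<close>

lemma arm_abs_2_at: "arm_abs 2 (8 / 9) k = 3 / 4 * 3 ^ k + 1 / 4 * (1 / 3) ^ k"
  and arm_abs_4_at: "arm_abs 4 (8 / 9) k = (1 / 3) ^ k"
  by (induction k rule: induct_nat_012) (simp_all add: arm_abs_rec add_divide_distrib)

text \<open>At \<open>5/6\<close> the term with index \<open>1\<close> is
  \<open>6 x - 5 = 0\<close>. From there on the coefficient is \<open>3\<close>, and a sequence that
  is nonpositive and has just decreased keeps decreasing.\<close>

lemma arm_abs_4_nonpos: "arm_abs 4 (5 / 6) (Suc k) \<le> 0"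
proof -
  have "arm_abs 4 (5 / 6) (Suc k) \<le> 0 \<and> arm_abs 4 (5 / 6) (Suc k) \<le> arm_abs 4 (5 / 6) k"
    by (induction k) (auto simp: arm_abs_rec)
  then show ?thesis ..
qed

text \<open>The differences obey the same recurrence with the source term
  \<open>6 (y - x) * arm_abs 4 y (Suc k)\<close>. Once this source is known to be nonnegative, they
  grow by at least \<open>7/3\<close> per step.\<close>

lemma arm_abs_4_diff:
  assumes "8 / 9 \<le> x" "x \<le> y"
  shows "0 \<le> arm_abs 4 x k" "0 \<le> arm_abs 4 y k - arm_abs 4 x k"
    "6 * (y - x) * (7 / 3) ^ k \<le> arm_abs 4 y (Suc k) - arm_abs 4 x (Suc k)"
proof -
  have *: "0 \<le> arm_abs 4 y k - arm_abs 4 x k \<and>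
     arm_abs 4 y k - arm_abs 4 x k \<le> arm_abs 4 y (Suc k) - arm_abs 4 x (Suc k) \<and>
     6 * (y - x) * (7 / 3) ^ k \<le> arm_abs 4 y (Suc k) - arm_abs 4 x (Suc k)"
    if "8 / 9 \<le> x" "x \<le> y" for x y
    using that
  proof (induction k arbitrary: x y)
    case 0
    then show ?case by (simp add: arm_abs_rec)
  next
    case (Suc k)
    define d where "d j = arm_abs 4 y j - arm_abs 4 x j" for j
    have IH: "0 \<le> d k" "d k \<le> d (Suc k)" "6 * (y - x) * (7 / 3) ^ k \<le> d (Suc k)"
      using Suc.IH[OF Suc.prems] by (auto simp: d_def)
    have y: "8 / 9 \<le> y" using Suc.prems by simp
    have "0 \<le> (1 / 3 :: real) ^ Suc k" by simp
    \<comment> \<open>The sign of the source term comes from the induction hypothesis with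
      \<open>8/9\<close> in place of \<open>x\<close>, where the values are explicit and
      positive.\<close>
    moreover have "arm_abs 4 (8 / 9) (Suc k) \<le> arm_abs 4 y (Suc k)"
      using Suc.IH[OF order_refl y] by linarith
    ultimately have "0 \<le> arm_abs 4 y (Suc k)"
      unfolding arm_abs_4_at by linarith
    then have "0 \<le> 6 * (y - x) * arm_abs 4 y (Suc k)"
      using Suc.prems by simp
    moreover have "d (Suc (Suc k)) = 2 * (3 * x - 1) * d (Suc k) - d k + 6 * (y - x) * arm_abs 4 y (Suc k)"
      by (simp add: d_def arm_abs_rec algebra_simps)
    moreover have "10 / 3 * d (Suc k) \<le> 2 * (3 * x - 1) * d (Suc k)"
      using IH Suc.prems by (intro mult_right_mono) auto
    ultimately have "7 / 3 * d (Suc k) \<le> d (Suc (Suc k))"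
      using IH by linarith
    then show ?case
      using IH unfolding d_def[symmetric] by auto
  qed
  show "0 \<le> arm_abs 4 y k - arm_abs 4 x k"
    "6 * (y - x) * (7 / 3) ^ k \<le> arm_abs 4 y (Suc k) - arm_abs 4 x (Suc k)"
    using *[OF assms] by auto
  have "0 \<le> (1 / 3 :: real) ^ k" by simp
  then show "0 \<le> arm_abs 4 x k"
    using *[OF order_refl assms(1)] unfolding arm_abs_4_at by linarith
qed

text \<open>The factor \<open>arm_abs 4\<close> of \<open>R\<close> changes sign between
  \<open>5/6\<close> and \<open>8/9\<close>. The zero serves as a nonzero preimage of
  \<open>0\<close> in the upper window.\<close>

lemma ex_zero_decimation:
  assumes "n \<ge> 2"
  obtains z where "5 / 6 \<le> z" "z < 8 / 9" "decimation n z = 0"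
proof -
  define f where "f x = arm_abs 4 x (n - 1)" for x
  have "continuous_on {5 / 6..8 / 9} f"
    unfolding f_def arm_abs_def by (intro continuous_intros continuous_arm_seq)
  moreover obtain k where k: "n - 1 = Suc k"
    using assms by (cases "n - 1") auto
  have "f (5 / 6) \<le> 0"
    unfolding f_def k by (rule arm_abs_4_nonpos)
  moreover have "f (8 / 9) > 0"
    by (simp add: f_def arm_abs_4_at)
  ultimately obtain z where z: "5 / 6 \<le> z" "z \<le> 8 / 9" "f z = 0"
    using IVT'[of f "5 / 6" 0 "8 / 9"] by auto
  then have "z \<noteq> 8 / 9" using \<open>f (8 / 9) > 0\<close> by (metis less_irrefl)
  then show ?thesis
    using z that[of z] by (auto simp: decimation_arm_abs f_def)
qed

text \<open>The right side is the slope bound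
  \<open>8/9 * (7/3) ^ (n - 1) * 6 * (7/3) ^ (n - 2)\<close> obtained from the growth of the two
  factors of \<open>R\<close>. For \<open>n = 2\<close> it would be \<open>112/9\<close>, which is
  below \<open>\<rho> = 15\<close>.\<close>

lemma exponential_beats_rho:
  assumes "n \<ge> 3"
  shows "vicsek_rho n < 16 / 3 * (7 / 3) ^ (2 * n - 3)"
  using assms
proof (induction n rule: dec_induct)
  case base
  then show ?case by (simp add: vicsek_rho_def eval_nat_numeral)
next
  case (step n)
  have e: "2 * Suc n - 3 = Suc (Suc (2 * n - 3))" using step by simp
  have "vicsek_rho (Suc n) \<le> 49 / 9 * vicsek_rho n"
  proof -
    have "0 \<le> (real n - 3) * (real n)" using step by simp
    then have "0 \<le> (320 * ((real n - 3) * real n) + 416 * real n + 138) / 9"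
      using step by (intro divide_nonneg_nonneg add_nonneg_nonneg mult_nonneg_nonneg) auto
    moreover have "49 / 9 * vicsek_rho n - vicsek_rho (Suc n)
        = (320 * ((real n - 3) * real n) + 416 * real n + 138) / 9"
      by (simp add: vicsek_rho_def field_simps)
    ultimately show ?thesis by linarith
  qed
  also have "\<dots> < 49 / 9 * (16 / 3 * (7 / 3) ^ (2 * n - 3))"
    using step by simp
  finally show ?case unfolding e by simp
qed

text \<open>The fixed point of the last increasing branch is more repelling than \<open>0\<close>.\<close>

lemma decimation_expanding:
  assumes "n \<ge> 2"
  obtains l q where "8 / 9 \<le> l" "l < 15 / 16" "q > vicsek_rho n"
    "decimation n l \<le> 5 / 6" "decimation n (15 / 16) \<ge> 15 / 16"
    "\<And>x y. l \<le> x \<Longrightarrow> x \<le> y \<Longrightarrow> decimation n y - decimation n x \<ge> q * (y - x)"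
proof (cases "n = 2")
  case True
  have R: "decimation n x = 36 * x ^ 3 - 48 * x ^ 2 + 15 * x" for x
    by (simp add: True decimation_def algebra_simps power2_eq_square power3_eq_cube)
  show ?thesis
  \<comment> \<open>The derivative \<open>108 x^2 - 96 x + 15\<close> equals
    \<open>15 = \<rho>\<close> at \<open>8/9\<close>. At \<open>89/100\<close> it is already
    \<open>15.1068\<close>, while \<open>R\<close> is still below \<open>5/6\<close>.\<close>
  proof (rule that[of "89 / 100" "15 + 1 / 10"])
    fix x y :: real
    assume xy: "89 / 100 \<le> x" "x \<le> y"
    have eq: "decimation n y - decimation n x = (y - x) * (36 * (x\<^sup>2 + x * y + y\<^sup>2) - 48 * (x + y) + 15)"
      by (simp add: R algebra_simps power2_eq_square power3_eq_cube)
    have ge: "36 * (x\<^sup>2 + x * y + y\<^sup>2) - 48 * (x + y) + 15 \<ge> 15 + 1 / 10"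
    proof -
      \<comment> \<open>Moving the origin to \<open>89/100\<close> makes all coefficients of the
        difference quotient positive, so its constant term \<open>37767/2500\<close> is a lower
        bound.\<close>
      define u v where "u = x - 89 / 100" and "v = y - 89 / 100"
      have uv: "u \<ge> 0" "v \<ge> 0" "x = u + 89 / 100" "y = v + 89 / 100"
        using xy by (auto simp: u_def v_def)
      have "36 * (x\<^sup>2 + x * y + y\<^sup>2) - 48 * (x + y) + 15
          = 36 * (u * u) + 36 * (u * v) + 36 * (v * v) + 2406 / 50 * u + 2406 / 50 * v + 37767 / 2500"
        unfolding uv(3,4) by (simp add: algebra_simps power2_eq_square)
      moreover have "0 \<le> u * u" "0 \<le> u * v" "0 \<le> v * v" using uv by simp_all
      ultimately show ?thesis using uv(1,2) by linarith
    qed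
    show "decimation n y - decimation n x \<ge> (15 + 1 / 10) * (y - x)"
      unfolding eq mult.commute[of _ "y - x"] using ge xy by (intro mult_left_mono) auto
  qed (simp_all only: R, simp_all add: True vicsek_rho_def power2_eq_square power3_eq_cube)
next
  case False
  then have n: "n \<ge> 3" using assms by simp
  then obtain k where k: "n - 1 = Suc k" "k \<ge> 1"
    by (cases "n - 1") auto
  define q where "q = 16 / 3 * (7 / 3 :: real) ^ (2 * n - 3)"
  have q: "q > vicsek_rho n"
    unfolding q_def by (rule exponential_beats_rho[OF n])
  \<comment> \<open>The exact value is \<open>2/3 + 2/9 * (1/9) ^ (n - 1)\<close>, so that
    \<open>5/6\<close> and everything up to \<open>15/16\<close> lie in the image of the interval
    starting at \<open>8/9\<close>.\<close>
  have R89: "decimation n (8 / 9) \<le> 7 / 10"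
  proof -
    have "decimation n (8 / 9) = 8 / 9 * (3 / 4 * (3 ^ Suc k * (1 / 3) ^ Suc k) + 1 / 4 * ((1 / 3) ^ Suc k * (1 / 3) ^ Suc k))"
      unfolding decimation_arm_abs arm_abs_2_at arm_abs_4_at k by (simp add: algebra_simps)
    also have "(3::real) ^ Suc k * (1 / 3) ^ Suc k = 1"
      by (simp only: power_mult_distrib[symmetric]) simp
    also have "(1 / 3 :: real) ^ Suc k * (1 / 3) ^ Suc k \<le> 1 / 3 * (1 / 3)"
      using power_le_one[of "1 / 3 :: real" k] by (intro mult_mono) auto
    finally show ?thesis by simp
  qed
  have slope: "decimation n y - decimation n x \<ge> q * (y - x)" if xy: "8 / 9 \<le> x" "x \<le> y" for x y
  proof -
    define d where "d = arm_abs 4 y (Suc k) - arm_abs 4 x (Suc k)"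
    note D = arm_abs_4_diff[OF xy, of "Suc k"]
    have d: "6 * (y - x) * (7 / 3) ^ k \<le> d"
      using arm_abs_4_diff(3)[OF xy, of k] by (simp add: d_def)
    have ax: "(7 / 3) ^ Suc k \<le> arm_abs 2 x (Suc k)"
      by (rule arm_abs_2_growth[OF xy(1)])
    have "0 \<le> (7 / 3 :: real) ^ Suc k" by simp
    then have ax0: "0 \<le> arm_abs 2 x (Suc k)" using ax by linarith
    have axy: "arm_abs 2 x (Suc k) \<le> arm_abs 2 y (Suc k)"
      using arm_abs_2_mono_arg xy by simp
    have hy: "0 \<le> arm_abs 4 y (Suc k)" using D by linarith
    \<comment> \<open>Only the increase of the factor \<open>arm_abs 4\<close> is kept; the other
      two factors are replaced by their smaller values at \<open>x\<close>.\<close>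
    have "decimation n y \<ge> (x * arm_abs 2 x (Suc k)) * arm_abs 4 y (Suc k)"
      unfolding decimation_arm_abs k using xy ax0 axy hy by (intro mult_right_mono mult_mono) auto
    then have "decimation n y - decimation n x \<ge> (x * arm_abs 2 x (Suc k)) * d"
      unfolding decimation_arm_abs k d_def by (simp add: algebra_simps)
    moreover have "(x * arm_abs 2 x (Suc k)) * d \<ge> (8 / 9 * (7 / 3) ^ Suc k) * (6 * (y - x) * (7 / 3) ^ k)"
      using xy ax ax0 d by (intro mult_mono) auto
    moreover have "2 * n - 3 = Suc k + k" using k by simp
    then have "(8 / 9 * (7 / 3) ^ Suc k) * (6 * (y - x) * (7 / 3) ^ k) = q * (y - x)"
      unfolding q_def by (simp add: power_add)
    ultimately show ?thesis by linarith
  qed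
  show ?thesis
  proof (rule that[of "8 / 9" q])
    have q45: "q \<ge> 45"
    proof -
      have "(9::real) * 5 \<le> (4 * real n - 3) * (2 * real n - 1)"
        using n by (intro mult_mono) auto
      then show ?thesis using q by (simp add: vicsek_rho_def)
    qed
    have "decimation n (8 / 9) \<ge> 0"
      unfolding decimation_arm_abs arm_abs_2_at arm_abs_4_at by simp
    then show "decimation n (15 / 16) \<ge> 15 / 16"
      using slope[of "8 / 9" "15 / 16"] q45 by simp
  qed (use q R89 slope in auto)
qed


subsection \<open>Cells and the graph Laplacian\<close>

definition cell_coord :: "nat \<Rightarrow> nat \<times> nat \<Rightarrow> real \<times> real \<Rightarrow> real \<times> real" where
  "cell_coord n i p = (2 * real n - 1) *\<^sub>R p - (real (fst i), real (snd i))"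

abbreviation unit_square :: "(real \<times> real) set" where
  "unit_square \<equiv> {0..1} \<times> {0..1}"

lemma vicsek_map_cell_coord:
  assumes "n \<ge> 2"
  shows "vicsek_map n i (cell_coord n i p) = p"
    and "cell_coord n i (vicsek_map n i p) = p"
proof -
  have "2 * real n - 1 \<noteq> 0" using assms by linarith
  then show "vicsek_map n i (cell_coord n i p) = p" "cell_coord n i (vicsek_map n i p) = p"
    by (simp_all add: vicsek_map_def cell_coord_def)
qed

lemma inj_vicsek_map: "n \<ge> 2 \<Longrightarrow> inj_on (vicsek_map n i) A"
  by (metis inj_on_def vicsek_map_cell_coord(2))

lemma vicsek_index_le:
  assumes "(a, b) \<in> vicsek_index n"
  shows "a + 2 \<le> 2 * n" "b + 2 \<le> 2 * n" "even (a + b)"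
  using assms unfolding vicsek_index_def by (auto simp: even_add) presburger+

lemma square_corners_eq: "square_corners = {(0, 0), (0, 1), (1, 0), (1, 1)}"
  by (auto simp: square_corners_def)

lemma finite_square_corners [simp]: "finite square_corners"
  by (simp add: square_corners_eq)

lemma square_corners_subset: "square_corners \<subseteq> unit_square"
  by (auto simp: square_corners_def)

text \<open>All \<open>(i, j)\<close> in the index set have \<open>i + j\<close> even, so two different cells never share an edge.\<close>

lemma cells_meet:
  assumes n: "n \<ge> 2" and i: "i \<in> vicsek_index n" and j: "j \<in> vicsek_index n" and ij: "i \<noteq> j"
    and q: "q \<in> unit_square" and r: "r \<in> unit_square" and eq: "vicsek_map n i q = vicsek_map n j r"
  shows "q \<in> square_corners" "r \<in> square_corners"
    and "q = ((if fst i < fst j then 1 else 0), (if snd i < snd j then 1 else 0))"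
proof -
  obtain a b where ab: "i = (a, b)" by (cases i)
  obtain c d where cd: "j = (c, d)" by (cases j)
  obtain x y where xy: "q = (x, y)" by (cases q)
  obtain z w where zw: "r = (z, w)" by (cases r)
  have "2 * real n - 1 \<noteq> 0" using n by linarith
  then have e: "x + real a = z + real c" "y + real b = w + real d"
    using eq by (simp_all add: vicsek_map_def ab cd xy zw)
  have bd: "0 \<le> x" "x \<le> 1" "0 \<le> y" "y \<le> 1" "0 \<le> z" "z \<le> 1" "0 \<le> w" "w \<le> 1"
    using q r xy zw by auto
  have key: "u = Suc v \<and> x = 0 \<and> z = 1 \<or> v = Suc u \<and> x = 1 \<and> z = 0 \<or> u = v"
    if "x + real u = z + real v" "0 \<le> x" "x \<le> 1" "0 \<le> z" "z \<le> 1" for u v :: nat and x z :: real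
  proof -
    have "real u \<le> real v + 1" "real v \<le> real u + 1" using that by linarith+
    then have "u \<le> Suc v" "v \<le> Suc u" by linarith+
    then consider "u = v" | "u = Suc v" | "v = Suc u" by linarith
    then show ?thesis
    proof cases
      case 2
      then have "x + 1 = z" using that(1) by simp
      then show ?thesis using 2 that by linarith
    next
      case 3
      then have "x = z + 1" using that(1) by simp
      then show ?thesis using 3 that by linarith
    qed simp
  qed
  have par: "even (a + b)" "even (c + d)"
    using vicsek_index_le(3) i j ab cd by auto
  note k1 = key[OF e(1) bd(1,2,5,6)] and k2 = key[OF e(2) bd(3,4,7,8)]
  have "a \<noteq> c" "b \<noteq> d"
    using k1 k2 par ij unfolding ab cd by auto
  then have *: "(a = c + 1 \<and> x = 0 \<and> z = 1 \<or> c = a + 1 \<and> x = 1 \<and> z = 0) \<and>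
     (b = d + 1 \<and> y = 0 \<and> w = 1 \<or> d = b + 1 \<and> y = 1 \<and> w = 0)"
    using k1 k2 by auto
  then show "q \<in> square_corners" "r \<in> square_corners"
    "q = ((if fst i < fst j then 1 else 0), (if snd i < snd j then 1 else 0))"
    unfolding ab cd xy zw square_corners_def by auto
qed

section \<open>Recursion of cells and neighbourhoods over the levels\<close>

lemma vicsek_cells_0: "vicsek_cells n 0 = {square_corners}"
  by (auto simp: vicsek_cells_def)

lemma vicsek_cells_Suc:
  "vicsek_cells n (Suc m) = {vicsek_map n i ` C | i C. i \<in> vicsek_index n \<and> C \<in> vicsek_cells n m}"
  (is "?L = ?R")
proof
  show "?L \<subseteq> ?R"
  proof
    fix D assume "D \<in> ?L"
    then obtain w where w: "D = foldr (vicsek_map n) w ` square_corners" "length w = Suc m" "set w \<subseteq> vicsek_index n"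
      by (auto simp: vicsek_cells_def)
    then obtain i w' where "w = i # w'" by (cases w) auto
    with w have "D = vicsek_map n i ` (foldr (vicsek_map n) w' ` square_corners)"
      "i \<in> vicsek_index n" "length w' = m" "set w' \<subseteq> vicsek_index n"
      by (auto simp: image_image)
    moreover from this have "foldr (vicsek_map n) w' ` square_corners \<in> vicsek_cells n m"
      unfolding vicsek_cells_def by blast
    ultimately show "D \<in> ?R" by blast
  qed
  show "?R \<subseteq> ?L"
  proof
    fix D assume "D \<in> ?R"
    then obtain i w where iw: "D = vicsek_map n i ` (foldr (vicsek_map n) w ` square_corners)"
      "i \<in> vicsek_index n" "length w = m" "set w \<subseteq> vicsek_index n"
      by (auto simp: vicsek_cells_def)
    then have "D = foldr (vicsek_map n) (i # w) ` square_corners" by (simp add: image_image)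
    with iw show "D \<in> ?L"
      unfolding vicsek_cells_def by (intro CollectI exI[of _ "i # w"]) auto
  qed
qed

lemma vicsek_cells_subset_vertices: "C \<in> vicsek_cells n m \<Longrightarrow> C \<subseteq> vicsek_vertices n m"
proof (induction m arbitrary: C)
  case 0
  then show ?case by (simp add: vicsek_cells_0)
next
  case (Suc m)
  then show ?case unfolding vicsek_cells_Suc vicsek_vertices.simps by blast
qed

lemma vicsek_nbrs_iff:
  "y \<in> vicsek_nbrs n m x \<longleftrightarrow> x \<noteq> y \<and> (\<exists>C\<in>vicsek_cells n m. x \<in> C \<and> y \<in> C)"
  using vicsek_cells_subset_vertices[of _ n m] by (auto simp: vicsek_nbrs_def vicsek_adj_def)

lemma vicsek_nbrs_0: "vicsek_nbrs n 0 x = (if x \<in> square_corners then square_corners - {x} else {})"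
  by (auto simp: vicsek_nbrs_iff vicsek_cells_0)

text \<open>Outside the vertices of level \<open>m\<close> the neighbourhood is empty, so the union
  may run over all cells of the first level, including those that do not contain
  \<open>x\<close>.\<close>

lemma vicsek_nbrs_Suc:
  assumes "n \<ge> 2"
  shows "vicsek_nbrs n (Suc m) x =
    (\<Union>i\<in>vicsek_index n. vicsek_map n i ` vicsek_nbrs n m (cell_coord n i x))"
proof -
  have im: "z \<in> vicsek_map n i ` C \<longleftrightarrow> cell_coord n i z \<in> C" for z i C
    by (metis assms image_iff vicsek_map_cell_coord)
  have inj: "cell_coord n i x = cell_coord n i y \<longleftrightarrow> x = y" for i y
    by (metis assms vicsek_map_cell_coord(1))
  have "y \<in> vicsek_nbrs n (Suc m) x \<longleftrightarrow>
      (\<exists>i\<in>vicsek_index n. cell_coord n i y \<in> vicsek_nbrs n m (cell_coord n i x))" for y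
  proof -
    have "(\<exists>C\<in>vicsek_cells n (Suc m). x \<in> C \<and> y \<in> C) \<longleftrightarrow>
      (\<exists>i\<in>vicsek_index n. \<exists>C\<in>vicsek_cells n m. x \<in> vicsek_map n i ` C \<and> y \<in> vicsek_map n i ` C)"
      unfolding vicsek_cells_Suc by blast
    then show ?thesis
      unfolding vicsek_nbrs_iff inj im by auto
  qed
  then show ?thesis
    by (intro set_eqI) (simp add: im)
qed

lemma finite_vicsek_nbrs: "n \<ge> 2 \<Longrightarrow> finite (vicsek_nbrs n m x)"
proof (induction m arbitrary: x)
  case 0
  then show ?case by (simp add: vicsek_nbrs_0)
next
  case (Suc m)
  then show ?case by (simp add: vicsek_nbrs_Suc finite_vicsek_index)
qed

lemma vicsek_nbrs_nonempty:
  assumes "n \<ge> 2"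
  shows "x \<in> vicsek_vertices n m \<Longrightarrow> vicsek_nbrs n m x \<noteq> {}"
proof (induction m arbitrary: x)
  case 0
  then have "x \<in> square_corners" by simp
  moreover have "(0, 0) \<in> square_corners - {x} \<or> (1, 1) \<in> square_corners - {x}"
    by (cases "x = (0, 0)") (simp_all add: square_corners_eq)
  ultimately show ?case by (auto simp: vicsek_nbrs_0)
next
  case (Suc m)
  then obtain i y where i: "i \<in> vicsek_index n" "y \<in> vicsek_vertices n m" "x = vicsek_map n i y"
    unfolding vicsek_vertices.simps by blast
  then have "vicsek_nbrs n m (cell_coord n i x) \<noteq> {}"
    using Suc.IH[OF i(2)] by (simp add: i(3) vicsek_map_cell_coord[OF assms])
  then show ?case using i(1) unfolding vicsek_nbrs_Suc[OF assms] by blast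
qed

lemma vicsek_nbrs_subset_square:
  assumes "n \<ge> 2" "y \<in> vicsek_nbrs n m x"
  shows "x \<in> unit_square" "y \<in> unit_square" "x \<noteq> y"
proof -
  obtain C where C: "x \<noteq> y" "C \<in> vicsek_cells n m" "x \<in> C" "y \<in> C"
    using assms(2) unfolding vicsek_nbrs_iff by blast
  then have "C \<subseteq> unit_square"
    using vicsek_cells_subset_vertices vicsek_vertices_subset_square[OF assms(1)] by (meson order_trans)
  with C show "x \<in> unit_square" "y \<in> unit_square" "x \<noteq> y" by blast+
qed

text \<open>This is the eigenvalue equation at \<open>x\<close> multiplied by the degree of
  \<open>x\<close>. Without the normalisation the expression is additive over the cells that meet at
  \<open>x\<close>, and it vanishes outside the vertices.\<close>

definition eigen_defect :: "nat \<Rightarrow> nat \<Rightarrow> (real \<times> real \<Rightarrow> real) \<Rightarrow> real \<Rightarrow> real \<times> real \<Rightarrow> real" where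
  "eigen_defect n m u e x = (\<Sum>y\<in>vicsek_nbrs n m x. u y - (1 - e) * u x)"

lemma graph_laplacian_eigen:
  assumes "n \<ge> 2" "x \<in> vicsek_vertices n m" "eigen_defect n m u e x = 0"
  shows "graph_laplacian n m u x = - e * u x"
proof -
  let ?N = "vicsek_nbrs n m x"
  have "card ?N \<noteq> 0"
    using vicsek_nbrs_nonempty[OF assms(1,2)] finite_vicsek_nbrs[OF assms(1)] by simp
  moreover have "(\<Sum>y\<in>?N. u y - u x) = eigen_defect n m u e x - real (card ?N) * (e * u x)"
    by (simp add: eigen_defect_def sum_subtractf sum.distrib algebra_simps)
  ultimately show ?thesis
    using assms(3) by (simp add: graph_laplacian_def)
qed

lemma eigen_defect_0:
  "eigen_defect n 0 u e x =
     (if x \<in> square_corners then (\<Sum>y\<in>square_corners. u y) - (4 - 3 * e) * u x else 0)"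
proof (cases "x \<in> square_corners")
  case True
  have "card square_corners = 4" by (simp add: square_corners_eq)
  then have "(\<Sum>y\<in>square_corners. u y - (1 - e) * u x) = (\<Sum>y\<in>square_corners. u y) - 4 * ((1 - e) * u x)"
    by (simp add: sum_subtractf)
  moreover have "eigen_defect n 0 u e x = (\<Sum>y\<in>square_corners. u y - (1 - e) * u x) - (u x - (1 - e) * u x)"
    using True by (simp add: eigen_defect_def vicsek_nbrs_0 sum_diff1)
  ultimately show ?thesis
    using True by (simp add: algebra_simps)
qed (simp add: eigen_defect_def vicsek_nbrs_0)

lemma eigen_defect_Suc:
  assumes "n \<ge> 2"
  shows "eigen_defect n (Suc m) u e x =
    (\<Sum>i\<in>vicsek_index n. eigen_defect n m (u \<circ> vicsek_map n i) e (cell_coord n i x))"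
proof -
  let ?N = "\<lambda>i. vicsek_map n i ` vicsek_nbrs n m (cell_coord n i x)"
  have disj: "?N i \<inter> ?N j = {}" if ij: "i \<in> vicsek_index n" "j \<in> vicsek_index n" "i \<noteq> j" for i j
  proof (rule ccontr)
    assume "?N i \<inter> ?N j \<noteq> {}"
    then obtain y z where yz: "y \<in> vicsek_nbrs n m (cell_coord n i x)"
      "z \<in> vicsek_nbrs n m (cell_coord n j x)" "vicsek_map n i y = vicsek_map n j z" by blast
    note y = vicsek_nbrs_subset_square[OF assms yz(1)]
    note z = vicsek_nbrs_subset_square[OF assms yz(2)]
    have "vicsek_map n i (cell_coord n i x) = vicsek_map n j (cell_coord n j x)"
      using assms by (simp add: vicsek_map_cell_coord)
    \<comment> \<open>Both \<open>x\<close> and the common neighbour would lie in both cells. The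
      meeting point of two cells is determined by their indices, so the two would coincide.\<close>
    from cells_meet(3)[OF assms ij y(1) z(1) this] cells_meet(3)[OF assms ij y(2) z(2) yz(3)] y(3)
    show False by simp
  qed
  have "eigen_defect n (Suc m) u e x = (\<Sum>i\<in>vicsek_index n. \<Sum>y\<in>?N i. u y - (1 - e) * u x)"
    unfolding eigen_defect_def vicsek_nbrs_Suc[OF assms]
    using finite_vicsek_nbrs[OF assms] finite_vicsek_index disj
    by (intro sum.UNION_disjoint) auto
  also have "\<dots> = (\<Sum>i\<in>vicsek_index n. eigen_defect n m (u \<circ> vicsek_map n i) e (cell_coord n i x))"
    unfolding eigen_defect_def
    by (rule sum.cong[OF refl])
       (simp add: sum.reindex[OF inj_vicsek_map[OF assms]] vicsek_map_cell_coord[OF assms])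
  finally show ?thesis .
qed


subsection \<open>Extending an eigenfunction by one level\<close>

text \<open>
  A vertex of the first level is \<open>(grid_pt n s a, grid_pt n t b)\<close>, where the corner \<open>(s, t)\<close> tells the
  arm and \<open>a\<close>, \<open>b\<close> count the distance from the centre in cells.
\<close>

definition grid_pt :: "nat \<Rightarrow> real \<Rightarrow> nat \<Rightarrow> real" where
  "grid_pt n s k = 1 / 2 + (2 * s - 1) * (2 * real k + 1) / (2 * (2 * real n - 1))"

definition grid_side :: "real \<Rightarrow> real" where
  "grid_side a = (if a > 1 / 2 then 1 else 0)"

text \<open>At \<open>grid_pt n s k\<close> the argument of the floor is \<open>k + 1/2\<close>, so
  the function recovers \<open>k\<close>.\<close>

definition grid_dist :: "nat \<Rightarrow> real \<Rightarrow> nat" where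
  "grid_dist n a = nat \<lfloor>(2 * real n - 1) * \<bar>2 * a - 1\<bar> / 2\<rfloor>"

lemma grid_pt_side_dist:
  assumes "n \<ge> 2" "s \<in> {0, 1}"
  shows "grid_side (grid_pt n s k) = s" "grid_dist n (grid_pt n s k) = k"
proof -
  define N where "N = 2 * real n - 1"
  have N: "N > 0" using assms by (simp add: N_def)
  define w where "w = (2 * real k + 1) / (2 * N)"
  have w: "w > 0" using N by (simp add: w_def)
  have g: "grid_pt n s k = 1 / 2 + (2 * s - 1) * w"
    by (simp add: grid_pt_def w_def N_def)
  show "grid_side (grid_pt n s k) = s"
    using assms(2) w unfolding g grid_side_def by auto
  have "\<bar>2 * grid_pt n s k - 1\<bar> = 2 * w"
    using assms(2) w unfolding g by auto
  then have "(2 * real n - 1) * \<bar>2 * grid_pt n s k - 1\<bar> / 2 = real k + 1 / 2"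
    using N unfolding N_def[symmetric] by (simp add: w_def field_simps)
  moreover have "\<lfloor>real k + 1 / 2\<rfloor> = int k" by linarith
  ultimately show "grid_dist n (grid_pt n s k) = k"
    by (simp only: grid_dist_def nat_int)
qed

lemma grid_pt_eq_iff:
  assumes "n \<ge> 2" "s \<in> {0, 1}" "t \<in> {0, 1}"
  shows "grid_pt n s a = grid_pt n t b \<longleftrightarrow> s = t \<and> a = b"
  by (metis assms grid_pt_side_dist)

lemma grid_pt_last: "n \<ge> 2 \<Longrightarrow> grid_pt n s (n - 1) = s"
  by (simp add: grid_pt_def of_nat_diff field_simps)

text \<open>The centre cell has coordinate \<open>n - 1\<close>; hence the first arm cell has
  coordinate \<open>n\<close> on the side \<open>1\<close> and \<open>n - 2\<close> on the side
  \<open>0\<close>.\<close>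

definition arm_index :: "nat \<Rightarrow> real \<Rightarrow> nat \<Rightarrow> nat" where
  "arm_index n s k = (if s = 1 then n + k else n - 2 - k)"

lemma arm_index_coord:
  assumes "n \<ge> 2" "s \<in> {0, 1}" "k < n - 1"
  shows "(\<lambda>c. (1 / (2 * real n - 1)) * (c + real (arm_index n s k))) ` {0, 1} = {grid_pt n s k, grid_pt n s (Suc k)}"
    and "(\<lambda>c. (1 / (2 * real n - 1)) * (c + real (n - 1))) ` {0, 1} = {grid_pt n 0 0, grid_pt n 1 0}"
proof -
  have N: "2 * real n - 1 \<noteq> 0" using assms by linarith
  have "real (n - 2 - k) = real n - 2 - real k" using assms by (simp add: of_nat_diff)
  then show "(\<lambda>c. (1 / (2 * real n - 1)) * (c + real (arm_index n s k))) ` {0, 1} = {grid_pt n s k, grid_pt n s (Suc k)}"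
    using assms(2) N by (auto simp: arm_index_def grid_pt_def field_simps)
  show "(\<lambda>c. (1 / (2 * real n - 1)) * (c + real (n - 1))) ` {0, 1} = {grid_pt n 0 0, grid_pt n 1 0}"
    using assms(1) N by (auto simp: grid_pt_def of_nat_diff field_simps)
qed

section \<open>The centre cell and the four arms\<close>

lemma vicsek_map_corners:
  "vicsek_map n (i, j) ` square_corners =
     ((\<lambda>c. (1 / (2 * real n - 1)) * (c + real i)) ` {0, 1}) \<times> ((\<lambda>c. (1 / (2 * real n - 1)) * (c + real j)) ` {0, 1})"
  by (auto simp: square_corners_eq vicsek_map_def)

lemma cell_corners_arm:
  assumes "n \<ge> 2" "s \<in> {0, 1}" "t \<in> {0, 1}" "k < n - 1"
  shows "vicsek_map n (arm_index n s k, arm_index n t k) ` square_corners =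
    {grid_pt n s k, grid_pt n s (Suc k)} \<times> {grid_pt n t k, grid_pt n t (Suc k)}"
  unfolding vicsek_map_corners arm_index_coord(1)[OF assms(1,2,4)] arm_index_coord(1)[OF assms(1,3,4)] ..

lemma cell_corners_centre:
  assumes "n \<ge> 2"
  shows "vicsek_map n (n - 1, n - 1) ` square_corners =
    {grid_pt n 0 0, grid_pt n 1 0} \<times> {grid_pt n 0 0, grid_pt n 1 0}"
proof -
  have "0 < n - 1" using assms by simp
  then show ?thesis
    unfolding vicsek_map_corners arm_index_coord(2)[OF assms insertI1 \<open>0 < n - 1\<close>] by simp
qed

lemma vicsek_index_eq:
  assumes n: "n \<ge> 2"
  shows "vicsek_index n = insert (n - 1, n - 1)
    ((\<lambda>(s, t, k). (arm_index n s k, arm_index n t k)) ` ({0, 1} \<times> {0, 1} \<times> {..<n - 1}))"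
    (is "_ = ?R")
proof
  have mem: "(arm_index n s k, arm_index n t k) \<in> ?R" if "s \<in> {0, 1}" "t \<in> {0, 1}" "k < n - 1" for s t k
    using that by (intro insertI2 image_eqI[of _ _ "(s, t, k)"]) auto
  have m: "(1::real) \<in> {0, 1}" and m': "(0::real) \<in> {0, 1}" by simp_all
  show "vicsek_index n \<subseteq> ?R"
  proof
    fix x assume x: "x \<in> vicsek_index n"
    obtain i j where ij: "x = (i, j)" by (cases x)
    have bd: "i < 2 * n - 1" "j < 2 * n - 1" "i = j \<or> i + j = 2 * n - 2"
      using x ij by (auto simp: vicsek_index_def)
    consider "i = n - 1" | "n \<le> i" | "i < n - 1" by linarith
    then show "x \<in> ?R"
    proof cases
      case 1
      then have "j = n - 1" using bd(3) by linarith
      then show ?thesis using 1 ij by simp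
    next
      case 2
      define k where "k = i - n"
      have k: "k < n - 1" using bd(1) 2 unfolding k_def by linarith
      obtain r where r: "n = k + 2 + r"
        using k le_Suc_ex[of "k + 2" n] by force
      have i: "i = n + k" using 2 by (simp add: k_def)
      have "x = (arm_index n 1 k, arm_index n 1 k) \<or> x = (arm_index n 1 k, arm_index n 0 k)"
        using bd(3) unfolding ij arm_index_def prod.inject i r by (simp, arith)
      then show ?thesis
        using mem[OF m m k] mem[OF m m' k] by (elim disjE ssubst)
    next
      case 3
      define k where "k = n - 2 - i"
      have k: "k < n - 1" using 3 by (simp add: k_def)
      obtain r where r: "n = i + 2 + r"
        using 3 le_Suc_ex[of "i + 2" n] by force
      have "x = (arm_index n 0 k, arm_index n 0 k) \<or> x = (arm_index n 0 k, arm_index n 1 k)"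
        using bd(3) unfolding ij arm_index_def prod.inject k_def r by (simp, arith)
      then show ?thesis
        using mem[OF m' m' k] mem[OF m' m k] by (elim disjE ssubst)
    qed
  qed
  have arm: "(arm_index n s k, arm_index n t k) \<in> vicsek_index n" if "s \<in> {0, 1}" "t \<in> {0, 1}" "k < n - 1" for s t k
  proof -
    have "k + 2 \<le> n" using that(3) by linarith
    then obtain r where r: "n = k + 2 + r" using le_Suc_ex by blast
    have "arm_index n s k = n + k \<or> arm_index n s k = r" "arm_index n t k = n + k \<or> arm_index n t k = r"
      by (simp_all add: arm_index_def r)
    then show ?thesis
      unfolding vicsek_index_def r by (elim disjE) simp_all
  qed
  have "(case x of (s, t, k) \<Rightarrow> (arm_index n s k, arm_index n t k)) \<in> vicsek_index n"
    if "x \<in> {0, 1} \<times> {0, 1} \<times> {..<n - 1}" for x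
    using that arm by (cases x) (simp del: insert_iff)
  then show "?R \<subseteq> vicsek_index n"
    using n by (intro insert_subsetI image_subsetI) (simp_all add: vicsek_index_def)
qed

lemma sum_vicsek_index:
  fixes f :: "nat \<times> nat \<Rightarrow> real"
  assumes n: "n \<ge> 2"
  shows "(\<Sum>i\<in>vicsek_index n. f i) = f (n - 1, n - 1) +
    (\<Sum>s\<in>{0, 1}. \<Sum>t\<in>{0, 1}. \<Sum>k<n - 1. f (arm_index n s k, arm_index n t k))"
proof -
  let ?g = "\<lambda>(s :: real, t :: real, k). (arm_index n s k, arm_index n t k)"
  let ?S = "{0, 1} \<times> {0, 1} \<times> {..<n - 1} :: (real \<times> real \<times> nat) set"
  have inj1: "s = t \<and> k = l" if "arm_index n s k = arm_index n t l" "s \<in> {0, 1}" "t \<in> {0, 1}" "k < n - 1" "l < n - 1"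
    for s t k l
    using that n unfolding arm_index_def by (elim insertE) simp_all
  have inj: "inj_on ?g ?S"
  proof (rule inj_onI)
    fix x y assume xy: "x \<in> ?S" "y \<in> ?S" "?g x = ?g y"
    obtain s t k where x: "x = (s, t, k)" by (rule prod_cases3)
    obtain s' t' k' where y: "y = (s', t', k')" by (rule prod_cases3)
    have st: "s \<in> {0, 1}" "t \<in> {0, 1}" "k < n - 1" "s' \<in> {0, 1}" "t' \<in> {0, 1}" "k' < n - 1"
      using xy(1,2) unfolding x y by (simp_all del: insert_iff)
    have "arm_index n s k = arm_index n s' k'" "arm_index n t k = arm_index n t' k'"
      using xy(3) unfolding x y prod.case prod.inject by blast+
    from inj1[OF this(1) st(1,4,3,6)] inj1[OF this(2) st(2,5,3,6)] show "x = y"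
      unfolding x y by blast
  qed
  have "arm_index n s k \<noteq> n - 1" if "s \<in> {0, 1}" "k < n - 1" for s k
    using that n unfolding arm_index_def by (elim insertE) simp_all
  then have notin: "?g x \<noteq> (n - 1, n - 1)" if "x \<in> ?S" for x
    using that by (cases x) (simp del: insert_iff)
  have "(n - 1, n - 1) \<notin> ?g ` ?S"
  proof
    assume "(n - 1, n - 1) \<in> ?g ` ?S"
    then obtain x where "(n - 1, n - 1) = ?g x" "x \<in> ?S" by (rule imageE)
    with notin[of x] show False by simp
  qed
  then have "(\<Sum>i\<in>vicsek_index n. f i) = f (n - 1, n - 1) + (\<Sum>i\<in>?g ` ?S. f i)"
    unfolding vicsek_index_eq[OF n] by (intro sum.insert) simp_all
  also have "(\<Sum>i\<in>?g ` ?S. f i) = (\<Sum>(s, t, k)\<in>?S. f (arm_index n s k, arm_index n t k))"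
    by (subst sum.reindex[OF inj]) (simp add: case_prod_unfold)
  also have "\<dots> = (\<Sum>s\<in>{0, 1}. \<Sum>t\<in>{0, 1}. \<Sum>k<n - 1. f (arm_index n s k, arm_index n t k))"
    by (simp add: sum.cartesian_product[symmetric])
  finally show ?thesis .
qed

section \<open>The explicit extension and its defect\<close>

definition corner_avg :: "(real \<times> real \<Rightarrow> real) \<Rightarrow> real" where
  "corner_avg v = (\<Sum>c\<in>square_corners. v c) / 4"

text \<open>Corner data split into their mean and deviations of sum zero. Each part has its own
  solution of the recurrence, normalised to \<open>1\<close> at the outer corner
  \<open>k = n - 1\<close>. The deviations cancel in the centre cell, so the arms interact only
  through the mean.\<close>

definition arm_val :: "nat \<Rightarrow> real \<Rightarrow> (real \<times> real \<Rightarrow> real) \<Rightarrow> real \<times> real \<Rightarrow> nat \<Rightarrow> real" where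
  "arm_val n e v r k = corner_avg v * (sym_seq e k / sym_seq e (n - 1))
     + (v r - corner_avg v) * (arm_seq 2 e k / arm_seq 2 e (n - 1))"

text \<open>In an arm cell with diagonal values \<open>y\<^sub>k\<close>,
  \<open>y\<^sub>k\<^sub>+\<^sub>1\<close> the other two corners belong to no other cell. Giving
  both the value \<open>z\<close>, their equation is
  \<open>y\<^sub>k + y\<^sub>k\<^sub>+\<^sub>1 + z = 3 (1 - e) z\<close>, which is the division by
  \<open>2 - 3 e\<close>. Inserting \<open>z\<close> into the equation at a diagonal vertex between
  two arm cells gives the recurrence of \<open>arm_seq\<close>.\<close>

definition eigen_ext :: "nat \<Rightarrow> real \<Rightarrow> (real \<times> real \<Rightarrow> real) \<Rightarrow> real \<times> real \<Rightarrow> real" where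
  "eigen_ext n e v p =
     (let r = (grid_side (fst p), grid_side (snd p)); a = grid_dist n (fst p); b = grid_dist n (snd p)
      in if a = b then arm_val n e v r a else (arm_val n e v r a + arm_val n e v r b) / (2 - 3 * e))"

lemma eigen_ext_grid:
  assumes "n \<ge> 2" "s \<in> {0, 1}" "t \<in> {0, 1}"
  shows "eigen_ext n e v (grid_pt n s a, grid_pt n t b) =
    (if a = b then arm_val n e v (s, t) a else (arm_val n e v (s, t) a + arm_val n e v (s, t) b) / (2 - 3 * e))"
  using assms by (simp add: eigen_ext_def grid_pt_side_dist Let_def)

lemma eigen_ext_corner:
  assumes "n \<ge> 2" "sym_seq e (n - 1) \<noteq> 0" "arm_seq 2 e (n - 1) \<noteq> 0" "c \<in> square_corners"
  shows "eigen_ext n e v c = v c"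
proof -
  obtain s t where c: "c = (s, t)" "s \<in> {0, 1}" "t \<in> {0, 1}"
    using assms(4) unfolding square_corners_def by blast
  then show ?thesis
    using eigen_ext_grid[OF assms(1) c(2,3), of e v "n - 1" "n - 1", unfolded grid_pt_last[OF assms(1)]] assms
    by (simp add: arm_val_def)
qed

lemma arm_val_rec:
  "arm_val n e v r (Suc (Suc k)) = 2 * (1 - 3 * e) * arm_val n e v r (Suc k) - arm_val n e v r k"
  by (simp add: arm_val_def sym_seq_rec diff_divide_distrib add_divide_distrib algebra_simps)

lemma eigen_defect_cell:
  assumes "n \<ge> 2"
  shows "eigen_defect n 0 (u \<circ> vicsek_map n i) e (cell_coord n i p) =
    (if p \<in> vicsek_map n i ` square_corners
     then (\<Sum>y\<in>vicsek_map n i ` square_corners. u y) - (4 - 3 * e) * u p else 0)"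
proof -
  have "cell_coord n i p \<in> square_corners \<longleftrightarrow> p \<in> vicsek_map n i ` square_corners"
    by (metis assms image_iff vicsek_map_cell_coord)
  then show ?thesis
    unfolding eigen_defect_0 sum.reindex[OF inj_vicsek_map[OF assms]]
    by (simp add: vicsek_map_cell_coord[OF assms])
qed

lemma sum_eigen_ext_arm:
  assumes "n \<ge> 2" "s \<in> {0, 1}" "t \<in> {0, 1}" "k < n - 1" "e \<noteq> 2 / 3"
  shows "(\<Sum>y\<in>vicsek_map n (arm_index n s k, arm_index n t k) ` square_corners. eigen_ext n e v y)
    = (4 - 3 * e) / (2 - 3 * e) * (arm_val n e v (s, t) k + arm_val n e v (s, t) (Suc k))"
proof -


  have nz: "2 - 3 * e \<noteq> 0" using assms(5) by auto
  have "(\<Sum>y\<in>vicsek_map n (arm_index n s k, arm_index n t k) ` square_corners. eigen_ext n e v y)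
    = (\<Sum>x\<in>{grid_pt n s k, grid_pt n s (Suc k)}. \<Sum>y\<in>{grid_pt n t k, grid_pt n t (Suc k)}. eigen_ext n e v (x, y))"
    unfolding cell_corners_arm[OF assms(1-4)] by (simp add: sum.cartesian_product)
  also have "\<dots> = eigen_ext n e v (grid_pt n s k, grid_pt n t k) + eigen_ext n e v (grid_pt n s k, grid_pt n t (Suc k))
     + (eigen_ext n e v (grid_pt n s (Suc k), grid_pt n t k) + eigen_ext n e v (grid_pt n s (Suc k), grid_pt n t (Suc k)))"
    using grid_pt_eq_iff[OF assms(1,2,2)] grid_pt_eq_iff[OF assms(1,3,3)] by simp
  also have "\<dots> = (4 - 3 * e) / (2 - 3 * e) * (arm_val n e v (s, t) k + arm_val n e v (s, t) (Suc k))"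
  proof -
    define q where "q = 2 - 3 * e"
    have q: "q \<noteq> 0" "4 - 3 * e = q + 2" using nz by (simp_all add: q_def)
    show ?thesis
      unfolding eigen_ext_grid[OF assms(1-3)] q(2) unfolding q_def[symmetric]
      using q(1) by (simp add: field_simps)
  qed
  finally show ?thesis .
qed

lemma sum_eigen_ext_centre:
  assumes "n \<ge> 2"
  shows "(\<Sum>y\<in>vicsek_map n (n - 1, n - 1) ` square_corners. eigen_ext n e v y)
    = 4 * corner_avg v * (sym_seq e 0 / sym_seq e (n - 1))"
proof -
  have "(\<Sum>y\<in>vicsek_map n (n - 1, n - 1) ` square_corners. eigen_ext n e v y)
    = (\<Sum>x\<in>{grid_pt n 0 0, grid_pt n 1 0}. \<Sum>y\<in>{grid_pt n 0 0, grid_pt n 1 0}. eigen_ext n e v (x, y))"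
    unfolding cell_corners_centre[OF assms] by (simp add: sum.cartesian_product)
  also have "\<dots> = arm_val n e v (0, 0) 0 + arm_val n e v (0, 1) 0 + (arm_val n e v (1, 0) 0 + arm_val n e v (1, 1) 0)"
    using grid_pt_eq_iff[OF assms, of 0 1] by (simp add: eigen_ext_grid[OF assms])
  also have "\<dots> = 4 * corner_avg v * (sym_seq e 0 / sym_seq e (n - 1))
      + (v (0, 0) + v (0, 1) + v (1, 0) + v (1, 1) - 4 * corner_avg v) * (arm_seq 2 e 0 / arm_seq 2 e (n - 1))"
    by (simp add: arm_val_def algebra_simps add_divide_distrib diff_divide_distrib)
  also have "v (0, 0) + v (0, 1) + v (1, 0) + v (1, 1) - 4 * corner_avg v = 0"
    by (simp add: corner_avg_def square_corners_eq)
  finally show ?thesis by simp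
qed

text \<open>This is the decimation step: the extension satisfies the equation for \<open>e\<close>
  at every new vertex, and at an old corner its defect is a multiple of the defect of
  \<open>v\<close> for \<open>R(e)\<close>. The multiplier depends neither on \<open>v\<close> nor
  on the corner, so defects of cells meeting at a vertex can be added.\<close>

lemma eigen_ext_level_1:
  assumes n: "n \<ge> 2" and e: "e \<noteq> 2 / 3" and A: "arm_seq 2 e (n - 1) \<noteq> 0" and B: "sym_seq e (n - 1) \<noteq> 0"
  shows "(\<Sum>i\<in>vicsek_index n. eigen_defect n 0 (eigen_ext n e v \<circ> vicsek_map n i) e (cell_coord n i p)) =
    (4 - 3 * e) / (arm_seq 2 e (n - 1) * sym_seq e (n - 1)) * eigen_defect n 0 v (decimation n e) p"
proof -
  define K where "K = n - 1"
  have K: "K > 0" using n by (simp add: K_def)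
  define u where "u = eigen_ext n e v"
  define cell where "cell i = vicsek_map n i ` square_corners" for i
  define f where "f i = (if p \<in> cell i then (\<Sum>y\<in>cell i. u y) - (4 - 3 * e) * u p else 0)" for i
  define \<kappa> where "\<kappa> = (4 - 3 * e) / (arm_seq 2 e K * sym_seq e K)"
  have nz: "2 - 3 * e \<noteq> 0" using e by auto
  have total: "(\<Sum>i\<in>vicsek_index n. eigen_defect n 0 (u \<circ> vicsek_map n i) e (cell_coord n i p)) =
      f (K, K) + (\<Sum>s\<in>{0, 1}. \<Sum>t\<in>{0, 1}. \<Sum>k<K. f (arm_index n s k, arm_index n t k))"
    unfolding eigen_defect_cell[OF n] sum_vicsek_index[OF n] K_def f_def cell_def ..
  have centre: "cell (K, K) = {grid_pt n 0 0, grid_pt n 1 0} \<times> {grid_pt n 0 0, grid_pt n 1 0}"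
    unfolding cell_def K_def by (rule cell_corners_centre[OF n])
  have arm: "cell (arm_index n s k, arm_index n t k) = {grid_pt n s k, grid_pt n s (Suc k)} \<times> {grid_pt n t k, grid_pt n t (Suc k)}"
    if "s \<in> {0, 1}" "t \<in> {0, 1}" "k < K" for s t k
    unfolding cell_def using that by (intro cell_corners_arm[OF n]) (simp_all add: K_def)
  have corner: "s = grid_pt n s K" for s
    unfolding K_def by (simp only: grid_pt_last[OF n])
  show ?thesis
  proof (cases "\<exists>s\<in>{0, 1}. \<exists>t\<in>{0, 1}. \<exists>a b. p = (grid_pt n s a, grid_pt n t b)")
    case False
    have "f (K, K) = 0"
      using False unfolding f_def centre by auto
    moreover have "f (arm_index n s k, arm_index n t k) = 0" if "s \<in> {0, 1}" "t \<in> {0, 1}" "k < K" for s t k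
    proof -
      have "p \<notin> cell (arm_index n s k, arm_index n t k)"
        using False that(1,2) unfolding arm[OF that] by auto
      then show ?thesis by (simp add: f_def)
    qed
    moreover have "p \<notin> square_corners"
      using False corner unfolding square_corners_def by blast
    ultimately show ?thesis
      unfolding u_def[symmetric] total by (simp add: eigen_defect_0)
  next
    case True
    then obtain s t a b where st: "s \<in> {0, 1}" "t \<in> {0, 1}" and p: "p = (grid_pt n s a, grid_pt n t b)"
      by blast
    define y where "y k = arm_val n e v (s, t) k" for k
    have up: "u p = (if a = b then y a else (y a + y b) / (2 - 3 * e))"
      unfolding u_def p y_def by (rule eigen_ext_grid[OF n st])
    \<comment> \<open>This is the contribution of the cell number \<open>k\<close> on the arm that
      contains \<open>p\<close>; the other arms contribute nothing.\<close>
    define g where "g k = (if (a = k \<or> a = Suc k) \<and> (b = k \<or> b = Suc k)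
      then (4 - 3 * e) / (2 - 3 * e) * (y k + y (Suc k)) - (4 - 3 * e) * u p else 0)" for k
    have fc: "f (K, K) = (if a = 0 \<and> b = 0 then 4 * corner_avg v * (sym_seq e 0 / sym_seq e K) - (4 - 3 * e) * u p else 0)"
    proof -
      have "p \<in> cell (K, K) \<longleftrightarrow> a = 0 \<and> b = 0"
        using st unfolding centre p by (auto simp: grid_pt_eq_iff[OF n])
      then show ?thesis
        using sum_eigen_ext_centre[OF n, of e v]
        unfolding f_def cell_def K_def u_def by simp
    qed
    have fa: "f (arm_index n s' k, arm_index n t' k) = (if s' = s \<and> t' = t then g k else 0)"
      if st': "s' \<in> {0, 1}" "t' \<in> {0, 1}" and k: "k < K" for s' t' k
    proof -
      have "p \<in> cell (arm_index n s' k, arm_index n t' k) \<longleftrightarrow>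
          s' = s \<and> t' = t \<and> (a = k \<or> a = Suc k) \<and> (b = k \<or> b = Suc k)"
        unfolding arm[OF st' k] p mem_Times_iff fst_conv snd_conv insert_iff empty_iff
          grid_pt_eq_iff[OF n st(1) st'(1)] grid_pt_eq_iff[OF n st(2) st'(2)] by blast
      moreover have "(\<Sum>y\<in>cell (arm_index n s k, arm_index n t k). u y) = (4 - 3 * e) / (2 - 3 * e) * (y k + y (Suc k))"
        unfolding cell_def u_def y_def using k by (intro sum_eigen_ext_arm[OF n st _ e]) (simp add: K_def)
      ultimately show ?thesis
        by (auto simp: f_def g_def)
    qed
    have "(\<Sum>s'\<in>{0, 1}. \<Sum>t'\<in>{0, 1}. \<Sum>k<K. f (arm_index n s' k, arm_index n t' k))
       = (\<Sum>s'\<in>{0, 1}. \<Sum>t'\<in>{0, 1}. if s' = s \<and> t' = t then (\<Sum>k<K. g k) else 0)"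
    proof (intro sum.cong refl)
      fix s' t' :: real assume st': "s' \<in> {0, 1}" "t' \<in> {0, 1}"
      have "(\<Sum>k<K. f (arm_index n s' k, arm_index n t' k)) = (\<Sum>k<K. if s' = s \<and> t' = t then g k else 0)"
        by (rule sum.cong[OF refl]) (rule fa[OF st'], simp)
      then show "(\<Sum>k<K. f (arm_index n s' k, arm_index n t' k)) = (if s' = s \<and> t' = t then (\<Sum>k<K. g k) else 0)"
        by (auto split: if_split_asm)
    qed
    also have "\<dots> = (\<Sum>k<K. g k)"
      using st by (elim insertE) simp_all
    finally have total': "(\<Sum>i\<in>vicsek_index n. eigen_defect n 0 (u \<circ> vicsek_map n i) e (cell_coord n i p))
        = f (K, K) + (\<Sum>k<K. g k)"
      unfolding total by simp
    have pc: "p \<in> square_corners \<longleftrightarrow> a = K \<and> b = K"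
    proof
      assume "p \<in> square_corners"
      then have "grid_pt n s a \<in> {0, 1}" "grid_pt n t b \<in> {0, 1}"
        unfolding p square_corners_def mem_Sigma_iff by blast+
      then show "a = K \<and> b = K"
        using grid_pt_eq_iff[OF n st(1), of "grid_pt n s a" a K] grid_pt_eq_iff[OF n st(2), of "grid_pt n t b" b K]
        unfolding corner[symmetric] by blast
    next
      assume "a = K \<and> b = K"
      then show "p \<in> square_corners"
        using st unfolding p square_corners_def by (simp only: corner[symmetric] mem_Sigma_iff)
    qed
    show ?thesis
    proof (cases "a = b")
      case False
      \<comment> \<open>A vertex off the diagonal lies in at most one cell, and its value was chosen
        to satisfy the equation there.\<close>
      have "g k = 0" for k
        using nz False up unfolding g_def by (auto simp: add.commute)
      then show ?thesis
        using False pc unfolding u_def[symmetric] total' fc by (simp add: eigen_defect_0)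
    next
      case ab: True
      \<comment> \<open>A diagonal vertex at distance \<open>a\<close> belongs to the arm cells
        \<open>a\<close> and \<open>a - 1\<close>. At \<open>a = 0\<close> the centre cell takes the
        place of the second one, and at \<open>a = K\<close> the first one is missing.\<close>
      have "g k = (if k = a then g a else 0) + (if Suc k = a then g (a - 1) else 0)" for k
        by (auto simp: g_def)
      then have "(\<Sum>k<K. g k) = (\<Sum>k<K. (if k = a then g a else 0) + (if Suc k = a then g (a - 1) else 0))"
        by (intro sum.cong refl)
      also have "\<dots> = (if a < K then g a else 0) + (\<Sum>k<K. if Suc k = a then g (a - 1) else 0)"
        by (simp add: sum.distrib sum.delta)
      also have "(\<Sum>k<K. if Suc k = a then g (a - 1) else 0) = (if 0 < a \<and> a \<le> K then g (a - 1) else 0)"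
        by (cases a) (auto simp: sum.delta)
      finally have sg: "(\<Sum>k<K. g k) = (if a < K then g a else 0) + (if 0 < a \<and> a \<le> K then g (a - 1) else 0)" .
      have ga: "g a = (4 - 3 * e) / (2 - 3 * e) * (y a + y (Suc a)) - (4 - 3 * e) * y a"
        using ab up by (simp add: g_def)
      have ga': "g (a - 1) = (4 - 3 * e) / (2 - 3 * e) * (y (a - 1) + y a) - (4 - 3 * e) * y a" if "0 < a"
        using ab up that by (simp add: g_def)
      define \<alpha> \<delta> where "\<alpha> = corner_avg v / sym_seq e K" and "\<delta> = (v (s, t) - corner_avg v) / arm_seq 2 e K"
      have yk: "y k = \<alpha> * sym_seq e k + \<delta> * arm_seq 2 e k" for k
        by (simp add: y_def arm_val_def \<alpha>_def \<delta>_def K_def)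
      consider "a = 0" | "0 < a" "a < K" | "a = K" | "K < a" by linarith
      then show ?thesis
      proof cases
        case 1
        have "f (K, K) + (\<Sum>k<K. g k) = 4 * \<alpha> * sym_seq e 0 + (4 - 3 * e) / (2 - 3 * e) * (y 0 + y (Suc 0)) - 2 * ((4 - 3 * e) * y 0)"
          unfolding sg fc using 1 ab K ga up by (simp add: \<alpha>_def)
        \<comment> \<open>The equation at a centre corner holds separately for the mean part and for
          the deviations, because the starting values of \<open>sym_seq\<close> and
          \<open>arm_seq 2\<close> were chosen for it.\<close>
        also have "\<dots> = 0"
          unfolding yk sym_seq_rec arm_seq.simps using nz by (simp add: field_simps power2_eq_square)
        finally show ?thesis
          using 1 K pc unfolding u_def[symmetric] total' by (simp add: eigen_defect_0)
      next
        case 2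
        then obtain j where j: "a = Suc j" by (cases a) auto
        define q where "q = (4 - 3 * e) / (2 - 3 * e)"
        have "f (K, K) + (\<Sum>k<K. g k) = g a + g (a - 1)"
          unfolding sg fc using 2 by simp
        also have "\<dots> = q * (y j + 2 * y (Suc j) + y (Suc (Suc j))) - 2 * ((4 - 3 * e) * y (Suc j))"
          unfolding ga ga'[OF 2(1)] q_def[symmetric] by (simp add: j algebra_simps)
        also have "\<dots> = 0"
          unfolding q_def y_def arm_val_rec using nz by (simp add: field_simps)
        finally show ?thesis
          using 2 K pc unfolding u_def[symmetric] total' by (simp add: eigen_defect_0)
      next
        case 3
        obtain j where j: "K = Suc j" using K by (cases K) auto
        \<comment> \<open>Primed letters are values one step before the corner. The Casoratian
          eliminates \<open>A'\<close> and \<open>sym_seq_step\<close> eliminates \<open>B'\<close>.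
          Then the factor \<open>2 - 3 e\<close> cancels, and \<open>e * A * H\<close>, which is
          \<open>R(e)\<close>, remains as the new eigenvalue.\<close>
        define A' A B' B H w where "A' = arm_seq 2 e j" and "A = arm_seq 2 e K" and "B' = sym_seq e j"
          and "B = sym_seq e K" and "H = arm_seq 4 e K" and "w = v (s, t)"
        have nzAB: "A \<noteq> 0" "B \<noteq> 0" using assms(3,4) by (simp_all add: A_def B_def K_def)
        have B': "B' = (1 - 3 * e) * B + 3 * e * (2 - 3 * e) * H"
          using sym_seq_step[of e j] unfolding B'_def B_def H_def j by simp
        have "A' * B - A * B' = - 4 * (2 - 3 * e)"
          using arm_sym_wronskian[of e j] unfolding A'_def A_def B'_def B_def j .
        then have A': "A' = (A * B' - 4 * (2 - 3 * e)) / B"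
          using nzAB by (simp add: field_simps)
        have yK: "y K = w"
          using nzAB unfolding yk \<alpha>_def \<delta>_def A_def[symmetric] B_def[symmetric] w_def by simp
        have "y j + y K = corner_avg v / B * B' + (w - corner_avg v) / A * A' + w"
          unfolding yK by (simp add: yk \<alpha>_def \<delta>_def A_def B_def A'_def B'_def w_def)
        also have "\<dots> = w * B' / B + w - 4 * (2 - 3 * e) * (w - corner_avg v) / (A * B)"
          unfolding A' using nzAB by (simp add: field_simps)
        also have "\<dots> = (2 - 3 * e) * (w + 3 * e * H * w / B - 4 * (w - corner_avg v) / (A * B))"
          unfolding B' using nzAB by (simp add: field_simps)
        finally have yy: "y j + y K = \<dots>" .
        have "f (K, K) + (\<Sum>k<K. g k) = (4 - 3 * e) / (2 - 3 * e) * (y j + y K) - (4 - 3 * e) * w"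
          unfolding sg fc using 3 K ga' yK j by simp
        also have "\<dots> = (4 - 3 * e) * (w + 3 * e * H * w / B - 4 * (w - corner_avg v) / (A * B)) - (4 - 3 * e) * w"
          unfolding yy using nz by simp
        also have "\<dots> = (4 - 3 * e) * (3 * e * H * w / B - 4 * (w - corner_avg v) / (A * B))"
          by (simp only: right_diff_distrib distrib_left)
        also have "\<dots> = (4 - 3 * e) / (A * B) * (4 * corner_avg v - (4 - 3 * (e * A * H)) * w)"
          using nzAB by (simp add: field_simps)
        also have "4 * corner_avg v - (4 - 3 * (e * A * H)) * w = eigen_defect n 0 v (decimation n e) p"
        proof -
          have "p = (s, t)" unfolding p ab[symmetric] 3 using corner[of s] corner[of t] by simp
          moreover have "p \<in> square_corners" using pc 3 ab by simp
          ultimately show ?thesis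
            by (simp add: eigen_defect_0 corner_avg_def decimation_def A_def H_def K_def w_def)
        qed
        finally show ?thesis
          unfolding u_def[symmetric] total' A_def B_def K_def .
      next
        case 4
        then have "f (K, K) + (\<Sum>k<K. g k) = 0" unfolding sg fc by simp
        then show ?thesis
          using 4 pc unfolding u_def[symmetric] total' by (simp add: eigen_defect_0)
      qed
    qed
  qed
qed


subsection \<open>Extending an eigenfunction to all levels\<close>

definition bilinear_interp :: "(real \<times> real \<Rightarrow> real) \<Rightarrow> real \<times> real \<Rightarrow> real" where
  "bilinear_interp v p = (1 - fst p) * (1 - snd p) * v (0, 0) + (1 - fst p) * snd p * v (0, 1)
     + fst p * (1 - snd p) * v (1, 0) + fst p * snd p * v (1, 1)"

lemma bilinear_interp_corner: "c \<in> square_corners \<Longrightarrow> bilinear_interp v c = v c"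
  by (auto simp: bilinear_interp_def square_corners_eq)

lemma bilinear_interp_dist:
  assumes "p \<in> unit_square" "\<And>c. c \<in> square_corners \<Longrightarrow> \<bar>v c - y\<bar> \<le> M"
  shows "\<bar>bilinear_interp v p - y\<bar> \<le> M"
proof -
  obtain a b where p: "p = (a, b)" by (cases p)
  have ab: "0 \<le> a" "a \<le> 1" "0 \<le> b" "b \<le> 1" using assms(1) p by auto
  have v: "\<bar>v (s, t) - y\<bar> \<le> M" if "s \<in> {0, 1}" "t \<in> {0, 1}" for s t
    using assms(2)[of "(s, t)"] that unfolding square_corners_def mem_Sigma_iff by blast
  have "bilinear_interp v p - y = (1 - a) * (1 - b) * (v (0, 0) - y) + (1 - a) * b * (v (0, 1) - y)
     + a * (1 - b) * (v (1, 0) - y) + a * b * (v (1, 1) - y)"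
    by (simp add: bilinear_interp_def p algebra_simps)
  also have "\<bar>\<dots>\<bar> \<le> (1 - a) * (1 - b) * M + (1 - a) * b * M + a * (1 - b) * M + a * b * M"
    using v ab by (intro order_trans[OF abs_triangle_ineq] add_mono)
      (auto simp: abs_mult intro!: mult_left_mono)
  also have "\<dots> = M" by (simp add: algebra_simps)
  finally show ?thesis .
qed

text \<open>
  The argument \<open>t j\<close> is the eigenvalue on level \<open>j\<close>. Interpolating on the smallest cells makes every
  \<open>eigen_fun n m t v\<close> continuous on the whole Vicsek set.
\<close>

fun eigen_fun :: "nat \<Rightarrow> nat \<Rightarrow> (nat \<Rightarrow> real) \<Rightarrow> (real \<times> real \<Rightarrow> real) \<Rightarrow> real \<times> real \<Rightarrow> real" where
  "eigen_fun n 0 t v p = bilinear_interp v p"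
| "eigen_fun n (Suc m) t v p =
    (let i = (SOME i. i \<in> vicsek_index n \<and> cell_coord n i p \<in> unit_square)
     in eigen_fun n m (t \<circ> Suc) (eigen_ext n (t 1) v \<circ> vicsek_map n i) (cell_coord n i p))"

text \<open>The inequalities keep all denominators of \<open>eigen_ext\<close> away from
  \<open>0\<close>. The condition \<open>t j \<noteq> 4 / 3\<close> takes care of
  \<open>sym_seq (t (Suc j)) (n - 1)\<close>.\<close>

definition decimation_chain :: "nat \<Rightarrow> (nat \<Rightarrow> real) \<Rightarrow> bool" where
  "decimation_chain n t \<longleftrightarrow> (\<forall>j. decimation n (t (Suc j)) = t j \<and> t j \<noteq> 4 / 3 \<and>
     t (Suc j) \<noteq> 2 / 3 \<and> arm_seq 2 (t (Suc j)) (n - 1) \<noteq> 0)"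

lemma decimation_chain_shift: "decimation_chain n t \<Longrightarrow> decimation_chain n (t \<circ> Suc)"
  by (simp add: decimation_chain_def)

lemma decimation_chainD:
  assumes n: "n \<ge> 2" and t: "decimation_chain n t"
  shows "decimation n (t (Suc j)) = t j" "t (Suc j) \<noteq> 2 / 3" "arm_seq 2 (t (Suc j)) (n - 1) \<noteq> 0"
    "sym_seq (t (Suc j)) (n - 1) \<noteq> 0"
proof -
  define e where "e = t (Suc j)"
  show 1: "decimation n (t (Suc j)) = t j" "t (Suc j) \<noteq> 2 / 3" "arm_seq 2 (t (Suc j)) (n - 1) \<noteq> 0"
    using t by (auto simp: decimation_chain_def)
  have ne: "decimation n e \<noteq> 4 / 3"
    using t by (auto simp: decimation_chain_def e_def)
  obtain k where k: "n - 1 = Suc k" using n by (cases "n - 1") auto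
  show "sym_seq (t (Suc j)) (n - 1) \<noteq> 0"
  proof
    assume "sym_seq (t (Suc j)) (n - 1) = 0"
    then have B: "sym_seq e (Suc k) = 0" by (simp only: e_def k)
    \<comment> \<open>If the last value of \<open>sym_seq\<close> vanished, then
      \<open>sym_seq_step\<close> and the Casoratian would determine the same product in two ways,
      forcing \<open>3 R(e) = 4\<close>.\<close>
    have "arm_seq 2 e (Suc k) * (3 * e * (2 - 3 * e) * arm_seq 4 e (Suc k)) = 4 * (2 - 3 * e)"
      using sym_seq_step[of e k] arm_sym_wronskian[of e k] by (simp add: B)
    then have "(2 - 3 * e) * (3 * decimation n e) = (2 - 3 * e) * 4"
      by (simp only: decimation_def k) (simp add: algebra_simps)
    moreover have "2 - 3 * e \<noteq> 0" using 1(2) by (simp add: e_def)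
    ultimately have "3 * decimation n e = 4" by (simp only: mult_cancel_left) simp
    then show False using ne by simp
  qed
qed

lemma ex_cell_corner:
  assumes "n \<ge> 2" "c \<in> square_corners"
  obtains i where "i \<in> vicsek_index n" "cell_coord n i c \<in> square_corners"
proof -
  have "c \<in> vicsek_vertices n 0" using assms(2) by simp
  then have "c \<in> vicsek_vertices n (Suc 0)"
    using vicsek_vertices_mono_Suc[OF assms(1)] by blast
  then obtain i d where "i \<in> vicsek_index n" "d \<in> square_corners" "c = vicsek_map n i d"
    unfolding vicsek_vertices.simps by blast
  then show ?thesis
    using that[of i] vicsek_map_cell_coord(2)[OF assms(1)] by simp
qed

text \<open>This controls the arbitrary choice in \<open>eigen_fun\<close>: the chosen cell is
  either the given one, or the point is a corner of both.\<close>

lemma eigen_fun_Suc: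
  assumes n: "n \<ge> 2" and i: "i \<in> vicsek_index n" "cell_coord n i p \<in> unit_square"
  obtains j where "j \<in> vicsek_index n" "cell_coord n j p \<in> unit_square"
    "eigen_fun n (Suc m) t v p =
      eigen_fun n m (t \<circ> Suc) (eigen_ext n (t 1) v \<circ> vicsek_map n j) (cell_coord n j p)"
    "j \<noteq> i \<Longrightarrow> cell_coord n i p \<in> square_corners \<and> cell_coord n j p \<in> square_corners"
proof -
  define j where "j = (SOME i. i \<in> vicsek_index n \<and> cell_coord n i p \<in> unit_square)"
  have j: "j \<in> vicsek_index n" "cell_coord n j p \<in> unit_square"
    using someI[of "\<lambda>i. i \<in> vicsek_index n \<and> cell_coord n i p \<in> unit_square", OF conjI, OF i]
    unfolding j_def by blast+
  have "vicsek_map n i (cell_coord n i p) = vicsek_map n j (cell_coord n j p)"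
    using vicsek_map_cell_coord[OF n] by simp
  from cells_meet(1,2)[OF n i(1) j(1) _ i(2) j(2) this] show ?thesis
    by (intro that[of j] j) (auto simp: j_def Let_def)
qed

lemma eigen_fun_corner:
  assumes n: "n \<ge> 2"
  shows "decimation_chain n t \<Longrightarrow> c \<in> square_corners \<Longrightarrow> eigen_fun n m t v c = v c"
proof (induction m arbitrary: t v c)
  case 0
  then show ?case by (simp add: bilinear_interp_corner)
next
  case (Suc m)
  obtain i where i: "i \<in> vicsek_index n" "cell_coord n i c \<in> square_corners"
    using ex_cell_corner[OF n Suc.prems(2)] .
  then have "cell_coord n i c \<in> unit_square" using square_corners_subset by blast
  from eigen_fun_Suc[OF n i(1) this, of m t v] obtain j where j:
    "eigen_fun n (Suc m) t v c = eigen_fun n m (t \<circ> Suc) (eigen_ext n (t 1) v \<circ> vicsek_map n j) (cell_coord n j c)"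
    "j \<noteq> i \<Longrightarrow> cell_coord n i c \<in> square_corners \<and> cell_coord n j c \<in> square_corners"
    by metis
  then have "cell_coord n j c \<in> square_corners" using i by (cases "j = i") auto
  then have "eigen_fun n (Suc m) t v c = (eigen_ext n (t 1) v \<circ> vicsek_map n j) (cell_coord n j c)"
    unfolding j(1) by (rule Suc.IH[OF decimation_chain_shift[OF Suc.prems(1)]])
  then show ?case
    using eigen_ext_corner[OF n _ _ Suc.prems(2)] decimation_chainD[OF n Suc.prems(1), of 0]
    by (simp add: vicsek_map_cell_coord[OF n])
qed

text \<open>The choice of the cell is harmless: where two cells meet, both descriptions return the
  value of \<open>eigen_ext\<close> at the common corner, by \<open>eigen_fun_corner\<close>. From
  here on \<open>eigen_fun\<close> is used only through this self-similar form.\<close>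

lemma eigen_fun_cell:
  assumes n: "n \<ge> 2" and t: "decimation_chain n t" and i: "i \<in> vicsek_index n" and q: "q \<in> unit_square"
  shows "eigen_fun n (Suc m) t v (vicsek_map n i q) =
    eigen_fun n m (t \<circ> Suc) (eigen_ext n (t 1) v \<circ> vicsek_map n i) q"
proof -
  note [simp] = vicsek_map_cell_coord[OF n]
  have "cell_coord n i (vicsek_map n i q) \<in> unit_square" using q by simp
  from eigen_fun_Suc[OF n i this, of m t v] obtain j where j:
    "eigen_fun n (Suc m) t v (vicsek_map n i q) =
      eigen_fun n m (t \<circ> Suc) (eigen_ext n (t 1) v \<circ> vicsek_map n j) (cell_coord n j (vicsek_map n i q))"
    "j \<noteq> i \<Longrightarrow> cell_coord n i (vicsek_map n i q) \<in> square_corners \<and> cell_coord n j (vicsek_map n i q) \<in> square_corners"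
    by metis
  show ?thesis
  proof (cases "j = i")
    case True
    then show ?thesis using j(1) by simp
  next
    case False
    then show ?thesis
      using j eigen_fun_corner[OF n decimation_chain_shift[OF t]] by simp
  qed
qed

lemma eigen_defect_cong:
  assumes "n \<ge> 2" "\<And>q. q \<in> unit_square \<Longrightarrow> u q = w q"
  shows "eigen_defect n m u e x = eigen_defect n m w e x"
  unfolding eigen_defect_def
  by (rule sum.cong[OF refl]) (use assms vicsek_nbrs_subset_square[OF assms(1)] in metis)

text \<open>The constant must be the same for all corner data \<open>v\<close> and all points
  \<open>p\<close>, because the cells of the first level carry different data and their defects are
  summed at a vertex.\<close>

lemma eigen_fun_defect:
  assumes n: "n \<ge> 2"
  shows "decimation_chain n t \<Longrightarrow> \<exists>c. \<forall>v p. eigen_defect n m (eigen_fun n m t v) (t m) p = c * eigen_defect n 0 v (t 0) p"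
proof (induction m arbitrary: t)
  case 0
  have "eigen_defect n 0 (eigen_fun n 0 t v) (t 0) p = 1 * eigen_defect n 0 v (t 0) p" for v p
    unfolding eigen_defect_0 by (simp add: bilinear_interp_corner)
  then show ?case by blast
next
  case (Suc m)
  obtain c where c: "\<And>v p. eigen_defect n m (eigen_fun n m (t \<circ> Suc) v) ((t \<circ> Suc) m) p
      = c * eigen_defect n 0 v ((t \<circ> Suc) 0) p"
    using Suc.IH[OF decimation_chain_shift[OF Suc.prems]] by blast
  note D = decimation_chainD[OF n Suc.prems, of 0]
  define e where "e = t (Suc 0)"
  define k where "k = (4 - 3 * e) / (arm_seq 2 e (n - 1) * sym_seq e (n - 1))"
  have "eigen_defect n (Suc m) (eigen_fun n (Suc m) t v) (t (Suc m)) p = (c * k) * eigen_defect n 0 v (t 0) p" for v p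
  proof -
    have "eigen_defect n (Suc m) (eigen_fun n (Suc m) t v) (t (Suc m)) p =
       (\<Sum>i\<in>vicsek_index n. eigen_defect n m (eigen_fun n m (t \<circ> Suc) (eigen_ext n e v \<circ> vicsek_map n i)) (t (Suc m)) (cell_coord n i p))"
      unfolding eigen_defect_Suc[OF n]
    proof (rule sum.cong[OF refl])
      fix i assume i: "i \<in> vicsek_index n"
      show "eigen_defect n m (eigen_fun n (Suc m) t v \<circ> vicsek_map n i) (t (Suc m)) (cell_coord n i p) =
        eigen_defect n m (eigen_fun n m (t \<circ> Suc) (eigen_ext n e v \<circ> vicsek_map n i)) (t (Suc m)) (cell_coord n i p)"
        by (rule eigen_defect_cong[OF n]) (simp only: o_apply[of _ "vicsek_map n i"] eigen_fun_cell[OF n Suc.prems i], simp add: e_def)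
    qed
    also have "\<dots> = c * (\<Sum>i\<in>vicsek_index n. eigen_defect n 0 (eigen_ext n e v \<circ> vicsek_map n i) e (cell_coord n i p))"
      using c by (simp add: e_def sum_distrib_left)
    also have "\<dots> = (c * k) * eigen_defect n 0 v (t 0) p"
      using eigen_ext_level_1[OF n, of e v p] D by (simp add: k_def e_def)
    finally show ?thesis .
  qed
  then show ?case by blast
qed

lemma eigen_fun_stable_Suc:
  assumes n: "n \<ge> 2"
  shows "decimation_chain n t \<Longrightarrow> p \<in> vicsek_vertices n m \<Longrightarrow> eigen_fun n (Suc m) t v p = eigen_fun n m t v p"
proof (induction m arbitrary: t v p)
  case 0
  then have "p \<in> square_corners" by simp
  then show ?case using eigen_fun_corner[OF n 0(1)] by metis
next
  case (Suc m)
  then obtain i q where i: "i \<in> vicsek_index n" "q \<in> vicsek_vertices n m" and p: "p = vicsek_map n i q"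
    unfolding vicsek_vertices.simps by blast
  have q: "q \<in> unit_square" using i(2) vicsek_vertices_subset_square[OF n] by blast
  show ?case
    unfolding p eigen_fun_cell[OF n Suc.prems(1) i(1) q]
    by (rule Suc.IH[OF decimation_chain_shift[OF Suc.prems(1)] i(2)])
qed

lemma vicsek_vertices_mono: "n \<ge> 2 \<Longrightarrow> m \<le> k \<Longrightarrow> vicsek_vertices n m \<subseteq> vicsek_vertices n k"
  by (rule lift_Suc_mono_le[of "vicsek_vertices n"]) (rule vicsek_vertices_mono_Suc)

lemma eigen_fun_stable:
  assumes n: "n \<ge> 2" and t: "decimation_chain n t" and p: "p \<in> vicsek_vertices n m" and "m \<le> k"
  shows "eigen_fun n k t v p = eigen_fun n m t v p"
  using \<open>m \<le> k\<close>
proof (induction k rule: dec_induct)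
  case (step k)
  then have "p \<in> vicsek_vertices n k" using vicsek_vertices_mono[OF n] p by blast
  then show ?case using eigen_fun_stable_Suc[OF n t] step by simp
qed simp

lemma vicsek_set_properties:
  assumes n: "n \<ge> 2"
  shows "compact (vicsek_set n)" "vicsek_set n = (\<Union>i\<in>vicsek_index n. vicsek_map n i ` vicsek_set n)"
    "vicsek_set n \<subseteq> unit_square" "vicsek_vertices n m \<subseteq> vicsek_set n"
proof -
  show "compact (vicsek_set n)" "vicsek_set n = (\<Union>i\<in>vicsek_index n. vicsek_map n i ` vicsek_set n)"
    unfolding vicsek_set_eq_closure[OF n] by (fact vicsek_fixpoint_closure[OF n])+
  have "closed unit_square" by (intro closed_Times closed_atLeastAtMost)
  then show "vicsek_set n \<subseteq> unit_square"
    unfolding vicsek_set_eq_closure[OF n]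
    by (intro closure_minimal UN_least vicsek_vertices_subset_square[OF n])
  show "vicsek_vertices n m \<subseteq> vicsek_set n"
    unfolding vicsek_set_eq_closure[OF n] by (rule order_trans[OF UN_upper closure_subset]) simp
qed

text \<open>The cells of the first level are finitely many compact sets covering the Vicsek set, so
  continuity on each of them can be pasted together.\<close>

lemma continuous_eigen_fun:
  assumes n: "n \<ge> 2"
  shows "decimation_chain n t \<Longrightarrow> continuous_on (vicsek_set n) (eigen_fun n m t v)"
proof (induction m arbitrary: t v)
  case 0
  have "continuous_on (vicsek_set n) (bilinear_interp v)"
    unfolding bilinear_interp_def by (intro continuous_intros)
  then show ?case by (simp cong: continuous_on_cong)
next
  case (Suc m)
  let ?K = "vicsek_set n"
  have cm: "continuous_on S (vicsek_map n i)" "continuous_on S (cell_coord n i)" for S i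
    unfolding vicsek_map_def cell_coord_def by (intro continuous_intros)+
  have "continuous_on (vicsek_map n i ` ?K) (eigen_fun n (Suc m) t v)" if i: "i \<in> vicsek_index n" for i
  proof -
    let ?g = "eigen_fun n m (t \<circ> Suc) (eigen_ext n (t 1) v \<circ> vicsek_map n i)"
    have cont: "continuous_on (vicsek_map n i ` ?K) (\<lambda>p. ?g (cell_coord n i p))"
      by (rule continuous_on_compose2[OF Suc.IH[OF decimation_chain_shift[OF Suc.prems]] cm(2)])
         (auto simp: vicsek_map_cell_coord[OF n])
    have eq: "eigen_fun n (Suc m) t v p = ?g (cell_coord n i p)" if px: "p \<in> vicsek_map n i ` ?K" for p
    proof -
      obtain q where q: "q \<in> ?K" "p = vicsek_map n i q" using px by blast
      then have "q \<in> unit_square" using vicsek_set_properties(3)[OF n] by blast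
      then show ?thesis
        unfolding q(2) vicsek_map_cell_coord(2)[OF n] by (rule eigen_fun_cell[OF n Suc.prems i])
    qed
    show ?thesis by (rule continuous_on_eq[OF cont eq[symmetric]])
  qed
  moreover have "closed (vicsek_map n i ` ?K)" for i
    by (intro compact_imp_closed compact_continuous_image cm vicsek_set_properties(1)[OF n])
  ultimately have "continuous_on (\<Union>i\<in>vicsek_index n. vicsek_map n i ` ?K) (eigen_fun n (Suc m) t v)"
    by (intro continuous_on_closed_Union finite_vicsek_index)
  then show ?case by (subst vicsek_set_properties(2)[OF n])
qed


subsection \<open>Extension for small eigenvalues\<close>

lemma arm_seq_differentiable: "(\<lambda>e. arm_seq s e k) differentiable (at x)"
proof (induction k rule: induct_nat_012)
  case 0
  show ?case unfolding arm_seq.simps by (rule differentiable_const)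
next
  case 1
  show ?case unfolding arm_seq.simps by (intro derivative_intros)
next
  case (ge2 k)
  then show ?case unfolding arm_seq.simps by (intro derivative_intros) simp_all
qed

lemma differentiable_linear_bound:
  fixes f :: "real \<Rightarrow> real"
  assumes "f differentiable (at 0)"
  obtains C d where "C \<ge> 0" "d > 0" "\<And>e. 0 \<le> e \<Longrightarrow> e \<le> d \<Longrightarrow> \<bar>f e - f 0\<bar> \<le> C * e"
proof -
  obtain D where "(f has_real_derivative D) (at 0)"
    using assms real_differentiable_def by blast
  then have "((\<lambda>h. (f h - f 0) / h) \<longlongrightarrow> D) (at 0)"
    by (simp add: DERIV_def)
  then have "\<forall>\<^sub>F h in at 0. dist ((f h - f 0) / h) D < 1"
    by (rule tendstoD) simp
  then obtain d where d: "d > 0" "\<And>h. h \<noteq> 0 \<Longrightarrow> dist h 0 < d \<Longrightarrow> dist ((f h - f 0) / h) D < 1"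
    unfolding eventually_at by blast
  have "\<bar>f e - f 0\<bar> \<le> (\<bar>D\<bar> + 1) * e" if "0 \<le> e" "e \<le> d / 2" for e
  proof (cases "e = 0")
    case False
    then have e: "e > 0" "dist e 0 < d" using that d(1) by auto
    then have "\<bar>(f e - f 0) / e - D\<bar> < 1"
      using d(2)[of e] by (simp add: dist_real_def)
    then have "\<bar>(f e - f 0) / e\<bar> \<le> \<bar>D\<bar> + 1" by linarith
    then show ?thesis using e by (simp add: abs_divide pos_divide_le_eq)
  qed simp
  then show ?thesis using d(1) by (intro that[of "\<bar>D\<bar> + 1" "d / 2"]) auto
qed

lemma differentiable_linear_bound_finite:
  fixes f :: "'i \<Rightarrow> real \<Rightarrow> real"
  assumes "finite I" "\<And>i. i \<in> I \<Longrightarrow> f i differentiable (at 0)"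
  shows "\<exists>C d. C \<ge> 0 \<and> d > 0 \<and> (\<forall>i\<in>I. \<forall>e. 0 \<le> e \<and> e \<le> d \<longrightarrow> \<bar>f i e - f i 0\<bar> \<le> C * e)"
  using assms
proof (induction I rule: finite_induct)
  case empty
  then show ?case by (auto intro: exI[of _ 1])
next
  case (insert x I)
  obtain C d where C: "C \<ge> 0" "d > 0" "\<And>i e. i \<in> I \<Longrightarrow> 0 \<le> e \<Longrightarrow> e \<le> d \<Longrightarrow> \<bar>f i e - f i 0\<bar> \<le> C * e"
    using insert.IH insert.prems by auto
  obtain C' d' where C': "C' \<ge> 0" "d' > 0" "\<And>e. 0 \<le> e \<Longrightarrow> e \<le> d' \<Longrightarrow> \<bar>f x e - f x 0\<bar> \<le> C' * e"
    using differentiable_linear_bound[of "f x"] insert.prems by auto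
  have m: "C * e \<le> max C C' * e" "C' * e \<le> max C C' * e" if "0 \<le> e" for e
    using that by (auto intro: mult_right_mono)
  have "\<bar>f i e - f i 0\<bar> \<le> max C C' * e" if "i \<in> insert x I" "0 \<le> e" "e \<le> min d d'" for i e
    using that m[of e] C(3)[of i e] C'(3)[of e] by (cases "i = x") force+
  then show ?case using C(1,2) C'(2) by (intro exI[of _ "max C C'"] exI[of _ "min d d'"]) auto
qed

text \<open>At \<open>e = 0\<close> the sequence \<open>sym_seq\<close> is constant and
  \<open>arm_seq 2\<close> is linear. A vertex off the diagonal gets the mean of two diagonal
  values, so one formula, linear in \<open>a + b\<close>, covers both kinds of vertices.\<close>

lemma eigen_ext_zero:
  assumes n: "n \<ge> 2" and st: "s \<in> {0, 1}" "t \<in> {0, 1}"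
  shows "eigen_ext n 0 v (grid_pt n s a, grid_pt n t b) =
    corner_avg v + (v (s, t) - corner_avg v) * ((real a + real b + 1) / (2 * real n - 1))"
proof -
  have N: "1 + 2 * real (n - 1) = 2 * real n - 1" using n by (simp add: of_nat_diff)
  have nz: "2 * real n - 1 \<noteq> 0" using n by linarith
  have av: "arm_val n 0 v r k = corner_avg v + (v r - corner_avg v) * ((2 * real k + 1) / (2 * real n - 1))" for r k
    unfolding arm_val_def sym_seq_def arm_seq_at_0 N using N by (simp add: algebra_simps)
  define d w where "d = v (s, t) - corner_avg v" and "w = 2 * real n - 1"
  show ?thesis
    unfolding eigen_ext_grid[OF n st] av d_def[symmetric] w_def[symmetric]
    using nz unfolding w_def[symmetric] by (simp add: field_simps)
qed

lemma abs_corner_avg: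
  assumes "\<And>c. c \<in> square_corners \<Longrightarrow> \<bar>v c - y\<bar> \<le> M"
  shows "\<bar>corner_avg v - y\<bar> \<le> M"
proof -
  have "corner_avg v - y = (\<Sum>c\<in>square_corners. v c - y) / 4"
    by (simp add: corner_avg_def sum_subtractf square_corners_eq)
  also have "\<bar>\<dots>\<bar> \<le> (\<Sum>c\<in>square_corners. \<bar>v c - y\<bar>) / 4"
    using sum_abs by (simp add: divide_right_mono)
  also have "\<dots> \<le> (\<Sum>c\<in>square_corners. M) / 4"
    using assms by (intro divide_right_mono sum_mono) auto
  also have "\<dots> = M" by (simp add: square_corners_eq)
  finally show ?thesis .
qed

lemma cell_corner_cases:
  assumes n: "n \<ge> 2" and i: "i \<in> vicsek_index n"
  obtains (arm) s t k where "s \<in> {0, 1}" "t \<in> {0, 1}" "k < n - 1"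
      "\<And>c. c \<in> square_corners \<Longrightarrow> \<exists>a\<in>{k, Suc k}. \<exists>b\<in>{k, Suc k}. vicsek_map n i c = (grid_pt n s a, grid_pt n t b)"
    | (centre) "\<And>c. c \<in> square_corners \<Longrightarrow> \<exists>s\<in>{0, 1}. \<exists>t\<in>{0, 1}. vicsek_map n i c = (grid_pt n s 0, grid_pt n t 0)"
proof (cases "i = (n - 1, n - 1)")
  case True
  have "vicsek_map n i c \<in> {grid_pt n 0 0, grid_pt n 1 0} \<times> {grid_pt n 0 0, grid_pt n 1 0}" if "c \<in> square_corners" for c
    using cell_corners_centre[OF n] that unfolding True by (metis imageI)
  then show ?thesis by (intro centre) blast
next
  case False
  then obtain x where x: "i = (case x of (s, t, k) \<Rightarrow> (arm_index n s k, arm_index n t k))"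
    "x \<in> {0, 1} \<times> {0, 1} \<times> {..<n - 1}"
    using i unfolding vicsek_index_eq[OF n] by (elim insertE imageE) simp_all
  obtain s t k where xx: "x = (s, t, k)" by (rule prod_cases3)
  have st: "s \<in> {0, 1}" "t \<in> {0, 1}" "k < n - 1" and ii: "i = (arm_index n s k, arm_index n t k)"
    using x unfolding xx by (simp_all del: insert_iff)
  have "vicsek_map n i c \<in> {grid_pt n s k, grid_pt n s (Suc k)} \<times> {grid_pt n t k, grid_pt n t (Suc k)}" if "c \<in> square_corners" for c
    using cell_corners_arm[OF n st] that unfolding ii by (metis imageI)
  then show ?thesis by (intro arm[OF st]) blast
qed

text \<open>With \<open>N = 2 n - 1 >= 3\<close>, the number \<open>a + b\<close> varies by at most
  \<open>2\<close> inside an arm cell, and in the centre cell differences shrink by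
  \<open>1/N\<close>; this gives the factor \<open>2/3\<close>. The second bound holds because every
  value is a convex combination of a corner value and the corner mean.\<close>

lemma eigen_ext_zero_bounds:
  assumes n: "n \<ge> 2" and i: "i \<in> vicsek_index n" and c: "c \<in> square_corners" "c' \<in> square_corners"
    and osc: "\<And>c c'. c \<in> square_corners \<Longrightarrow> c' \<in> square_corners \<Longrightarrow> \<bar>v c - v c'\<bar> \<le> r"
  shows "\<bar>eigen_ext n 0 v (vicsek_map n i c) - eigen_ext n 0 v (vicsek_map n i c')\<bar> \<le> 2 / 3 * r"
    and "(\<And>c. c \<in> square_corners \<Longrightarrow> \<bar>v c - y\<bar> \<le> M) \<Longrightarrow> \<bar>eigen_ext n 0 v (vicsek_map n i c) - y\<bar> \<le> M"
proof -
  define N where "N = 2 * real n - 1"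
  define A where "A = corner_avg v"
  have N: "N \<ge> 3" using n by (simp add: N_def)
  have r0: "r \<ge> 0" using osc[OF c] by linarith
  have cs: "(s, t) \<in> square_corners" if "s \<in> {0, 1}" "t \<in> {0, 1}" for s t
    using that unfolding square_corners_def by blast
  have av: "\<bar>v (s, t) - A\<bar> \<le> r" if "s \<in> {0, 1}" "t \<in> {0, 1}" for s t
    using abs_corner_avg[of v "v (s, t)" r] osc cs[OF that] unfolding A_def by (metis abs_minus_commute)
  have z: "eigen_ext n 0 v (grid_pt n s a, grid_pt n t b) = A + (v (s, t) - A) * ((real a + real b + 1) / N)"
    if "s \<in> {0, 1}" "t \<in> {0, 1}" for s t a b
    unfolding A_def N_def by (rule eigen_ext_zero[OF n that])
  have third: "x / N \<le> x / 3" if "x \<ge> 0" for x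
    using that N by (intro divide_left_mono) auto
  show "\<bar>eigen_ext n 0 v (vicsek_map n i c) - eigen_ext n 0 v (vicsek_map n i c')\<bar> \<le> 2 / 3 * r"
    using n i
  proof (cases rule: cell_corner_cases)
    case (arm s t k)
    obtain a b where ab: "a \<in> {k, Suc k}" "b \<in> {k, Suc k}" "vicsek_map n i c = (grid_pt n s a, grid_pt n t b)"
      using arm(4)[OF c(1)] by blast
    obtain a' b' where ab': "a' \<in> {k, Suc k}" "b' \<in> {k, Suc k}" "vicsek_map n i c' = (grid_pt n s a', grid_pt n t b')"
      using arm(4)[OF c(2)] by blast
    define w where "w = real a + real b - real a' - real b'"
    have w: "\<bar>w\<bar> \<le> 2" using ab(1,2) ab'(1,2) by (auto simp: w_def)
    have "eigen_ext n 0 v (vicsek_map n i c) - eigen_ext n 0 v (vicsek_map n i c') = (v (s, t) - A) * w / N"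
      unfolding ab(3) ab'(3) z[OF arm(1,2)] w_def by (simp add: diff_divide_distrib algebra_simps add_divide_distrib)
    also have "\<bar>\<dots>\<bar> = \<bar>v (s, t) - A\<bar> * \<bar>w\<bar> / N"
      using N by (simp add: abs_mult)
    also have "\<dots> \<le> (r * 2) / N"
      using N av[OF arm(1,2)] w r0 by (intro divide_right_mono mult_mono) auto
    also have "\<dots> \<le> 2 / 3 * r" using third[of "r * 2"] r0 by simp
    finally show ?thesis .
  next
    case centre
    obtain s t where st: "s \<in> {0, 1}" "t \<in> {0, 1}" "vicsek_map n i c = (grid_pt n s 0, grid_pt n t 0)"
      using centre[OF c(1)] by blast
    obtain s' t' where st': "s' \<in> {0, 1}" "t' \<in> {0, 1}" "vicsek_map n i c' = (grid_pt n s' 0, grid_pt n t' 0)"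
      using centre[OF c(2)] by blast
    have "eigen_ext n 0 v (vicsek_map n i c) - eigen_ext n 0 v (vicsek_map n i c') = (v (s, t) - v (s', t')) / N"
      unfolding st(3) st'(3) z[OF st(1,2)] z[OF st'(1,2)] by (simp add: diff_divide_distrib algebra_simps)
    also have "\<bar>\<dots>\<bar> = \<bar>v (s, t) - v (s', t')\<bar> / N"
      using N by simp
    also have "\<dots> \<le> r / N"
      using N osc[OF cs[OF st(1,2)] cs[OF st'(1,2)]] by (intro divide_right_mono) auto
    also have "\<dots> \<le> 2 / 3 * r" using third[of r] r0 by simp
    finally show ?thesis .
  qed
  assume y: "\<And>c. c \<in> square_corners \<Longrightarrow> \<bar>v c - y\<bar> \<le> M"
  have conv: "\<bar>A + (w - A) * \<theta> - y\<bar> \<le> M" if "\<bar>w - y\<bar> \<le> M" "0 \<le> \<theta>" "\<theta> \<le> 1" for w \<theta>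
  proof -
    have "A + (w - A) * \<theta> - y = (1 - \<theta>) * (A - y) + \<theta> * (w - y)"
      by (simp add: algebra_simps)
    also have "\<bar>\<dots>\<bar> \<le> (1 - \<theta>) * M + \<theta> * M"
      using that abs_corner_avg[of v y M] y unfolding A_def
      by (intro order_trans[OF abs_triangle_ineq] add_mono) (auto simp: abs_mult intro!: mult_left_mono)
    finally show ?thesis by (simp add: algebra_simps)
  qed
  show "\<bar>eigen_ext n 0 v (vicsek_map n i c) - y\<bar> \<le> M"
    using n i
  proof (cases rule: cell_corner_cases)
    case (arm s t k)
    obtain a b where ab: "a \<in> {k, Suc k}" "b \<in> {k, Suc k}" "vicsek_map n i c = (grid_pt n s a, grid_pt n t b)"
      using arm(4)[OF c(1)] by blast
    have "a + b + 2 \<le> 2 * n" using ab(1,2) arm(3) by auto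
    then have "real (a + b + 2) \<le> real (2 * n)" by (simp only: of_nat_le_iff)
    then have "(real a + real b + 1) / N \<le> 1" using N by (simp add: N_def divide_le_eq)
    then show ?thesis
      unfolding ab(3) z[OF arm(1,2)] using N y[OF cs[OF arm(1,2)]] by (intro conv) auto
  next
    case centre
    obtain s t where st: "s \<in> {0, 1}" "t \<in> {0, 1}" "vicsek_map n i c = (grid_pt n s 0, grid_pt n t 0)"
      using centre[OF c(1)] by blast
    show ?thesis
      unfolding st(3) z[OF st(1,2)] using N y[OF cs[OF st(1,2)]] by (intro conv) auto
  qed
qed

text \<open>The extension is linear in \<open>v\<close>, with finitely many coefficients that are
  differentiable in \<open>e\<close> at \<open>0\<close>. Hence it differs from the harmonic
  extension by \<open>O(e)\<close> times the size of the data, uniformly over cells and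
  data.\<close>

lemma eigen_ext_perturbation:
  assumes n: "n \<ge> 2"
  shows "\<exists>C d. C \<ge> 0 \<and> d > 0 \<and> (\<forall>e v M i c. 0 \<le> e \<and> e \<le> d \<and> i \<in> vicsek_index n \<and> c \<in> square_corners \<and>
     (\<forall>c\<in>square_corners. \<bar>v c\<bar> \<le> M) \<longrightarrow>
     \<bar>eigen_ext n e v (vicsek_map n i c) - eigen_ext n 0 v (vicsek_map n i c)\<bar> \<le> C * e * M)"
proof -
  define ratio where "ratio g a b e = (if a = b then g e a / g e (n - 1) else (g e a / g e (n - 1) + g e b / g e (n - 1)) / (2 - 3 * e))"
    for g :: "real \<Rightarrow> nat \<Rightarrow> real" and a b :: nat and e :: real
  have "sym_seq 0 (n - 1) = 4" by (simp add: sym_seq_def arm_seq_at_0)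
  moreover have "arm_seq 2 0 (n - 1) > 0" unfolding arm_seq_at_0 by (simp add: add_pos_nonneg)
  ultimately have nz: "sym_seq 0 (n - 1) \<noteq> 0" "arm_seq 2 0 (n - 1) \<noteq> 0" by linarith+
  have sd: "(\<lambda>e. sym_seq e k) differentiable (at 0)" for k
    unfolding sym_seq_def by (intro derivative_intros arm_seq_differentiable)
  have dif: "ratio sym_seq a b differentiable (at 0)" "ratio (arm_seq 2) a b differentiable (at 0)" for a b
    unfolding ratio_def[abs_def] using nz
    by (cases "a = b"; simp; intro derivative_intros arm_seq_differentiable sd; simp)+
  have fin: "finite ({..n} \<times> {..n})" by simp
  obtain C d where C: "C \<ge> 0" "d > 0"
    "\<And>a b e. a \<le> n \<Longrightarrow> b \<le> n \<Longrightarrow> 0 \<le> e \<Longrightarrow> e \<le> d \<Longrightarrow> \<bar>ratio sym_seq a b e - ratio sym_seq a b 0\<bar> \<le> C * e"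
    using differentiable_linear_bound_finite[OF fin, of "\<lambda>(a, b). ratio sym_seq a b"] dif by auto
  obtain C' d' where C': "C' \<ge> 0" "d' > 0"
    "\<And>a b e. a \<le> n \<Longrightarrow> b \<le> n \<Longrightarrow> 0 \<le> e \<Longrightarrow> e \<le> d' \<Longrightarrow> \<bar>ratio (arm_seq 2) a b e - ratio (arm_seq 2) a b 0\<bar> \<le> C' * e"
    using differentiable_linear_bound_finite[OF fin, of "\<lambda>(a, b). ratio (arm_seq 2) a b"] dif by auto
  have ext: "eigen_ext n e v (grid_pt n s a, grid_pt n t b) =
      corner_avg v * ratio sym_seq a b e + (v (s, t) - corner_avg v) * ratio (arm_seq 2) a b e"
    if "s \<in> {0, 1}" "t \<in> {0, 1}" for e v s t a b
    unfolding eigen_ext_grid[OF n that] arm_val_def ratio_def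
    by (simp add: add_divide_distrib distrib_left)
  have main: "\<bar>eigen_ext n e v (grid_pt n s a, grid_pt n t b) - eigen_ext n 0 v (grid_pt n s a, grid_pt n t b)\<bar> \<le> (C + 2 * C') * e * M"
    if st: "s \<in> {0, 1}" "t \<in> {0, 1}" and e: "0 \<le> e" "e \<le> min d d'" and ab: "a \<le> n" "b \<le> n"
      and M: "\<And>c. c \<in> square_corners \<Longrightarrow> \<bar>v c\<bar> \<le> M" for s t e a b v M
  proof -
    have "(s, t) \<in> square_corners" using st unfolding square_corners_def by blast
    then have vM: "\<bar>v (s, t)\<bar> \<le> M" by (rule M)
    have aM: "\<bar>corner_avg v\<bar> \<le> M" using abs_corner_avg[of v 0 M] M by simp
    have "eigen_ext n e v (grid_pt n s a, grid_pt n t b) - eigen_ext n 0 v (grid_pt n s a, grid_pt n t b)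
      = corner_avg v * (ratio sym_seq a b e - ratio sym_seq a b 0)
        + (v (s, t) - corner_avg v) * (ratio (arm_seq 2) a b e - ratio (arm_seq 2) a b 0)"
      unfolding ext[OF st] by (simp add: algebra_simps)
    also have "\<bar>\<dots>\<bar> \<le> M * (C * e) + (2 * M) * (C' * e)"
      using C(3)[OF ab e(1)] C'(3)[OF ab e(1)] e vM aM
      by (intro order_trans[OF abs_triangle_ineq] add_mono) (auto simp: abs_mult intro!: mult_mono)
    also have "\<dots> = (C + 2 * C') * e * M" by (simp add: algebra_simps)
    finally show ?thesis .
  qed
  have "\<bar>eigen_ext n e v (vicsek_map n i c) - eigen_ext n 0 v (vicsek_map n i c)\<bar> \<le> (C + 2 * C') * e * M"
    if e: "0 \<le> e" "e \<le> min d d'" and i: "i \<in> vicsek_index n" and c: "c \<in> square_corners"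
      and M: "\<forall>c\<in>square_corners. \<bar>v c\<bar> \<le> M" for e v M i c
    using n i
  proof (cases rule: cell_corner_cases)
    case (arm s t k)
    obtain a b where ab: "a \<in> {k, Suc k}" "b \<in> {k, Suc k}" "vicsek_map n i c = (grid_pt n s a, grid_pt n t b)"
      using arm(4)[OF c] by blast
    then have "a \<le> n" "b \<le> n" using arm(3) by auto
    then show ?thesis unfolding ab(3) using arm(1,2) e M by (intro main) blast+
  next
    case centre
    obtain s t where st: "s \<in> {0, 1}" "t \<in> {0, 1}" "vicsek_map n i c = (grid_pt n s 0, grid_pt n t 0)"
      using centre[OF c] by blast
    show ?thesis unfolding st(3) using st(1,2) e M by (intro main) (blast | simp)+
  qed
  then show ?thesis
    using C(1,2) C'(1,2) by (intro exI[of _ "C + 2 * C'"] exI[of _ "min d d'"]) auto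
qed


subsection \<open>Uniform convergence\<close>

definition extends_uniformly :: "nat \<Rightarrow> (nat \<Rightarrow> real) \<Rightarrow> bool" where
  "extends_uniformly n t \<longleftrightarrow>
     (\<forall>v. uniformly_convergent_on (vicsek_set n) (\<lambda>m. eigen_fun n m t v))"

text \<open>The estimate for convergence needs small eigenvalues, which only a tail of the chain
  provides. One level can be put back in front because it consists of finitely many cells, each
  carrying a function of the shifted chain.\<close>

lemma extends_uniformly_unshift:
  assumes n: "n \<ge> 2" and t: "decimation_chain n t" and conv: "extends_uniformly n (t \<circ> Suc)"
  shows "extends_uniformly n t"
  unfolding extends_uniformly_def
proof
  fix v
  let ?K = "vicsek_set n"
  let ?v = "\<lambda>i. eigen_ext n (t 1) v \<circ> vicsek_map n i"
  have "uniformly_Cauchy_on ?K (\<lambda>m. eigen_fun n m t v)"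
  proof (rule uniformly_Cauchy_onI)
    fix e :: real assume e: "e > 0"
    have "\<exists>M. \<forall>x\<in>?K. \<forall>m\<ge>M. \<forall>k\<ge>M. dist (eigen_fun n m (t \<circ> Suc) (?v i) x) (eigen_fun n k (t \<circ> Suc) (?v i) x) < e" for i
      using conv e unfolding extends_uniformly_def uniformly_convergent_eq_Cauchy uniformly_Cauchy_on_def by blast
    then obtain M where M: "\<And>i x m k. x \<in> ?K \<Longrightarrow> M i \<le> m \<Longrightarrow> M i \<le> k \<Longrightarrow>
        dist (eigen_fun n m (t \<circ> Suc) (?v i) x) (eigen_fun n k (t \<circ> Suc) (?v i) x) < e"
      by metis
    \<comment> \<open>The additional \<open>Suc\<close> pays for the level that is consumed on
      entering a cell.\<close>
    define L where "L = Suc (Max (M ` vicsek_index n))"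
    have "dist (eigen_fun n m t v x) (eigen_fun n k t v x) < e" if x: "x \<in> ?K" and mk: "L \<le> m" "L \<le> k" for x m k
    proof -
      obtain i q where i: "i \<in> vicsek_index n" "q \<in> ?K" "x = vicsek_map n i q"
        using x vicsek_set_properties(2)[OF n] by blast
      have q: "q \<in> unit_square" using i(2) vicsek_set_properties(3)[OF n] by blast
      have "M i \<le> Max (M ` vicsek_index n)" using i(1) finite_vicsek_index by (intro Max_ge) auto
      moreover obtain m' k' where "m = Suc m'" "k = Suc k'"
        using mk unfolding L_def by (metis Suc_le_D)
      ultimately show ?thesis
        using mk M[OF i(2), of i m' k'] eigen_fun_cell[OF n t i(1) q] unfolding L_def i(3) by simp
    qed
    then show "\<exists>M. \<forall>x\<in>?K. \<forall>m\<ge>M. \<forall>k\<ge>M. dist (eigen_fun n m t v x) (eigen_fun n k t v x) < e"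
      by blast
  qed
  then show "uniformly_convergent_on ?K (\<lambda>m. eigen_fun n m t v)"
    by (simp add: uniformly_convergent_eq_Cauchy)
qed

text \<open>The harmonic extension contracts the oscillation \<open>r\<close> of the corner data,
  and the perturbation adds an amount proportional to \<open>t 0\<close> times their size
  \<open>M\<close>. Since \<open>t\<close> decays geometrically, a weighted sum of both quantities
  still contracts.\<close>

lemma extends_uniformly_small:
  assumes n: "n \<ge> 2"
  obtains d where "d > 0"
    "\<And>t. decimation_chain n t \<Longrightarrow> (\<And>j. 0 \<le> t j) \<Longrightarrow> (\<And>j. t (Suc j) \<le> t j / 3) \<Longrightarrow> t 0 \<le> d \<Longrightarrow> extends_uniformly n t"
proof -
  obtain C d where C: "C \<ge> 0" "d > 0" and
    pert': "\<forall>e v M i c. 0 \<le> e \<and> e \<le> d \<and> i \<in> vicsek_index n \<and> c \<in> square_corners \<and>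
     (\<forall>c\<in>square_corners. \<bar>v c\<bar> \<le> M) \<longrightarrow>
     \<bar>eigen_ext n e v (vicsek_map n i c) - eigen_ext n 0 v (vicsek_map n i c)\<bar> \<le> C * e * M"
    using eigen_ext_perturbation[OF n] by (elim exE conjE)
  have pert:
    "\<And>e v M i c. 0 \<le> e \<Longrightarrow> e \<le> d \<Longrightarrow> i \<in> vicsek_index n \<Longrightarrow> c \<in> square_corners \<Longrightarrow>
     (\<And>c. c \<in> square_corners \<Longrightarrow> \<bar>v c\<bar> \<le> M) \<Longrightarrow>
     \<bar>eigen_ext n e v (vicsek_map n i c) - eigen_ext n 0 v (vicsek_map n i c)\<bar> \<le> C * e * M"
    by (rule pert'[rule_format]) blast
  define \<delta> where "\<delta> = min d (1 / (2 * C + 1))"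
  have \<delta>: "\<delta> > 0" "\<delta> \<le> d" "C * \<delta> \<le> 1 / 2"
  proof -
    show "\<delta> > 0" "\<delta> \<le> d" using C by (auto simp: \<delta>_def)
    have "C * \<delta> \<le> C * (1 / (2 * C + 1))" using C by (intro mult_left_mono) (auto simp: \<delta>_def)
    also have "\<dots> \<le> 1 / 2" using C by (simp add: divide_simps)
    finally show "C * \<delta> \<le> 1 / 2" .
  qed
  let ?K = "vicsek_set n"
  \<comment> \<open>The contracting quantity is \<open>r + 4 X\<close> with
    \<open>X = C * t 0 * M\<close>. Entering a cell replaces \<open>r\<close> by
    \<open>2/3 r + 2/3 X\<close>, \<open>M\<close> by \<open>M + X/3\<close> and \<open>t 0\<close>
    by at most a third of it.\<close>
  have step: "\<bar>eigen_fun n (Suc m) t v p - eigen_fun n m t v p\<bar> \<le> (3 / 4) ^ m * (r + 4 * C * t 0 * M)"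
    if "decimation_chain n t" "\<And>j. 0 \<le> t j" "\<And>j. t (Suc j) \<le> t j / 3" "t 0 \<le> \<delta>"
      "\<And>c. c \<in> square_corners \<Longrightarrow> \<bar>v c\<bar> \<le> M"
      "\<And>c c'. c \<in> square_corners \<Longrightarrow> c' \<in> square_corners \<Longrightarrow> \<bar>v c - v c'\<bar> \<le> r" "p \<in> ?K"
    for m t v M r p
    using that
  proof (induction m arbitrary: t v M r p)
    case (0 t v M r p)
    define e where "e = t 1"
    have t0: "0 \<le> t 0" and e: "0 \<le> e" "e \<le> t 0"
      using 0(2)[of 0] 0(2)[of 1] 0(3)[of 0] by (simp_all add: e_def)
    have corner: "(0, 0) \<in> square_corners" by (simp add: square_corners_eq)
    have M0: "0 \<le> M" using 0(5)[OF corner] by linarith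
    obtain i q where i: "i \<in> vicsek_index n" "q \<in> ?K" "p = vicsek_map n i q"
      using 0(7) vicsek_set_properties(2)[OF n] by blast
    have q: "q \<in> unit_square" "p \<in> unit_square" using i(2) 0(7) vicsek_set_properties(3)[OF n] by blast+
    have bnd: "\<bar>eigen_ext n e v (vicsek_map n i c) - v c'\<bar> \<le> r + C * e * M"
      if c: "c \<in> square_corners" "c' \<in> square_corners" for c c'
    proof -
      have "\<bar>eigen_ext n 0 v (vicsek_map n i c) - v c'\<bar> \<le> r"
        by (rule eigen_ext_zero_bounds(2)[OF n i(1) c 0(6)]) (use 0(6) c in auto)
      moreover have "\<bar>eigen_ext n e v (vicsek_map n i c) - eigen_ext n 0 v (vicsek_map n i c)\<bar> \<le> C * e * M"
        by (rule pert[OF e(1) _ i(1) c(1) 0(5)]) (use e 0(4) \<delta>(2) in linarith)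
      ultimately show ?thesis by linarith
    qed
    have "\<bar>bilinear_interp (eigen_ext n e v \<circ> vicsek_map n i) q - v c'\<bar> \<le> r + C * e * M" if "c' \<in> square_corners" for c'
      by (rule bilinear_interp_dist[OF q(1)]) (use bnd that in simp)
    then have "\<bar>bilinear_interp v p - bilinear_interp (eigen_ext n e v \<circ> vicsek_map n i) q\<bar> \<le> r + C * e * M"
      by (intro bilinear_interp_dist[OF q(2)]) (simp add: abs_minus_commute)
    moreover have "eigen_fun n (Suc 0) t v p = bilinear_interp (eigen_ext n e v \<circ> vicsek_map n i) q"
      unfolding i(3) eigen_fun_cell[OF n 0(1) i(1) q(1)] e_def by simp
    moreover have "C * e * M \<le> C * t 0 * M"
      using C e M0 by (intro mult_right_mono mult_left_mono) auto
    moreover have "0 \<le> C * t 0 * M" using C t0 M0 by simp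
    ultimately show ?case by simp
  next
    case (Suc m t v M r p)
    define e where "e = t 1"
    have t0: "0 \<le> t 0" and e: "0 \<le> e" "e \<le> t 0 / 3"
      using Suc.prems(2)[of 0] Suc.prems(2)[of 1] Suc.prems(3)[of 0] by (simp_all add: e_def)
    have ed: "e \<le> d" "e \<le> t 0" and te: "t 0 \<le> \<delta>" using e t0 Suc.prems(4) \<delta>(2) by linarith+
    have corner: "(0, 0) \<in> square_corners" by (simp add: square_corners_eq)
    have M0: "0 \<le> M" using Suc.prems(5)[OF corner] by linarith
    have r0: "0 \<le> r" using Suc.prems(6)[OF corner corner] by linarith
    obtain i q where i: "i \<in> vicsek_index n" "q \<in> ?K" "p = vicsek_map n i q"
      using Suc.prems(7) vicsek_set_properties(2)[OF n] by blast
    have q: "q \<in> unit_square" using i(2) vicsek_set_properties(3)[OF n] by blast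
    let ?w = "eigen_ext n e v \<circ> vicsek_map n i"
    define X where "X = C * t 0 * M"
    have X0: "0 \<le> X" using C t0 M0 by (simp add: X_def)
    have P: "\<bar>?w c - eigen_ext n 0 v (vicsek_map n i c)\<bar> \<le> X / 3" if "c \<in> square_corners" for c
    proof -
      have "C * e * M \<le> C * (t 0 / 3) * M" using C e M0 by (intro mult_right_mono mult_left_mono) auto
      moreover have "C * (t 0 / 3) * M = X / 3" by (simp add: X_def)
      moreover have "\<bar>?w c - eigen_ext n 0 v (vicsek_map n i c)\<bar> \<le> C * e * M"
        unfolding o_apply by (rule pert[OF e(1) ed(1) i(1) that]) (rule Suc.prems(5))
      ultimately show ?thesis by linarith
    qed
    have w1: "\<bar>?w c\<bar> \<le> M + X / 3" if c: "c \<in> square_corners" for c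
    proof -
      have "\<bar>eigen_ext n 0 v (vicsek_map n i c) - 0\<bar> \<le> M"
        by (rule eigen_ext_zero_bounds(2)[OF n i(1) c c Suc.prems(6)]) (use Suc.prems(5) in auto)
      then show ?thesis using P[OF c] by linarith
    qed
    have w2: "\<bar>?w c - ?w c'\<bar> \<le> 2 / 3 * r + 2 / 3 * X" if c: "c \<in> square_corners" "c' \<in> square_corners" for c c'
    proof -
      have "\<bar>eigen_ext n 0 v (vicsek_map n i c) - eigen_ext n 0 v (vicsek_map n i c')\<bar> \<le> 2 / 3 * r"
        by (rule eigen_ext_zero_bounds(1)[OF n i(1) c Suc.prems(6)])
      then show ?thesis using P[OF c(1)] P[OF c(2)] by linarith
    qed
    have "eigen_fun n (Suc (Suc m)) t v p - eigen_fun n (Suc m) t v p =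
      eigen_fun n (Suc m) (t \<circ> Suc) ?w q - eigen_fun n m (t \<circ> Suc) ?w q"
      unfolding i(3) eigen_fun_cell[OF n Suc.prems(1) i(1) q] e_def ..
    also have "\<bar>\<dots>\<bar> \<le> (3 / 4) ^ m * (2 / 3 * r + 2 / 3 * X + 4 * C * (t \<circ> Suc) 0 * (M + X / 3))"
    proof (rule Suc.IH)
      show "decimation_chain n (t \<circ> Suc)" by (rule decimation_chain_shift[OF Suc.prems(1)])
      show "0 \<le> (t \<circ> Suc) j" "(t \<circ> Suc) (Suc j) \<le> (t \<circ> Suc) j / 3" for j
        using Suc.prems(2,3) by simp_all
      show "(t \<circ> Suc) 0 \<le> \<delta>" using ed te by (simp add: e_def)
      show "\<bar>?w c\<bar> \<le> M + X / 3" if "c \<in> square_corners" for c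
        by (rule w1[OF that])
      show "\<bar>?w c - ?w c'\<bar> \<le> 2 / 3 * r + 2 / 3 * X" if "c \<in> square_corners" "c' \<in> square_corners" for c c'
        by (rule w2[OF that])
      show "q \<in> ?K" by (rule i(2))
    qed
    \<comment> \<open>With \<open>C * t 0 <= 1/2\<close> the new quantity is at most
      \<open>2/3 r + 20/9 X\<close>, which is below \<open>3/4 r + 3 X\<close>. The choice of
      \<open>\<delta>\<close> serves this inequality.\<close>
    also have "\<dots> \<le> (3 / 4) ^ m * (3 / 4 * (r + 4 * X))"
    proof (rule mult_left_mono)
      have "C * t 0 \<le> C * \<delta>" using C te by (intro mult_left_mono) auto
      then have "C * t 0 \<le> 1 / 2" using \<delta>(3) by linarith
      then have "(C * t 0) * (4 / 9 * X) \<le> 1 / 2 * (4 / 9 * X)" using X0 by (intro mult_right_mono) auto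
      moreover have "4 * C * (t \<circ> Suc) 0 * (M + X / 3) \<le> 4 * C * (t 0 / 3) * (M + X / 3)"
        using C e M0 X0 by (intro mult_right_mono mult_left_mono) (auto simp: e_def)
      moreover have "4 * C * (t 0 / 3) * (M + X / 3) = 4 / 3 * X + (C * t 0) * (4 / 9 * X)"
        by (simp add: X_def algebra_simps)
      ultimately have "4 * C * (t \<circ> Suc) 0 * (M + X / 3) \<le> 4 / 3 * X + 1 / 2 * (4 / 9 * X)"
        by simp
      moreover have "2 / 3 * r + 2 / 3 * X + Y \<le> 3 / 4 * (r + 4 * X)" if "Y \<le> 4 / 3 * X + 1 / 2 * (4 / 9 * X)" for Y
      proof -
        have "2 / 3 * r \<le> 3 / 4 * r" using r0 by (intro mult_right_mono) auto
        moreover have "20 / 9 * X \<le> 3 * X" using X0 by (intro mult_right_mono) auto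
        ultimately show ?thesis using that by (simp add: field_simps)
      qed
      ultimately show "2 / 3 * r + 2 / 3 * X + 4 * C * (t \<circ> Suc) 0 * (M + X / 3) \<le> 3 / 4 * (r + 4 * X)"
        by blast
    qed simp
    also have "\<dots> = (3 / 4) ^ Suc m * (r + 4 * C * t 0 * M)" by (simp add: X_def)
    finally show ?case .
  qed
  have "extends_uniformly n t"
    if t: "decimation_chain n t" "\<And>j. 0 \<le> t j" "\<And>j. t (Suc j) \<le> t j / 3" "t 0 \<le> \<delta>" for t
    unfolding extends_uniformly_def
  proof
    fix v :: "real \<times> real \<Rightarrow> real"
    define M where "M = (\<Sum>c\<in>square_corners. \<bar>v c\<bar>)"
    have M: "\<bar>v c\<bar> \<le> M" if "c \<in> square_corners" for c
      unfolding M_def using that by (intro member_le_sum) auto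
    have r: "\<bar>v c - v c'\<bar> \<le> 2 * M" if "c \<in> square_corners" "c' \<in> square_corners" for c c'
      using M[OF that(1)] M[OF that(2)] by linarith
    have "uniformly_convergent_on ?K (\<lambda>m x. \<Sum>i<m. eigen_fun n (Suc i) t v x - eigen_fun n i t v x)"
    proof (rule Weierstrass_m_test')
      show "norm (eigen_fun n (Suc m) t v x - eigen_fun n m t v x) \<le> (3 / 4) ^ m * (2 * M + 4 * C * t 0 * M)"
        if "x \<in> ?K" for m x
        unfolding real_norm_def by (rule step[OF t M r that])
      show "summable (\<lambda>m. (3 / 4) ^ m * (2 * M + 4 * C * t 0 * M))"
        by (intro summable_mult2 summable_geometric) simp
    qed
    then have "uniformly_convergent_on ?K (\<lambda>m x. bilinear_interp v x + (\<Sum>i<m. eigen_fun n (Suc i) t v x - eigen_fun n i t v x))"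
      by (intro uniformly_convergent_add uniformly_convergent_on_const)
    moreover have "bilinear_interp v x + (\<Sum>i<m. eigen_fun n (Suc i) t v x - eigen_fun n i t v x) = eigen_fun n m t v x" for m x
      by (subst sum_lessThan_telescope) simp
    ultimately show "uniformly_convergent_on ?K (\<lambda>m. eigen_fun n m t v)" by simp
  qed
  then show ?thesis using that \<delta>(1) by blast
qed

text \<open>A tail is small enough for \<open>extends_uniformly_small\<close>; the finitely many
  earlier levels are restored one at a time.\<close>

lemma extends_uniformly_chain:
  assumes n: "n \<ge> 2" and t: "decimation_chain n t" and lim: "t \<longlonglongrightarrow> 0"
    and nonneg: "\<And>j. 0 \<le> t j" and dec: "\<And>j. N \<le> j \<Longrightarrow> t (Suc j) \<le> t j / 3"
  shows "extends_uniformly n t"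
proof -
  obtain d where d: "d > 0" "\<And>t. decimation_chain n t \<Longrightarrow> (\<And>j. 0 \<le> t j) \<Longrightarrow> (\<And>j. t (Suc j) \<le> t j / 3) \<Longrightarrow> t 0 \<le> d \<Longrightarrow> extends_uniformly n t"
    using extends_uniformly_small[OF n] by blast
  have "\<forall>\<^sub>F j in sequentially. t j < d"
    using lim d(1) by (rule order_tendstoD)
  then obtain L where L: "\<And>j. L \<le> j \<Longrightarrow> t j < d"
    unfolding eventually_sequentially by blast
  define P where "P = max N L"
  define s where "s k j = t (k + j)" for k j
  have sc: "decimation_chain n (s k)" for k
    using t by (simp add: decimation_chain_def s_def)
  have "extends_uniformly n (s P)"
  proof (rule d(2)[OF sc])
    show "0 \<le> s P j" "s P (Suc j) \<le> s P j / 3" for j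
      using nonneg dec[of "P + j"] by (simp_all add: s_def P_def)
    show "s P 0 \<le> d" using L[of P] by (simp add: s_def P_def)
  qed
  then have "extends_uniformly n (s (P - k))" for k
  proof (induction k)
    case (Suc k)
    show ?case
    proof (cases "k < P")
      case True
      then have "P - k + j = P - Suc k + Suc j" for j by linarith
      then have "s (P - k) = s (P - Suc k) \<circ> Suc" by (intro ext) (simp only: s_def o_apply)
      with Suc have "extends_uniformly n (s (P - Suc k) \<circ> Suc)" by (simp only:)
      then show ?thesis by (rule extends_uniformly_unshift[OF n sc])
    qed (use Suc in simp)
  qed simp
  from this[of P] have "extends_uniformly n (s 0)" by simp
  moreover have "s 0 = t" by (intro ext) (simp add: s_def)
  ultimately show ?thesis by simp
qed

text \<open>The constant \<open>1\<close> has zero defect for the eigenvalue \<open>t 0 = 0\<close>.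
  So the limit function is an exact eigenfunction on each level \<open>m\<close>, with eigenvalue
  \<open>t m\<close>, and boundedness makes the convergence of the renormalised Laplacians uniform.
  Its value at a corner stays \<open>1\<close>, so it is not zero.\<close>

lemma chain_limit_eigenvalue:
  assumes n: "n \<ge> 2" and t: "decimation_chain n t" "t 0 = 0" and lim: "(\<lambda>m. vicsek_rho n ^ m * t m) \<longlonglongrightarrow> ev"
    and nonneg: "\<And>j. 0 \<le> t j" and dec: "\<And>j. N \<le> j \<Longrightarrow> t (Suc j) \<le> t j / 3"
  shows "ev \<in> neumann_eigenvalues n"
proof -
  let ?K = "vicsek_set n" and ?E = "\<lambda>m. eigen_fun n m t (\<lambda>_. 1)"
  have rho: "vicsek_rho n \<ge> 15" by (rule vicsek_rho_ge[OF n])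
  have "(\<lambda>m. (vicsek_rho n ^ m * t m) * (1 / vicsek_rho n) ^ m) \<longlonglongrightarrow> ev * 0"
    using rho by (intro tendsto_mult lim LIMSEQ_realpow_zero) auto
  moreover have "(vicsek_rho n ^ m * t m) * (1 / vicsek_rho n) ^ m = t m" for m
    using rho by (simp add: power_one_over)
  ultimately have "t \<longlonglongrightarrow> 0" by simp
  then have "extends_uniformly n t"
    by (rule extends_uniformly_chain[OF n t(1) _ nonneg dec])
  then obtain u where u: "uniform_limit ?K ?E u sequentially"
    unfolding extends_uniformly_def uniformly_convergent_on_def by (elim allE exE)
  have cont: "continuous_on ?K u"
    by (rule uniform_limit_theorem[OF always_eventually u])
       (simp_all only: continuous_eigen_fun[OF n t(1)] sequentially_bot not_False_eq_True simp_thms)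
  have level: "u x = ?E m x" if "x \<in> vicsek_vertices n m" for x m
  proof (rule LIMSEQ_unique)
    show "(\<lambda>k. ?E k x) \<longlonglongrightarrow> u x"
      by (rule tendsto_uniform_limitI[OF u]) (rule subsetD[OF vicsek_set_properties(4)[OF n] that])
    show "(\<lambda>k. ?E k x) \<longlonglongrightarrow> ?E m x"
      by (rule tendsto_eventually, rule eventually_sequentiallyI)
         (rule eigen_fun_stable[OF n t(1) that])
  qed
  have lap: "graph_laplacian n m u x = - t m * u x" if x: "x \<in> vicsek_vertices n m" for m x
  proof -
    have "eigen_defect n m u (t m) x = eigen_defect n m (?E m) (t m) x"
      unfolding eigen_defect_def
    proof (rule sum.cong[OF refl])
      fix y assume "y \<in> vicsek_nbrs n m x"
      then have "y \<in> vicsek_vertices n m" by (simp add: vicsek_nbrs_def)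
      then show "u y - (1 - t m) * u x = ?E m y - (1 - t m) * ?E m x"
        by (simp only: level[OF x] level)
    qed
    also have "\<dots> = 0"
    proof -
      obtain c where c: "\<forall>v p. eigen_defect n m (eigen_fun n m t v) (t m) p = c * eigen_defect n 0 v (t 0) p"
        using eigen_fun_defect[OF n t(1), of m] by (elim exE)
      have "eigen_defect n 0 (\<lambda>_. 1) (t 0) x = 0"
        unfolding eigen_defect_0 t(2) by (simp add: square_corners_eq)
      then show ?thesis by (simp only: c[rule_format] mult_zero_right)
    qed
    finally show ?thesis by (rule graph_laplacian_eigen[OF n x])
  qed
  have "bounded (u ` ?K)"
    by (intro compact_imp_bounded compact_continuous_image cont vicsek_set_properties(1)[OF n])
  then obtain B where B0: "B > 0" and "\<forall>y\<in>u ` ?K. norm y \<le> B"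
    unfolding bounded_pos by (elim exE conjE)
  then have B: "B > 0" "\<And>x. x \<in> ?K \<Longrightarrow> \<bar>u x\<bar> \<le> B"
    by (simp_all only: real_norm_def ball_simps)
  have "\<forall>\<^sub>F m in sequentially. \<forall>x\<in>vicsek_vertices n m.
      \<bar>vicsek_rho n ^ m * graph_laplacian n m u x - - (ev * u x)\<bar> < e" if e: "e > 0" for e
  proof -
    have "\<forall>\<^sub>F m in sequentially. dist (vicsek_rho n ^ m * t m) ev < e / B"
      using lim by (rule tendstoD) (use e B in simp)
    then show ?thesis
    proof (rule eventually_mono, intro ballI)
      fix m x assume m: "dist (vicsek_rho n ^ m * t m) ev < e / B" and x: "x \<in> vicsek_vertices n m"
      have "\<bar>vicsek_rho n ^ m * graph_laplacian n m u x - - (ev * u x)\<bar> = \<bar>vicsek_rho n ^ m * t m - ev\<bar> * \<bar>u x\<bar>"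
        unfolding lap[OF x] abs_mult[symmetric] by (subst abs_minus_commute) (simp add: algebra_simps)
      also have "\<dots> \<le> \<bar>vicsek_rho n ^ m * t m - ev\<bar> * B"
        by (intro mult_left_mono B(2) subsetD[OF vicsek_set_properties(4)[OF n] x] abs_ge_zero)
      also have "\<dots> < e" using m B(1) by (simp add: dist_real_def pos_less_divide_eq)
      finally show "\<bar>vicsek_rho n ^ m * graph_laplacian n m u x - - (ev * u x)\<bar> < e" .
    qed
  qed
  moreover have "continuous_on ?K (\<lambda>x. - (ev * u x))" by (intro continuous_intros cont)
  ultimately have "has_neumann_laplacian n u (\<lambda>x. - (ev * u x))"
    unfolding has_neumann_laplacian_def using cont by (intro conjI allI impI)
  moreover have "\<exists>x\<in>?K. u x \<noteq> 0"
  proof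
    have c: "(0, 0) \<in> vicsek_vertices n 0" by (simp add: square_corners_eq)
    show "(0, 0) \<in> ?K" by (rule subsetD[OF vicsek_set_properties(4)[OF n] c])
    show "u (0, 0) \<noteq> 0" unfolding level[OF c] by (simp add: bilinear_interp_def)
  qed
  ultimately show ?thesis
    unfolding neumann_eigenvalues_def by (intro CollectI exI[of _ u] conjI)
qed


subsection \<open>Clustering\<close>

lemma decimation_ivt:
  assumes "a \<le> b" "decimation n a \<le> y" "y \<le> decimation n b"
  shows "\<exists>x. a \<le> x \<and> x \<le> b \<and> decimation n x = y"
  using IVT'[OF assms(2,3,1) continuous_decimation] .

lemma origin_branch:
  assumes n: "n \<ge> 2"
  obtains \<phi> where "\<And>y. 0 \<le> y \<Longrightarrow> y \<le> 15 / 16 \<Longrightarrow> 0 \<le> \<phi> y \<and> \<phi> y \<le> origin_bound n \<and> decimation n (\<phi> y) = y"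
proof -
  define \<phi> where "\<phi> y = (SOME x. 0 \<le> x \<and> x \<le> origin_bound n \<and> decimation n x = y)" for y
  have "0 \<le> \<phi> y \<and> \<phi> y \<le> origin_bound n \<and> decimation n (\<phi> y) = y" if y: "0 \<le> y" "y \<le> 15 / 16" for y
    unfolding \<phi>_def
  proof (rule someI_ex, rule decimation_ivt)
    show "0 \<le> origin_bound n" using origin_bound_pos[OF n] by simp
    show "decimation n 0 \<le> y" using y by simp
    show "y \<le> decimation n (origin_bound n)" using y decimation_origin_bound[OF n] by linarith
  qed
  then show ?thesis by (rule that)
qed

text \<open>The last inequality bounds the accumulated distortion of the inverse branch without an
  infinite product: the gap of two points, rescaled by \<open>\<rho>\<close> at each step and
  multiplied by the weight \<open>1 + r/2 * b\<close>, does not increase along the branch.\<close>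

lemma origin_branch_step:
  assumes n: "n \<ge> 2" and ab: "0 \<le> a" "a \<le> origin_bound n" "0 \<le> b" "b \<le> origin_bound n"
    and le: "decimation n a \<le> decimation n b"
  defines "r \<equiv> vicsek_rho n"
  shows "a \<le> b" "decimation n b - decimation n a \<le> r * (b - a)"
    "9 * b \<le> decimation n b"
    "r * (b - a) * (1 + r / 2 * b) \<le> (decimation n b - decimation n a) * (1 + r / 2 * decimation n b)"
proof -
  have r: "r \<ge> 15" unfolding r_def by (rule vicsek_rho_ge[OF n])
  have bnd: "r / 2 * x \<le> 3 / 4" if "x \<le> origin_bound n" for x
    using that r unfolding origin_bound_def r_def[symmetric] by (simp add: field_simps)
  show "a \<le> b"
  proof (rule ccontr)
    assume "\<not> a \<le> b"
    then have ba: "b < a" by simp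
    have "decimation n a - decimation n b \<ge> r * (a - b) * (1 - r / 4 * (b + a))"
      unfolding r_def using ba ab by (intro decimation_origin(2)[OF n]) auto
    moreover have "r / 4 * (b + a) \<le> 3 / 4"
      using bnd[OF ab(2)] bnd[OF ab(4)] by (simp add: algebra_simps)
    then have "r * (a - b) * (1 - r / 4 * (b + a)) > 0"
      using r ba by (intro mult_pos_pos) auto
    ultimately show False using le by linarith
  qed
  note U = decimation_origin[OF n ab(1) this ab(4), folded r_def]
  note U0 = decimation_origin[OF n order_refl ab(3,4), folded r_def]
  show "decimation n b - decimation n a \<le> r * (b - a)" by (rule U(1))
  define x where "x = r / 2 * b"
  have x: "0 \<le> x" "x \<le> 3 / 4" using bnd[OF ab(4)] r ab by (simp_all add: x_def)
  have "r * b * (1 - x / 2) \<ge> r * b * (5 / 8)"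
    using x r ab by (intro mult_left_mono) auto
  moreover have "r * b * (5 / 8) \<ge> 9 * b"
    using mult_right_mono[OF r ab(3)] ab(3) by linarith
  moreover have e: "r * (b - 0) * (1 - r / 4 * (0 + b)) = r * b * (1 - x / 2)" by (simp add: x_def)
  ultimately show nine: "9 * b \<le> decimation n b" using U0(2) unfolding e decimation_0 by linarith
  have "decimation n b - decimation n a \<ge> r * (b - a) * (1 - x)"
  proof -
    have "r / 4 * (a + b) \<le> x" using \<open>a \<le> b\<close> r by (simp add: x_def field_simps)
    then have "r * (b - a) * (1 - x) \<le> r * (b - a) * (1 - r / 4 * (a + b))"
      using r \<open>a \<le> b\<close> by (intro mult_left_mono) auto
    then show ?thesis using U(2) by linarith
  qed
  moreover have "1 + r / 2 * decimation n b \<ge> 1 + 9 * x"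
  proof -
    have "r / 2 * (9 * b) \<le> r / 2 * decimation n b" using nine r by (intro mult_left_mono) auto
    then show ?thesis by (simp add: x_def)
  qed
  ultimately have "(r * (b - a) * (1 - x)) * (1 + 9 * x) \<le> (decimation n b - decimation n a) * (1 + r / 2 * decimation n b)"
    using x r \<open>a \<le> b\<close> le by (intro mult_mono) auto
  \<comment> \<open>The inequality \<open>1 + x <= (1 - x) (1 + 9 x)\<close> holds for
    \<open>0 <= x <= 7/9\<close>, and \<open>origin_bound\<close> gives \<open>x <= 3/4\<close>. The
    \<open>9\<close> is the expansion rate just proved.\<close>
  moreover have "(r * (b - a)) * (1 + x) \<le> (r * (b - a)) * ((1 - x) * (1 + 9 * x))"
  proof (rule mult_left_mono)
    have "0 \<le> x * (7 - 9 * x)" using x by simp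
    then show "1 + x \<le> (1 - x) * (1 + 9 * x)" by (simp add: algebra_simps)
    show "0 \<le> r * (b - a)" using r \<open>a \<le> b\<close> by simp
  qed
  ultimately show "r * (b - a) * (1 + r / 2 * b) \<le> (decimation n b - decimation n a) * (1 + r / 2 * decimation n b)"
    by (simp add: x_def mult.assoc)
qed

text \<open>The limit is the Koenigs linearisation of the decimation polynomial at \<open>0\<close>.\<close>

lemma origin_branch_limit:
  assumes n: "n \<ge> 2"
    and \<phi>: "\<And>y. 0 \<le> y \<Longrightarrow> y \<le> 15 / 16 \<Longrightarrow> 0 \<le> \<phi> y \<and> \<phi> y \<le> origin_bound n \<and> decimation n (\<phi> y) = y"
  obtains L where "\<And>y. 0 \<le> y \<Longrightarrow> y \<le> 15 / 16 \<Longrightarrow> (\<lambda>j. vicsek_rho n ^ j * (\<phi> ^^ j) y) \<longlonglongrightarrow> L y"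
    "\<And>x y. 0 \<le> x \<Longrightarrow> x \<le> y \<Longrightarrow> y \<le> 15 / 16 \<Longrightarrow> y - x \<le> L y - L x \<and> L y - L x \<le> vicsek_rho n * (y - x)"
    "\<And>y j. 0 \<le> y \<Longrightarrow> y \<le> 15 / 16 \<Longrightarrow> 0 \<le> (\<phi> ^^ j) y \<and> (\<phi> ^^ j) y \<le> y"
    "\<And>y. 0 \<le> y \<Longrightarrow> y \<le> 15 / 16 \<Longrightarrow> \<phi> y \<le> y / 3"
proof -
  define r where "r = vicsek_rho n"
  have r: "r \<ge> 15" unfolding r_def by (rule vicsek_rho_ge[OF n])
  have step: "\<phi> x \<le> \<phi> y" "y - x \<le> r * (\<phi> y - \<phi> x)" "9 * \<phi> y \<le> y"
    "r * (\<phi> y - \<phi> x) * (1 + r / 2 * \<phi> y) \<le> (y - x) * (1 + r / 2 * y)"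
    if xy: "0 \<le> x" "x \<le> y" "y \<le> 15 / 16" for x y
  proof -
    have px: "0 \<le> \<phi> x" "\<phi> x \<le> origin_bound n" "decimation n (\<phi> x) = x"
      and py: "0 \<le> \<phi> y" "\<phi> y \<le> origin_bound n" "decimation n (\<phi> y) = y"
      using \<phi>[of x] \<phi>[of y] xy by auto
    have le: "decimation n (\<phi> x) \<le> decimation n (\<phi> y)" using px py xy by simp
    show "\<phi> x \<le> \<phi> y" "y - x \<le> r * (\<phi> y - \<phi> x)" "9 * \<phi> y \<le> y"
      "r * (\<phi> y - \<phi> x) * (1 + r / 2 * \<phi> y) \<le> (y - x) * (1 + r / 2 * y)"
      using origin_branch_step[OF n px(1,2) py(1,2) le] unfolding px(3) py(3) r_def by blast+
  qed
  have rng: "0 \<le> (\<phi> ^^ j) y \<and> (\<phi> ^^ j) y \<le> y" if y: "0 \<le> y" "y \<le> 15 / 16" for y j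
  proof (induction j)
    case 0
    then show ?case using y by simp
  next
    case (Suc j)
    then have z: "0 \<le> (\<phi> ^^ j) y" "(\<phi> ^^ j) y \<le> 15 / 16" using y by linarith+
    have "9 * \<phi> ((\<phi> ^^ j) y) \<le> (\<phi> ^^ j) y" by (rule step(3)[OF z(1) order_refl z(2)])
    then show ?case using \<phi>[OF z] Suc by simp
  qed
  have \<phi>0: "(\<phi> ^^ j) 0 = 0" for j using rng[of 0 j] by simp
  \<comment> \<open>The lower bound for the rescaled gap uses slope at most \<open>\<rho>\<close>,
    the upper bound the weighted inequality. As the weight lies between \<open>1\<close> and
    \<open>r\<close>, both survive in the limit.\<close>
  have iter: "(\<phi> ^^ j) x \<le> (\<phi> ^^ j) y \<and> y - x \<le> r ^ j * ((\<phi> ^^ j) y - (\<phi> ^^ j) x) \<and>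
     r ^ j * ((\<phi> ^^ j) y - (\<phi> ^^ j) x) * (1 + r / 2 * (\<phi> ^^ j) y) \<le> (y - x) * (1 + r / 2 * y)"
    if xy: "0 \<le> x" "x \<le> y" "y \<le> 15 / 16" for x y j
  proof (induction j)
    case 0
    then show ?case using xy by simp
  next
    case (Suc j)
    define a b where "a = (\<phi> ^^ j) x" and "b = (\<phi> ^^ j) y"
    have ab: "0 \<le> a" "a \<le> b" "b \<le> 15 / 16"
      using Suc rng[of x j] rng[of y j] xy by (auto simp: a_def b_def)
    have "r ^ j * (b - a) \<le> r ^ j * (r * (\<phi> b - \<phi> a))"
      using step(2)[OF ab] r by (intro mult_left_mono) auto
    moreover have "r ^ j * (r * (\<phi> b - \<phi> a) * (1 + r / 2 * \<phi> b)) \<le> r ^ j * ((b - a) * (1 + r / 2 * b))"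
      using step(4)[OF ab] r by (intro mult_left_mono) auto
    ultimately show ?case
      using Suc step(1)[OF ab] unfolding a_def[symmetric] b_def[symmetric] funpow.simps o_apply
      by (auto simp: mult.assoc mult.left_commute)
  qed
  have upper: "r ^ j * ((\<phi> ^^ j) y - (\<phi> ^^ j) x) \<le> r * (y - x)"
    if xy: "0 \<le> x" "x \<le> y" "y \<le> 15 / 16" for x y j
  proof -
    define D where "D = r ^ j * ((\<phi> ^^ j) y - (\<phi> ^^ j) x)"
    have D0: "D \<ge> 0" using iter[OF xy, of j] r by (simp add: D_def)
    have "0 \<le> r / 2 * (\<phi> ^^ j) y" using rng[of y j] xy r by simp
    then have "D * 1 \<le> D * (1 + r / 2 * (\<phi> ^^ j) y)" using D0 by (intro mult_left_mono) auto
    also have "\<dots> \<le> (y - x) * (1 + r / 2 * y)" using iter[OF xy, of j] by (simp add: D_def)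
    also have "\<dots> \<le> (y - x) * r"
    proof (rule mult_left_mono)
      have "r / 2 * y \<le> r / 2 * 1" using xy r by (intro mult_left_mono) auto
      then show "1 + r / 2 * y \<le> r" using r by linarith
    qed (use xy in simp)
    finally show ?thesis by (simp add: D_def mult.commute)
  qed
  define s where "s y j = r ^ j * (\<phi> ^^ j) y" for y j
  have conv: "convergent (s y)" if y: "0 \<le> y" "y \<le> 15 / 16" for y
  proof (rule Bseq_monoseq_convergent)
    have "s y j \<le> s y (Suc j)" for j
    proof -
      have z: "0 \<le> (\<phi> ^^ j) y" "(\<phi> ^^ j) y \<le> 15 / 16" using rng[OF y, of j] y by auto
      have "\<phi> 0 = 0" using \<phi>0[of 1] by simp
      then have "(\<phi> ^^ j) y \<le> r * \<phi> ((\<phi> ^^ j) y)" using step(2)[OF order_refl z] by simp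
      then have "r ^ j * (\<phi> ^^ j) y \<le> r ^ j * (r * \<phi> ((\<phi> ^^ j) y))"
        using r by (intro mult_left_mono) auto
      then show ?thesis by (simp add: s_def mult.assoc mult.left_commute)
    qed
    then show "monoseq (s y)" by (simp add: monoseq_Suc)
    have "norm (s y j) \<le> r * y" for j
    proof -
      have "s y j \<le> r * y" using upper[OF order_refl y, of j] by (simp add: s_def \<phi>0)
      moreover have "0 \<le> s y j" using rng[OF y, of j] r by (simp add: s_def)
      ultimately show ?thesis by simp
    qed
    then show "Bseq (s y)" by (rule BseqI')
  qed
  show ?thesis
  proof (rule that[of "\<lambda>y. lim (s y)"])
    show lim: "(\<lambda>j. vicsek_rho n ^ j * (\<phi> ^^ j) y) \<longlonglongrightarrow> lim (s y)" if "0 \<le> y" "y \<le> 15 / 16" for y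
      using conv[OF that] unfolding convergent_LIMSEQ_iff s_def[abs_def] r_def by simp
    show "y - x \<le> lim (s y) - lim (s x) \<and> lim (s y) - lim (s x) \<le> vicsek_rho n * (y - x)"
      if xy: "0 \<le> x" "x \<le> y" "y \<le> 15 / 16" for x y
    proof -
      have "(\<lambda>j. vicsek_rho n ^ j * (\<phi> ^^ j) y - vicsek_rho n ^ j * (\<phi> ^^ j) x) \<longlonglongrightarrow> lim (s y) - lim (s x)"
        using xy by (intro tendsto_diff lim) auto
      then have l: "(\<lambda>j. r ^ j * ((\<phi> ^^ j) y - (\<phi> ^^ j) x)) \<longlonglongrightarrow> lim (s y) - lim (s x)"
        by (simp add: r_def right_diff_distrib)
      have "y - x \<le> lim (s y) - lim (s x)"
        by (rule LIMSEQ_le_const[OF l]) (use iter[OF xy] in blast)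
      moreover have "lim (s y) - lim (s x) \<le> r * (y - x)"
        by (rule LIMSEQ_le_const2[OF l]) (use upper[OF xy] in blast)
      ultimately show ?thesis by (simp add: r_def)
    qed
    show "0 \<le> (\<phi> ^^ j) y \<and> (\<phi> ^^ j) y \<le> y" if "0 \<le> y" "y \<le> 15 / 16" for y j
      by (rule rng[OF that])
    show "\<phi> y \<le> y / 3" if "0 \<le> y" "y \<le> 15 / 16" for y
      using step(3)[OF that(1) order_refl that(2)] \<phi>[OF that] by linarith
  qed
qed

text \<open>Between the two windows lie the zeros of \<open>arm_seq 2\<close> on the positive axis
  and the value \<open>2/3\<close>, so the range leaves out this gap.\<close>

definition branch_range :: "nat \<Rightarrow> real set" where
  "branch_range n = {x. 0 \<le> x \<and> x \<le> 15 / 16 \<and> (x \<le> origin_bound n \<or> 5 / 6 \<le> x)}"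

text \<open>The index counts the applications of \<open>R\<close> that lead to \<open>0\<close>; it
  becomes the power of \<open>\<rho>\<close> in front of the eigenvalue.\<close>

inductive preimage_of_0 :: "nat \<Rightarrow> nat \<Rightarrow> real \<Rightarrow> bool" for n where
  zero: "preimage_of_0 n 0 0"
| step: "preimage_of_0 n s (decimation n x) \<Longrightarrow> x \<in> branch_range n \<Longrightarrow> preimage_of_0 n (Suc s) x"

lemma preimage_of_0_chain:
  assumes "preimage_of_0 n s x"
  shows "\<exists>f. f 0 = 0 \<and> f s = x \<and> (\<forall>j<s. decimation n (f (Suc j)) = f j \<and> f (Suc j) \<in> branch_range n)"
  using assms
proof induction
  case zero
  show ?case by (rule exI[of _ "\<lambda>_. 0"]) simp
next
  case (step s x)
  from step.IH obtain f where f: "f 0 = 0" "f s = decimation n x"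
    "\<forall>j<s. decimation n (f (Suc j)) = f j \<and> f (Suc j) \<in> branch_range n" by (elim exE conjE)
  show ?case
  proof (intro exI[of _ "f(Suc s := x)"] conjI allI impI)
    fix j assume "j < Suc s"
    then show "decimation n ((f(Suc s := x)) (Suc j)) = (f(Suc s := x)) j"
      "(f(Suc s := x)) (Suc j) \<in> branch_range n"
      using f step.hyps by (cases "j = s"; simp add: less_Suc_eq)+
  qed (use f in simp_all)
qed

lemma branch_rangeD:
  assumes n: "n \<ge> 2" and x: "x \<in> branch_range n"
  shows "0 \<le> x" "x \<noteq> 4 / 3" "x \<noteq> 2 / 3" "arm_seq 2 x (n - 1) \<noteq> 0"
proof -
  show "0 \<le> x" "x \<noteq> 4 / 3" "x \<noteq> 2 / 3"
    using x origin_bound_le[OF n] by (auto simp: branch_range_def)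
  show "arm_seq 2 x (n - 1) \<noteq> 0"
  proof (cases "x \<le> origin_bound n")
    case True
    then show ?thesis using arm_seq_2_pos_origin[OF n \<open>0 \<le> x\<close>] by simp
  next
    case False
    then have "2 / 3 \<le> x" using x by (auto simp: branch_range_def)
    then show ?thesis using arm_abs_2_mono[of x "n - 1"] by (auto simp: arm_abs_def)
  qed
qed

text \<open>The chain runs from \<open>0\<close> up to \<open>x\<close> in \<open>s\<close> steps
  and then follows \<open>\<phi>\<close> forever. The first \<open>s\<close> levels account for the
  factor \<open>\<rho> ^ s\<close>, the rest for the limit \<open>l\<close>.\<close>

lemma preimage_eigenvalue:
  assumes n: "n \<ge> 2" and x: "preimage_of_0 n s x" "0 \<le> x" "x \<le> 15 / 16"
    and \<phi>: "\<And>y. 0 \<le> y \<Longrightarrow> y \<le> 15 / 16 \<Longrightarrow> 0 \<le> \<phi> y \<and> \<phi> y \<le> origin_bound n \<and> decimation n (\<phi> y) = y"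
    and third: "\<And>y. 0 \<le> y \<Longrightarrow> y \<le> 15 / 16 \<Longrightarrow> \<phi> y \<le> y / 3"
    and rng: "\<And>j. 0 \<le> (\<phi> ^^ j) x \<and> (\<phi> ^^ j) x \<le> x"
    and lim: "(\<lambda>j. vicsek_rho n ^ j * (\<phi> ^^ j) x) \<longlonglongrightarrow> l"
  shows "vicsek_rho n ^ s * l \<in> neumann_eigenvalues n"
proof -
  obtain f where f: "f 0 = 0" "f s = x"
    "\<forall>j<s. decimation n (f (Suc j)) = f j \<and> f (Suc j) \<in> branch_range n"
    using preimage_of_0_chain[OF x(1)] by (elim exE conjE)
  define t where "t j = (if j < s then f j else (\<phi> ^^ (j - s)) x)" for j
  have t_ge: "t (j + s) = (\<phi> ^^ j) x" for j by (simp add: t_def)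
  have t_le: "t j = f j" if "j \<le> s" for j using that f(2) by (auto simp: t_def)
  have r: "0 \<le> (\<phi> ^^ j) x" "(\<phi> ^^ j) x \<le> 15 / 16" for j using rng[of j] x(3) by linarith+
  have Suc: "decimation n (t (Suc j)) = t j \<and> t (Suc j) \<in> branch_range n" for j
  proof (cases "j < s")
    case True
    then show ?thesis using f t_le by simp
  next
    case False
    define i where "i = j - s"
    have i: "j = i + s" using False by (simp add: i_def)
    have "t (Suc j) = \<phi> ((\<phi> ^^ i) x)" "t j = (\<phi> ^^ i) x" using t_ge[of "Suc i"] t_ge[of i] by (simp_all add: i)
    then show ?thesis
      using \<phi>[OF r[of i]] r(2)[of "Suc i"] by (simp add: branch_range_def)
  qed
  have t0: "t 0 = 0" using t_le[of 0] f(1) by simp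
  have "0 \<in> branch_range n" using origin_bound_pos[OF n] by (simp add: branch_range_def)
  then have br: "t j \<in> branch_range n" for j using Suc t0 by (cases j) auto
  show ?thesis
  proof (rule chain_limit_eigenvalue[where t = t and N = s])
    show "2 \<le> n" "t 0 = 0" by (rule n, rule t0)
    show "decimation_chain n t"
      unfolding decimation_chain_def by (intro allI conjI branch_rangeD[OF n br] conjunct1[OF Suc])
    show "0 \<le> t j" for j by (rule branch_rangeD(1)[OF n br])
    show "t (Suc j) \<le> t j / 3" if "s \<le> j" for j
    proof -
      define i where "i = j - s"
      have i: "j = i + s" using that by (simp add: i_def)
      show ?thesis using third[OF r[of i]] t_ge[of "Suc i"] t_ge[of i] by (simp add: i)
    qed
    show "(\<lambda>m. vicsek_rho n ^ m * t m) \<longlonglongrightarrow> vicsek_rho n ^ s * l"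
    proof (rule LIMSEQ_offset[of _ s])
      have "(\<lambda>j. vicsek_rho n ^ s * (vicsek_rho n ^ j * (\<phi> ^^ j) x)) \<longlonglongrightarrow> vicsek_rho n ^ s * l"
        by (intro tendsto_mult_left lim)
      then show "(\<lambda>j. vicsek_rho n ^ (j + s) * t (j + s)) \<longlonglongrightarrow> vicsek_rho n ^ s * l"
        unfolding t_ge by (simp add: power_add mult_ac)
    qed
  qed
qed

lemma neumann_eigenvalues_clustering:
  assumes n: "n \<ge> 2"
  shows "spectral_clustering (neumann_eigenvalues n)"
  unfolding spectral_clustering_def
proof (intro allI impI)
  fix N :: nat and \<epsilon> :: real
  assume "N > 0 \<and> \<epsilon> > 0"
  then have N: "N > 0" and eps: "\<epsilon> > 0" by simp_all
  define r where "r = vicsek_rho n"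
  have r: "r \<ge> 15" unfolding r_def by (rule vicsek_rho_ge[OF n])
  obtain \<phi> where \<phi>: "\<And>y. 0 \<le> y \<Longrightarrow> y \<le> 15 / 16 \<Longrightarrow> 0 \<le> \<phi> y \<and> \<phi> y \<le> origin_bound n \<and> decimation n (\<phi> y) = y"
    using origin_branch[OF n] by blast
  obtain L where L: "\<And>y. 0 \<le> y \<Longrightarrow> y \<le> 15 / 16 \<Longrightarrow> (\<lambda>j. vicsek_rho n ^ j * (\<phi> ^^ j) y) \<longlonglongrightarrow> L y"
    "\<And>x y. 0 \<le> x \<Longrightarrow> x \<le> y \<Longrightarrow> y \<le> 15 / 16 \<Longrightarrow> y - x \<le> L y - L x \<and> L y - L x \<le> vicsek_rho n * (y - x)"
    and rng: "\<And>y j. 0 \<le> y \<Longrightarrow> y \<le> 15 / 16 \<Longrightarrow> 0 \<le> (\<phi> ^^ j) y \<and> (\<phi> ^^ j) y \<le> y"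
    and third: "\<And>y. 0 \<le> y \<Longrightarrow> y \<le> 15 / 16 \<Longrightarrow> \<phi> y \<le> y / 3"
    using origin_branch_limit[OF n \<phi>] by blast
  obtain z where z: "5 / 6 \<le> z" "z < 8 / 9" "decimation n z = 0"
    using ex_zero_decimation[OF n] .
  obtain l q where l: "8 / 9 \<le> l" "l < 15 / 16" "decimation n l \<le> 5 / 6" "decimation n (15 / 16) \<ge> 15 / 16"
    and q: "q > r" "\<And>x y. l \<le> x \<Longrightarrow> x \<le> y \<Longrightarrow> decimation n y - decimation n x \<ge> q * (y - x)"
    using decimation_expanding[OF n] unfolding r_def by metis
  define \<psi> where "\<psi> y = (SOME x. l \<le> x \<and> x \<le> 15 / 16 \<and> decimation n x = y)" for y
  \<comment> \<open>The map \<open>\<psi>\<close> is only used on arguments from \<open>5/6\<close>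
    on, since the expansion starts at \<open>l\<close>, where \<open>R\<close> may be well above
    \<open>0\<close>. The map \<open>\<eta>\<close> begins at the zero \<open>z\<close> instead, so
    it can lift the small numbers \<open>(\<phi> ^^ a) z\<close> to the upper window.\<close>
  define \<eta> where "\<eta> y = (SOME x. z \<le> x \<and> x \<le> 15 / 16 \<and> decimation n x = y)" for y
  have \<psi>: "l \<le> \<psi> y \<and> \<psi> y \<le> 15 / 16 \<and> decimation n (\<psi> y) = y" if "5 / 6 \<le> y" "y \<le> 15 / 16" for y
    unfolding \<psi>_def by (rule someI_ex, rule decimation_ivt) (use that l in linarith)+
  have \<eta>: "z \<le> \<eta> y \<and> \<eta> y \<le> 15 / 16 \<and> decimation n (\<eta> y) = y" if "0 \<le> y" "y \<le> 15 / 16" for y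
    unfolding \<eta>_def by (rule someI_ex, rule decimation_ivt) (use that l z in linarith)+
  have \<psi>_rng: "5 / 6 \<le> (\<psi> ^^ j) y \<and> (\<psi> ^^ j) y \<le> 15 / 16" if "5 / 6 \<le> y" "y \<le> 15 / 16" for y j
  proof (induction j)
    case (Suc j)
    then show ?case using \<psi>[of "(\<psi> ^^ j) y"] l(1) by auto
  qed (use that in simp)
  have contract: "\<bar>(\<psi> ^^ j) x - (\<psi> ^^ j) y\<bar> \<le> (1 / q) ^ j"
    if xy: "5 / 6 \<le> x" "x \<le> 15 / 16" "5 / 6 \<le> y" "y \<le> 15 / 16" for x y j
  proof (induction j)
    case 0
    then show ?case using xy by (auto simp: abs_le_iff)
  next
    case (Suc j)
    have one: "q * \<bar>\<psi> a - \<psi> b\<bar> \<le> \<bar>a - b\<bar>"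
      if "5 / 6 \<le> a" "a \<le> 15 / 16" "5 / 6 \<le> b" "b \<le> 15 / 16" for a b
    proof -
      have a: "l \<le> \<psi> a" "decimation n (\<psi> a) = a" and b: "l \<le> \<psi> b" "decimation n (\<psi> b) = b"
        using \<psi> that by blast+
      show ?thesis
      proof (cases "\<psi> a \<le> \<psi> b")
        case True
        then have "q * \<bar>\<psi> a - \<psi> b\<bar> = q * (\<psi> b - \<psi> a)" by simp
        also have "\<dots> \<le> b - a" using q(2)[OF a(1) True] unfolding a(2) b(2) .
        also have "\<dots> \<le> \<bar>a - b\<bar>" by linarith
        finally show ?thesis .
      next
        case False
        then have ba: "\<psi> b \<le> \<psi> a" by simp
        then have "q * \<bar>\<psi> a - \<psi> b\<bar> = q * (\<psi> a - \<psi> b)" by simp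
        also have "\<dots> \<le> a - b" using q(2)[OF b(1) ba] unfolding a(2) b(2) .
        also have "\<dots> \<le> \<bar>a - b\<bar>" by linarith
        finally show ?thesis .
      qed
    qed
    have q0: "q > 0" using q(1) r by linarith
    have "q * \<bar>\<psi> ((\<psi> ^^ j) x) - \<psi> ((\<psi> ^^ j) y)\<bar> \<le> \<bar>(\<psi> ^^ j) x - (\<psi> ^^ j) y\<bar>"
      using \<psi>_rng[of x j] \<psi>_rng[of y j] xy by (intro one) auto
    also have "\<dots> \<le> (1 / q) ^ j" by (rule Suc)
    finally show ?case using q0 by (simp add: field_simps)
  qed
  have \<psi>_inv: "(decimation n ^^ j) ((\<psi> ^^ j) y) = y" if "5 / 6 \<le> y" "y \<le> 15 / 16" for y j
  proof (induction j)
    case (Suc j)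
    then show ?case using \<psi>[of "(\<psi> ^^ j) y"] \<psi>_rng[OF that, of j] by (simp add: funpow_swap1)
  qed simp
  have z1: "0 \<le> z" "z \<le> 15 / 16" using z by linarith+
  define w where "w a = \<eta> ((\<phi> ^^ a) z)" for a
  have w: "5 / 6 \<le> w a" "w a \<le> 15 / 16" "decimation n (w a) = (\<phi> ^^ a) z" for a
    using \<eta>[of "(\<phi> ^^ a) z"] rng[OF z1, of a] z unfolding w_def by auto
  \<comment> \<open>The level is \<open>1\<close> for \<open>z\<close>, plus \<open>a\<close> for
    \<open>\<phi>\<close>, plus \<open>1\<close> for \<open>\<eta>\<close>, plus
    \<open>N - a + k\<close> for \<open>\<psi>\<close>, which is \<open>N + 2 + k\<close> for every
    \<open>a < N\<close>.\<close>
  define \<mu> where "\<mu> k a = (\<psi> ^^ (N - a + k)) (w a)" for k a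
  have \<mu>_rng: "5 / 6 \<le> \<mu> k a" "\<mu> k a \<le> 15 / 16" for k a
    using \<psi>_rng[OF w(1,2)] by (auto simp: \<mu>_def)
  have pre: "preimage_of_0 n (N + 2 + k) (\<mu> k a)" if a: "a < N" for k a
  proof -
    have hi: "x \<in> branch_range n" if "5 / 6 \<le> x" "x \<le> 15 / 16" for x
      using that by (simp add: branch_range_def)
    have 1: "preimage_of_0 n (Suc j) ((\<phi> ^^ j) z)" for j
    proof (induction j)
      case 0
      show ?case using preimage_of_0.step[of n 0 z] preimage_of_0.zero z hi z1 by simp
    next
      case (Suc j)
      have y: "0 \<le> (\<phi> ^^ j) z" "(\<phi> ^^ j) z \<le> 15 / 16" using rng[OF z1, of j] z1 by auto
      have "\<phi> ((\<phi> ^^ j) z) \<le> 15 / 16" using rng[OF z1, of "Suc j"] z1 by simp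
      then show ?case
        using preimage_of_0.step[of n "Suc j" "\<phi> ((\<phi> ^^ j) z)"] Suc \<phi>[OF y] by (simp add: branch_range_def)
    qed
    have 2: "preimage_of_0 n (Suc (Suc a)) (w a)"
      using preimage_of_0.step[of n "Suc a" "w a"] 1 w[of a] hi by simp
    have 3: "preimage_of_0 n (Suc (Suc a) + j) ((\<psi> ^^ j) (w a))" for j
    proof (induction j)
      case (Suc j)
      then show ?case
        using preimage_of_0.step[of n "Suc (Suc a) + j" "\<psi> ((\<psi> ^^ j) (w a))"]
          \<psi>[of "(\<psi> ^^ j) (w a)"] \<psi>_rng[OF w(1,2), of j a] \<psi>_rng[OF w(1,2), of "Suc j" a] hi by simp
    qed (use 2 in simp)
    have "Suc (Suc a) + (N - a + k) = N + 2 + k" using a by simp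
    then show ?thesis using 3[of "N - a + k"] by (simp add: \<mu>_def)
  qed
  \<comment> \<open>After the common steps of \<open>\<psi>\<close> are cancelled, one more
    application of \<open>R\<close> leaves the point from \<open>a\<close> in the upper window,
    while the point from \<open>b >= 1\<close> becomes \<open>(\<phi> ^^ b) z\<close>, which is at
    most \<open>1/10\<close>.\<close>
  have distinct: "\<mu> k a \<noteq> \<mu> k b" if ab: "a < b" "b < N" for k a b
  proof
    assume eq: "\<mu> k a = \<mu> k b"
    define m where "m = N - b + k"
    obtain i where i: "b - a = Suc i" using ab by (metis Suc_diff_Suc)
    have "N - a + k = m + Suc i" using ab i by (simp add: m_def)
    then have "\<mu> k a = (\<psi> ^^ m) ((\<psi> ^^ Suc i) (w a))" by (simp only: \<mu>_def funpow_add o_apply)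
    moreover have "\<mu> k b = (\<psi> ^^ m) (w b)" by (simp add: \<mu>_def m_def)
    ultimately have "(\<psi> ^^ Suc i) (w a) = w b"
      using eq \<psi>_inv[OF \<psi>_rng[OF w(1,2), THEN conjunct1] \<psi>_rng[OF w(1,2), THEN conjunct2], of m "Suc i" a]
        \<psi>_inv[OF w(1,2), of m b] by simp
    then have "decimation n (\<psi> ((\<psi> ^^ i) (w a))) = decimation n (w b)" by simp
    then have "(\<psi> ^^ i) (w a) = (\<phi> ^^ b) z"
      using \<psi>[of "(\<psi> ^^ i) (w a)"] \<psi>_rng[OF w(1,2), of i a] w(3) by simp
    moreover obtain b' where b': "b = Suc b'" using ab by (cases b) auto
    have "(\<phi> ^^ b) z \<le> 1 / 10"
      using \<phi>[of "(\<phi> ^^ b') z"] rng[OF z1, of b'] z1 origin_bound_le[OF n] by (auto simp: b')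
    ultimately show False using \<psi>_rng[OF w(1,2), of i a] by simp
  qed
  \<comment> \<open>The exponent \<open>N + 3\<close> consists of \<open>N + 2\<close> from the
    level and one factor \<open>r\<close> from the Lipschitz constant of \<open>L\<close>.\<close>
  have "(\<lambda>k. r ^ (N + 3) * (r / q) ^ k) \<longlonglongrightarrow> r ^ (N + 3) * 0"
    using q(1) r by (intro tendsto_mult_left LIMSEQ_realpow_zero) auto
  then have "\<forall>\<^sub>F k in sequentially. r ^ (N + 3) * (r / q) ^ k < \<epsilon>"
    using eps by (intro order_tendstoD) auto
  then obtain k where k: "r ^ (N + 3) * (r / q) ^ k < \<epsilon>"
    unfolding eventually_sequentially by blast
  define ev where "ev a = r ^ (N + 2 + k) * L (\<mu> k a)" for a
  have ev_in: "ev a \<in> neumann_eigenvalues n" if "a < N" for a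
  proof -
    have m: "0 \<le> \<mu> k a" "\<mu> k a \<le> 15 / 16" using \<mu>_rng[of k a] by auto
    show ?thesis
      unfolding ev_def r_def
      by (rule preimage_eigenvalue[OF n pre[OF that] m \<phi> third rng[OF m] L(1)[OF m]])
  qed
  have L_le: "\<mu> k b - \<mu> k a \<le> L (\<mu> k b) - L (\<mu> k a)" "L (\<mu> k b) - L (\<mu> k a) \<le> r * (\<mu> k b - \<mu> k a)"
    if "\<mu> k a \<le> \<mu> k b" for a b
    using L(2)[OF _ that \<mu>_rng(2)] \<mu>_rng(1)[of k a] unfolding r_def by auto
  have ev_inj: "inj_on ev {..<N}"
  proof (rule inj_onI)
    fix a b assume "a \<in> {..<N}" "b \<in> {..<N}" "ev a = ev b"
    then have "L (\<mu> k a) = L (\<mu> k b)" using r by (simp add: ev_def)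
    then have "\<mu> k a = \<mu> k b"
      using L_le(1)[of a b] L_le(1)[of b a] by linarith
    then show "a = b"
      using distinct[of a b k] distinct[of b a k] \<open>a \<in> {..<N}\<close> \<open>b \<in> {..<N}\<close>
      by (cases a b rule: linorder_cases) auto
  qed
  have close: "ev b - ev a \<le> \<epsilon>" if ab: "a < N" "b < N" for a b
  proof (cases "\<mu> k a \<le> \<mu> k b")
    case True
    have "\<mu> k b - \<mu> k a \<le> (1 / q) ^ k"
    proof -
      \<comment> \<open>Since \<open>c < N\<close> is spent separately, all points are images under
        the same iterate of \<open>\<psi>\<close> of points in the upper window, so the contraction
        applies with \<open>k\<close> steps.\<close>
      have s: "\<mu> k c = (\<psi> ^^ k) ((\<psi> ^^ (N - c)) (w c))" for c
        by (simp add: \<mu>_def funpow_add add.commute)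
      have "\<bar>\<mu> k b - \<mu> k a\<bar> \<le> (1 / q) ^ k"
        unfolding s using \<psi>_rng[OF w(1,2)] by (intro contract) auto
      then show ?thesis by linarith
    qed
    then have "r * (\<mu> k b - \<mu> k a) \<le> r * (1 / q) ^ k" using r by (intro mult_left_mono) auto
    then have "L (\<mu> k b) - L (\<mu> k a) \<le> r * (1 / q) ^ k" using L_le(2)[OF True] by linarith
    then have "r ^ (N + 2 + k) * (L (\<mu> k b) - L (\<mu> k a)) \<le> r ^ (N + 2 + k) * (r * (1 / q) ^ k)"
      using r by (intro mult_left_mono) auto
    also have "\<dots> = r ^ (N + 3) * (r / q) ^ k"
      by (simp add: power_add power_divide eval_nat_numeral)
    finally show ?thesis using k by (simp add: ev_def right_diff_distrib)
  next
    case False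
    then have "L (\<mu> k b) \<le> L (\<mu> k a)" using L_le(1)[of b a] by linarith
    then have "ev b \<le> ev a" unfolding ev_def using r by (intro mult_left_mono) auto
    then show ?thesis using eps by linarith
  qed
  define S where "S = ev ` {..<N}"
  have S: "finite S" "card S = N" "S \<noteq> {}"
    using ev_inj N by (auto simp: S_def card_image)
  obtain a where a: "a < N" "Min S = ev a"
    using Min_in[OF S(1,3)] unfolding S_def by auto
  have "S \<subseteq> neumann_eigenvalues n \<inter> {Min S..Min S + \<epsilon>}"
  proof
    fix x assume x: "x \<in> S"
    then obtain b where b: "b < N" "x = ev b" unfolding S_def by auto
    have "Min S \<le> x" using x S(1) by simp
    then show "x \<in> neumann_eigenvalues n \<inter> {Min S..Min S + \<epsilon>}"
      using close[OF a(1) b(1)] ev_in[OF b(1)] unfolding a(2) b(2) by auto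
  qed
  then show "\<exists>a. \<exists>S\<subseteq>neumann_eigenvalues n \<inter> {a..a + \<epsilon>}. finite S \<and> card S = N"
    using S by blast
qed

theorem mainTheorem6:
  fixes n :: nat
  assumes "n \<in> {2..9}"
  shows "spectral_clustering (neumann_eigenvalues n)"
  using assms by (intro neumann_eigenvalues_clustering) simp

end
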